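(* Let $d\geq 1$ and let $(c_n)_{n\in\mathbb{N}}$ be a sequence of scalars such that $$\exists\,\alpha>1,\qquad\sum_{j=1}^{+\infty}j^{\gamma(d)}(\ln j)^\alpha\max_{n\in I(j)}|c_n|^2<+\infty.$$ Let $(X_n)_{n\geq 0}$ be an i.i.d. family of symmetric real random variables, not almost surely constant, such that for some $\sigma>0$ one has $\mathbb{E}[e^{rX_1}]\leq e^{\frac12\sigma^2r^2}$ for all $r\in\mathbb{R}$. Denote $$u^\omega_\lambda=\sum_{\lambda_n\leq\lambda}c_nX_n(\omega)\varphi_n,\qquad u^\omega=\sum_{n\geq 0}c_nX_n(\omega)\varphi_n.$$ Then, almost surely, $u^\omega_\lambda\longrightarrow u^\omega$ in $L^\infty(\mathbb{R}^d)$ as $\lambda\to+\infty$. In particular, for almost all $\omega\in\Omega$, $u^\omega$ is a bounded continuous function on $\mathbb{R}^d$.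
   Context: $H=-\Delta+|x|^2$ is the harmonic oscillator on $L^2(\mathbb{R}^d)$; its eigenvalues, counted with multiplicity, are $d=\lambda_0<\lambda_1\leq\lambda_2\leq\cdots$ (as a set, the spectrum is $d+2\mathbb{N}$). $(\varphi_n)_{n\geq 0}$ is any fixed orthonormal basis of $L^2(\mathbb{R}^d)$ with $H\varphi_n=\lambda_n\varphi_n$. For $j\geq 1$, $I(j)=\{n\in\mathbb{N}:2j\leq\lambda_n<2(j+1)\}$ (a maximum over an empty $I(j)$ is $0$). $\gamma(1)=-\frac16$ and $\gamma(d)=\frac d2-1$ for $d\geq 2$. The series $u^\omega$ is a priori defined, almost surely, as a tempered distribution: there is $s\in\mathbb{R}$ with $\sum_n\lambda_n^s|c_n|^2<+\infty$, hence $\sum_n\lambda_n^s|c_nX_n|^2<+\infty$ almost surely. $(\Omega,\mathcal{F},\mathbb{P})$ is the underlying probability space. *)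

theory Defs
  imports "HOL-Probability.Probability"
begin

text \<open>The space \<open>\<real>\<^sup>d\<close> is a type \<open>'a :: euclidean_space\<close> with \<open>d = DIM('a)\<close>
  (automatically \<open>d \<ge> 1\<close>).  Functions on it, and the scalars, are complex valued.\<close>


subsection \<open>Schwartz functions and tempered distributions\<close>

definition partial_deriv :: "'a::euclidean_space \<Rightarrow> ('a \<Rightarrow> complex) \<Rightarrow> 'a \<Rightarrow> complex" where
  "partial_deriv b f = (\<lambda>x. frechet_derivative f (at x) b)"

primrec iter_partial_deriv ::
    "'a::euclidean_space list \<Rightarrow> ('a \<Rightarrow> complex) \<Rightarrow> 'a \<Rightarrow> complex" where
  "iter_partial_deriv [] f = f"
| "iter_partial_deriv (b # bs) f = partial_deriv b (iter_partial_deriv bs f)"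

text \<open>\<open>frechet_derivative\<close> is total, so smoothness is required explicitly: all iterated
  partial derivatives exist and are differentiable everywhere.\<close>

definition schwartz :: "('a::euclidean_space \<Rightarrow> complex) \<Rightarrow> bool" where
  "schwartz f \<longleftrightarrow>
     (\<forall>bs\<in>lists Basis.
        (\<forall>x. iter_partial_deriv bs f differentiable (at x)) \<and>
        (\<forall>k. bounded (range (\<lambda>x. (1 + norm x) ^ k *\<^sub>R iter_partial_deriv bs f x))))"

definition schwartz_seminorm :: "nat \<Rightarrow> ('a::euclidean_space \<Rightarrow> complex) \<Rightarrow> real" where
  "schwartz_seminorm k f =
     (\<Sum>bs\<in>{bs. set bs \<subseteq> Basis \<and> length bs \<le> k}.
        SUP x. (1 + norm x) ^ k * norm (iter_partial_deriv bs f x))"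

text \<open>A tempered distribution is a continuous linear form on the Schwartz space.  It is
  represented by a total function whose values off the Schwartz space are irrelevant.\<close>

definition tempered_distribution :: "(('a::euclidean_space \<Rightarrow> complex) \<Rightarrow> complex) \<Rightarrow> bool" where
  "tempered_distribution u \<longleftrightarrow>
     (\<forall>f g. schwartz f \<longrightarrow> schwartz g \<longrightarrow> u (\<lambda>x. f x + g x) = u f + u g) \<and>
     (\<forall>a f. schwartz f \<longrightarrow> u (\<lambda>x. a * f x) = a * u f) \<and>
     (\<exists>C k. \<forall>f. schwartz f \<longrightarrow> norm (u f) \<le> C * schwartz_seminorm k f)"

text \<open>The bilinear pairing (no complex conjugation).\<close>

definition distr_of_fun :: "('a::euclidean_space \<Rightarrow> complex) \<Rightarrow> ('a \<Rightarrow> complex) \<Rightarrow> complex" where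
  "distr_of_fun f = (\<lambda>\<psi>. LINT x|lborel. f x * \<psi> x)"

definition distr_eq ::
    "(('a::euclidean_space \<Rightarrow> complex) \<Rightarrow> complex) \<Rightarrow> (('a \<Rightarrow> complex) \<Rightarrow> complex) \<Rightarrow> bool" where
  "distr_eq u v \<longleftrightarrow> (\<forall>\<psi>. schwartz \<psi> \<longrightarrow> u \<psi> = v \<psi>)"

definition distr_sums ::
    "(nat \<Rightarrow> ('a::euclidean_space \<Rightarrow> complex) \<Rightarrow> complex) \<Rightarrow> (('a \<Rightarrow> complex) \<Rightarrow> complex) \<Rightarrow> bool" where
  "distr_sums U u \<longleftrightarrow> (\<forall>\<psi>. schwartz \<psi> \<longrightarrow> (\<lambda>n. U n \<psi>) sums u \<psi>)"


subsection \<open>\<open>L\<^sup>2\<close> and \<open>L\<^sup>\<infinity>\<close>\<close>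

definition L2_fun :: "('a::euclidean_space \<Rightarrow> complex) \<Rightarrow> bool" where
  "L2_fun f \<longleftrightarrow> f \<in> borel_measurable lborel \<and> integrable lborel (\<lambda>x. (norm (f x))\<^sup>2)"

definition L2_inner :: "('a::euclidean_space \<Rightarrow> complex) \<Rightarrow> ('a \<Rightarrow> complex) \<Rightarrow> complex" where
  "L2_inner f g = (LINT x|lborel. f x * cnj (g x))"

definition L2_norm :: "('a::euclidean_space \<Rightarrow> complex) \<Rightarrow> real" where
  "L2_norm f = sqrt (LINT x|lborel. (norm (f x))\<^sup>2)"

definition L2_orthonormal_basis :: "(nat \<Rightarrow> 'a::euclidean_space \<Rightarrow> complex) \<Rightarrow> bool" where
  "L2_orthonormal_basis \<phi> \<longleftrightarrow>
     (\<forall>n. L2_fun (\<phi> n)) \<and>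
     (\<forall>m n. L2_inner (\<phi> m) (\<phi> n) = (if m = n then 1 else 0)) \<and>
     (\<forall>f. L2_fun f \<longrightarrow>
        (\<lambda>N. L2_norm (\<lambda>x. f x - (\<Sum>n<N. L2_inner f (\<phi> n) * \<phi> n x))) \<longlonglongrightarrow> 0)"

definition Linf_norm :: "('a::euclidean_space \<Rightarrow> complex) \<Rightarrow> ennreal" where
  "Linf_norm f = esssup lborel (\<lambda>x. ennreal (norm (f x)))"

definition Linf_fun :: "('a::euclidean_space \<Rightarrow> complex) \<Rightarrow> bool" where
  "Linf_fun f \<longleftrightarrow> f \<in> borel_measurable lborel \<and> Linf_norm f < \<infinity>"

text \<open>Convergence in \<open>L\<^sup>\<infinity>\<close> of functions to a tempered distribution: the latter belongs to
  \<open>L\<^sup>\<infinity>\<close>, and the functions converge to it in norm.\<close>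

definition tendsto_Linf ::
    "('i \<Rightarrow> 'a::euclidean_space \<Rightarrow> complex) \<Rightarrow> (('a \<Rightarrow> complex) \<Rightarrow> complex) \<Rightarrow> 'i filter \<Rightarrow> bool" where
  "tendsto_Linf U u F \<longleftrightarrow>
     (\<exists>f. Linf_fun f \<and> distr_eq u (distr_of_fun f) \<and>
          ((\<lambda>i. Linf_norm (\<lambda>x. U i x - f x)) \<longlongrightarrow> 0) F)"


subsection \<open>The harmonic oscillator\<close>

definition laplacian :: "('a::euclidean_space \<Rightarrow> complex) \<Rightarrow> 'a \<Rightarrow> complex" where
  "laplacian f = (\<lambda>x. \<Sum>b\<in>Basis. partial_deriv b (partial_deriv b f) x)"

definition harm_osc :: "('a::euclidean_space \<Rightarrow> complex) \<Rightarrow> 'a \<Rightarrow> complex" where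
  "harm_osc f = (\<lambda>x. - laplacian f x + of_real ((norm x)\<^sup>2) * f x)"

text \<open>The formally self-adjoint expression \<open>-\<Delta> + |x|\<^sup>2\<close> acts on tempered distributions by
  duality.\<close>

definition harm_osc_distr ::
    "(('a::euclidean_space \<Rightarrow> complex) \<Rightarrow> complex) \<Rightarrow> ('a \<Rightarrow> complex) \<Rightarrow> complex" where
  "harm_osc_distr u = (\<lambda>\<psi>. u (harm_osc \<psi>))"

text \<open>The graph of the self-adjoint operator \<open>H\<close> on \<open>L\<^sup>2\<close>, whose domain consists of the
  \<open>f \<in> L\<^sup>2\<close> such that \<open>-\<Delta>f + |x|\<^sup>2f\<close>, computed in the sense of distributions, is in \<open>L\<^sup>2\<close>.\<close>

definition harm_osc_L2 :: "('a::euclidean_space \<Rightarrow> complex) \<Rightarrow> ('a \<Rightarrow> complex) \<Rightarrow> bool" where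
  "harm_osc_L2 f g \<longleftrightarrow>
     L2_fun f \<and> L2_fun g \<and> distr_eq (harm_osc_distr (distr_of_fun f)) (distr_of_fun g)"

definition spectral_window :: "(nat \<Rightarrow> real) \<Rightarrow> nat \<Rightarrow> nat set" where
  "spectral_window lam j = {n. 2 * real j \<le> lam n \<and> lam n < 2 * (real j + 1)}"

definition window_max :: "(nat \<Rightarrow> real) \<Rightarrow> (nat \<Rightarrow> complex) \<Rightarrow> nat \<Rightarrow> real" where
  "window_max lam c j =
     (if spectral_window lam j = {} then 0
      else Max ((\<lambda>n. (norm (c n))\<^sup>2) ` spectral_window lam j))"

definition gamma_exp :: "nat \<Rightarrow> real" where
  "gamma_exp d = (if d = 1 then - 1 / 6 else real d / 2 - 1)"

end

theory Submission
  imports Defs "HOL-Computational_Algebra.Formal_Power_Series"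
begin

text \<open>By completeness of the tensor products of Hermite functions, every eigenfunction in the
  given orthonormal family is almost everywhere a finite combination of Hermite functions of one
  fixed degree \<open>k\<close>, and Bessel's inequality bounds the sum of \<open>\<bar>\<phi>\<^sub>n(x)\<bar>\<^sup>2\<close> over one eigenspace by
  the sum of the squares of those Hermite functions, which is \<open>O(k\<^bsup>\<gamma>(d)\<^esup>)\<close> uniformly in \<open>x\<close>.  For
  \<open>d = 1\<close> this is a WKB estimate up to the turning point; for \<open>d = 2\<close> the sum is rotation
  invariant and can be evaluated on an axis; the remaining dimensions follow by convolution with
  the bound \<open>O(k\<^bsup>1/2\<^esup>)\<close> for the partial sums in each further variable.  Hence, at each point, the
  block of the random series with levels between \<open>N\<close> and \<open>N\<^sup>2\<close> is subgaussian with variance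
  \<open>O((ln N)\<^bsup>-\<alpha>\<^esup>)\<close>; a union bound over a net of polynomial size costs a factor \<open>ln N\<close> in the square
  of the supremum, and the bounds \<open>(ln N)\<^bsup>(1-\<alpha>)/2\<^esup>\<close> are summable along \<open>N = 2\<^bsup>2\<^sup>m\<^esup>\<close>.\<close>

subsection \<open>Hermite functions on the line\<close>

text \<open>The basis is arbitrary, so a single eigenfunction admits no better pointwise bound than
  its whole eigenspace; the sum of squares over an eigenspace is independent of the basis and can be
  computed with tensor products. Multiplying one-dimensional sup bounds is too lossy for this: in
  two variables it gives \<open>k powr (2 / 3)\<close> where a constant is true. On an axis one
  factor is \<open>hermite b 0\<close>, whose square is at most \<open>1 / sqrt (b + 1)\<close>, and
  only the turning point of the other factor has to be followed. The exponent -1/6 for d = 1 is the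
  Airy size at a turning point. The supremum over an unbounded space is reduced to finitely many
  points by two crude polynomial estimates: a Lipschitz constant between the points of a net, and a
  bound of \<open>norm x\<close> times the function outside a large ball. The given eigenfunctions
  are determined only up to null sets, so the estimates concern their continuous representatives,
  and the given functions return at the very end.\<close>

fun hermite :: "nat \<Rightarrow> real \<Rightarrow> real" where
  "hermite 0 x = pi powr (- 1 / 4) * exp (- x\<^sup>2 / 2)"
| "hermite (Suc 0) x = sqrt 2 * x * hermite 0 x"
| "hermite (Suc (Suc n)) x =
     (sqrt 2 * x * hermite (Suc n) x - sqrt (real n + 1) * hermite n x) / sqrt (real n + 2)"

text \<open>The lowering-operator formula for the derivative, fixed before differentiability is
  known. At \<open>n = 0\<close> the truncated index \<open>n - 1\<close> is harmless because its
  coefficient is \<open>sqrt 0\<close>.\<close>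

definition hermite_deriv :: "nat \<Rightarrow> real \<Rightarrow> real" where
  "hermite_deriv n x = sqrt (2 * real n) * hermite (n - 1) x - x * hermite n x"

lemma hermite_Suc:
  "sqrt (real n + 1) * hermite (Suc n) x = sqrt 2 * x * hermite n x - sqrt (real n) * hermite (n - 1) x"
proof (cases n)
  case (Suc m)
  have eq: "sqrt (real (Suc m) + 1) = sqrt (real m + 2)" "sqrt (real (Suc m)) = sqrt (real m + 1)"
    by (simp_all add: add.commute)
  show ?thesis unfolding Suc eq hermite.simps(3) by simp
qed simp

text \<open>The raising form of the same expression. Lowering at \<open>Suc n\<close> and raising at
  \<open>n\<close> involve only \<open>hermite n\<close> and \<open>hermite (Suc n)\<close>, so
  relations between consecutive degrees become identities in two unknowns.\<close>

lemma hermite_deriv_eq_raise: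
  "hermite_deriv n x = x * hermite n x - sqrt (2 * (real n + 1)) * hermite (Suc n) x"
proof -
  have "sqrt (2 * (real n + 1)) * hermite (Suc n) x = sqrt 2 * (sqrt (real n + 1) * hermite (Suc n) x)"
    unfolding real_sqrt_mult by simp
  also have "\<dots> = 2 * x * hermite n x - sqrt (2 * real n) * hermite (n - 1) x"
    unfolding hermite_Suc by (simp add: real_sqrt_mult algebra_simps)
  finally show ?thesis unfolding hermite_deriv_def by simp
qed

lemma hermite_deriv_Suc:
  "hermite_deriv (Suc n) x = sqrt (2 * (real n + 1)) * hermite n x - x * hermite (Suc n) x"
  by (simp add: hermite_deriv_def add.commute)

text \<open>Induction along the recurrence: the derivatives of the two earlier functions are
  expressed in the same pair \<open>H0\<close>, \<open>H1\<close>, by lowering at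
  \<open>Suc n\<close> and raising at \<open>n\<close>.\<close>

lemma has_real_derivative_hermite: "(hermite n has_real_derivative hermite_deriv n x) (at x)"
proof (induction n rule: induct_nat_012)
  case 0
  show ?case
    unfolding hermite_deriv_def hermite.simps(1)[abs_def]
    by (auto intro!: derivative_eq_intros)
next
  case 1
  show ?case
    unfolding hermite_deriv_def hermite.simps(1,2)[abs_def]
    by (auto intro!: derivative_eq_intros simp: power2_eq_square algebra_simps)
next
  case (ge2 n)
  have c: "sqrt (real n + 2) \<noteq> 0" by simp
  have "(hermite (Suc (Suc n)) has_real_derivative
      (sqrt 2 * hermite (Suc n) x + sqrt 2 * x * hermite_deriv (Suc n) x
        - sqrt (real n + 1) * hermite_deriv n x) / sqrt (real n + 2)) (at x)"
    unfolding hermite.simps(3)[abs_def]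
    by (rule derivative_eq_intros ge2 refl)+ (use c in \<open>simp_all add: field_simps\<close>)
  moreover have "(sqrt 2 * hermite (Suc n) x + sqrt 2 * x * hermite_deriv (Suc n) x
        - sqrt (real n + 1) * hermite_deriv n x) / sqrt (real n + 2) = hermite_deriv (Suc (Suc n)) x"
  proof -
    define a where "a = sqrt (real n + 1)"
    define b where "b = sqrt (real n + 2)"
    define H0 where "H0 = hermite n x"
    define H1 where "H1 = hermite (Suc n) x"
    define s where "s = sqrt 2"
    have a2: "a * a = real n + 1" "b * b = real n + 2" "s * s = 2" and b0: "b > 0"
      by (simp_all add: a_def b_def s_def)
    have h2: "hermite (Suc (Suc n)) x = (s * x * H1 - a * H0) / b"
      by (simp add: a_def b_def H0_def H1_def s_def)
    have "2 * (real (Suc n) + 1) = 2 * (real n + 2)" by simp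
    then have "sqrt (2 * (real (Suc n) + 1)) = s * b"
      unfolding b_def s_def real_sqrt_mult[symmetric] by (rule arg_cong)
    then have d2: "hermite_deriv (Suc (Suc n)) x = s * b * H1 - x * ((s * x * H1 - a * H0) / b)"
      unfolding hermite_deriv_Suc h2 H1_def by simp
    have d1: "hermite_deriv (Suc n) x = s * a * H0 - x * H1"
      unfolding hermite_deriv_Suc real_sqrt_mult a_def s_def H0_def H1_def by simp
    have d0: "hermite_deriv n x = x * H0 - s * a * H1"
      unfolding hermite_deriv_eq_raise real_sqrt_mult a_def s_def H0_def H1_def by simp
    \<comment> \<open>The coefficients of \<open>s * H1\<close> match because
      \<open>1 + a * a = b * b\<close>.\<close>
    have "s * H1 + s * x * (s * a * H0 - x * H1) - a * (x * H0 - s * a * H1)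
        = b * (s * b * H1) - x * (s * x * H1 - a * H0)"
    proof -
      have "s * H1 + s * x * (s * a * H0 - x * H1) - a * (x * H0 - s * a * H1)
        = s * H1 + (s * s) * x * a * H0 - s * x * x * H1 - a * x * H0 + s * (a * a) * H1"
        by (simp add: algebra_simps)
      also have "\<dots> = s * (b * b) * H1 - s * x * x * H1 + x * a * H0"
        unfolding a2 by (simp add: algebra_simps)
      finally show ?thesis by (simp add: algebra_simps)
    qed
    then show ?thesis
      unfolding d1 d0 d2 H1_def[symmetric] s_def[symmetric] a_def[symmetric] b_def[symmetric]
      using b0 by (simp add: field_simps)
  qed
  ultimately show ?case by (simp only:)
qed

text \<open>Read as \<open>h'' = - q h\<close> with \<open>q = 2n + 1 - x\<^sup>2\<close>, this is
  the equation behind the energy, amplitude and convexity arguments.\<close>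

lemma has_real_derivative_hermite_deriv:
  "(hermite_deriv n has_real_derivative (x\<^sup>2 - (2 * real n + 1)) * hermite n x) (at x)"
proof -
  have "(hermite_deriv n has_real_derivative
      sqrt (2 * real n) * hermite_deriv (n - 1) x - hermite n x - x * hermite_deriv n x) (at x)"
    unfolding hermite_deriv_def[of n, abs_def]
    by (auto intro!: derivative_eq_intros has_real_derivative_hermite simp: hermite_deriv_def[of n])
  moreover have "sqrt (2 * real n) * hermite_deriv (n - 1) x - hermite n x - x * hermite_deriv n x
      = (x\<^sup>2 - (2 * real n + 1)) * hermite n x"
  proof (cases n)
    case 0
    then show ?thesis by (simp add: hermite_deriv_def power2_eq_square algebra_simps)
  next
    case (Suc m)
    have "sqrt (2 * (real m + 1)) * sqrt (2 * (real m + 1)) = 2 * (real m + 1)" by simp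
    then have "sqrt (2 * (real m + 1)) * (sqrt (2 * (real m + 1)) * hermite (Suc m) x)
        = 2 * (real m + 1) * hermite (Suc m) x" by (simp only: mult.assoc[symmetric])
    then show ?thesis
      unfolding Suc hermite_deriv_Suc
      by (simp add: hermite_deriv_eq_raise add.commute power2_eq_square algebra_simps)
  qed
  ultimately show ?thesis by simp
qed

section \<open>Parity, values at the origin and decay\<close>

lemma hermite_minus: "hermite n (- x) = (- 1) ^ n * hermite n x"
  by (induction n rule: induct_nat_012) (simp_all add: field_simps)

lemma hermite_abs_square: "(hermite n \<bar>x\<bar>)\<^sup>2 = (hermite n x)\<^sup>2"
  by (cases "x \<ge> 0") (simp_all add: hermite_minus power_mult_distrib flip: power_mult)

text \<open>At the origin the recurrence links degrees of equal parity: the square is multiplied by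
  \<open>(n + 1) / (n + 2)\<close>, and \<open>sqrt ((n + 1) * (n + 3)) \<le> n + 2\<close>
  preserves the bound.\<close>

lemma hermite_zero_square_le: "(hermite n 0)\<^sup>2 \<le> 1 / sqrt (real n + 1)"
proof (induction n rule: induct_nat_012)
  case 0
  have "pi powr (- 1 / 4) \<le> pi powr 0"
    by (rule powr_mono) (use pi_gt3 in auto)
  then show ?case by (simp add: power_le_one)
next
  case 1
  then show ?case by simp
next
  case (ge2 n)
  have "(hermite (Suc (Suc n)) 0)\<^sup>2 = (real n + 1) / (real n + 2) * (hermite n 0)\<^sup>2"
    by (simp add: power_mult_distrib power_divide)
  also have "\<dots> \<le> (real n + 1) / (real n + 2) * (1 / sqrt (real n + 1))"
    using ge2 by (intro mult_left_mono) auto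
  also have "\<dots> = sqrt (real n + 1) / (real n + 2)"
    using real_div_sqrt[of "real n + 1"] by (simp add: mult.commute flip: divide_divide_eq_left)
  also have "\<dots> \<le> 1 / sqrt (real (Suc (Suc n)) + 1)"
  proof -
    have "sqrt (real n + 1) * sqrt (real n + 3) = sqrt ((real n + 1) * (real n + 3))"
      by (simp add: real_sqrt_mult)
    also have "\<dots> \<le> sqrt ((real n + 2)\<^sup>2)"
      by (intro real_sqrt_le_mono) (simp add: power2_eq_square algebra_simps)
    finally have "sqrt (real n + 1) * sqrt (real n + 3) \<le> real n + 2" by simp
    then show ?thesis by (simp add: field_simps add.commute)
  qed
  finally show ?case .
qed

lemma hermite_0_decay:
  "\<exists>C. \<forall>x. \<bar>x\<bar> ^ k * \<bar>hermite 0 x\<bar> \<le> C"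
proof -
  have "\<bar>x\<bar> ^ k * \<bar>hermite 0 x\<bar> \<le> 2 ^ k * fact k + 1" for x
  proof -
    have c: "pi powr (- 1 / 4) \<le> pi powr 0"
      by (rule powr_mono) (use pi_gt3 in auto)
    \<comment> \<open>A single term of the exponential series, taken at
      \<open>x\<^sup>2 / 2\<close>, dominates the power of \<open>x\<close>.\<close>
    have "y ^ k / fact k \<le> exp y" if "y \<ge> 0" for y :: real
    proof -
      have "(\<Sum>n\<in>{k}. y ^ n /\<^sub>R fact n) \<le> exp y"
        unfolding exp_def by (rule sum_le_suminf[OF summable_exp_generic]) (use that in auto)
      then show ?thesis by (simp add: divide_inverse_commute)
    qed
    then have "(x\<^sup>2 / 2) ^ k / fact k \<le> exp (x\<^sup>2 / 2)" by simp
    then have "(x\<^sup>2 / 2) ^ k \<le> fact k * exp (x\<^sup>2 / 2)"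
      by (simp add: pos_divide_le_eq mult.commute)
    then have "(x\<^sup>2) ^ k \<le> 2 ^ k * fact k * exp (x\<^sup>2 / 2)"
      by (simp add: power_divide pos_divide_le_eq mult_ac)
    then have "x ^ (2 * k) \<le> 2 ^ k * fact k * exp (x\<^sup>2 / 2)"
      by (simp only: power_mult)
    then have 1: "x ^ (2 * k) * exp (- (x\<^sup>2 / 2)) \<le> 2 ^ k * fact k"
      by (simp add: exp_minus field_simps)
    have 2: "\<bar>x\<bar> ^ k \<le> x ^ (2 * k) + 1"
    proof (cases "\<bar>x\<bar> \<le> 1")
      case True
      then have "\<bar>x\<bar> ^ k \<le> 1" by (simp add: power_le_one)
      moreover have "0 \<le> x ^ (2 * k)" by (simp add: power_mult)
      ultimately show ?thesis by linarith
    next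
      case False
      then have "\<bar>x\<bar> ^ k \<le> \<bar>x\<bar> ^ (2 * k)" by (intro power_increasing) auto
      also have "\<dots> = x ^ (2 * k)" by (simp add: power_mult)
      finally show ?thesis by linarith
    qed
    have "\<bar>x\<bar> ^ k * \<bar>hermite 0 x\<bar> = pi powr (- 1 / 4) * (\<bar>x\<bar> ^ k * exp (- (x\<^sup>2 / 2)))"
      by (simp add: abs_mult)
    also have "\<dots> \<le> 1 * (\<bar>x\<bar> ^ k * exp (- (x\<^sup>2 / 2)))"
      using c by (intro mult_right_mono) auto
    also have "\<dots> \<le> (x ^ (2 * k) + 1) * exp (- (x\<^sup>2 / 2))"
      using 2 by (simp add: mult_right_mono)
    also have "\<dots> = x ^ (2 * k) * exp (- (x\<^sup>2 / 2)) + exp (- (x\<^sup>2 / 2))"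
      by (simp add: algebra_simps)
    also have "\<dots> \<le> 2 ^ k * fact k + 1"
      using 1 by (intro add_mono) auto
    finally show ?thesis .
  qed
  then show ?thesis by blast
qed

lemma hermite_decay:
  "\<exists>C. \<forall>x. \<bar>x\<bar> ^ k * \<bar>hermite n x\<bar> \<le> C"
proof (induction n arbitrary: k rule: induct_nat_012)
  case 0
  show ?case by (rule hermite_0_decay)
next
  case 1
  obtain C where C: "\<And>x. \<bar>x\<bar> ^ Suc k * \<bar>hermite 0 x\<bar> \<le> C" using hermite_0_decay by blast
  have "\<bar>x\<bar> ^ k * \<bar>hermite (Suc 0) x\<bar> \<le> sqrt 2 * C" for x
    using C[of x] by (simp add: abs_mult mult_ac del: hermite.simps(1))
  then show ?case by blast
next
  case (ge2 n)
  obtain C where C: "\<And>x. \<bar>x\<bar> ^ k * \<bar>hermite n x\<bar> \<le> C" using ge2(1)[of k] by blast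
  obtain D where D: "\<And>x. \<bar>x\<bar> ^ Suc k * \<bar>hermite (Suc n) x\<bar> \<le> D" using ge2(2)[of "Suc k"] by blast
  have "\<bar>x\<bar> ^ k * \<bar>hermite (Suc (Suc n)) x\<bar> \<le> sqrt 2 * D + sqrt (real n + 1) * C" for x
  proof -
    have "\<bar>hermite (Suc (Suc n)) x\<bar> * 1
        \<le> \<bar>hermite (Suc (Suc n)) x\<bar> * sqrt (real n + 2)"
      by (rule mult_left_mono) auto
    also have "\<dots> = \<bar>sqrt 2 * x * hermite (Suc n) x - sqrt (real n + 1) * hermite n x\<bar>"
      by (simp add: abs_mult)
    also have "\<dots> \<le> \<bar>sqrt 2 * x * hermite (Suc n) x\<bar> + \<bar>sqrt (real n + 1) * hermite n x\<bar>"
      by (rule abs_triangle_ineq4)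
    also have "\<dots> = sqrt 2 * \<bar>x\<bar> * \<bar>hermite (Suc n) x\<bar> + sqrt (real n + 1) * \<bar>hermite n x\<bar>"
      by (simp add: abs_mult)
    finally have "\<bar>x\<bar> ^ k * \<bar>hermite (Suc (Suc n)) x\<bar> \<le>
        \<bar>x\<bar> ^ k * (sqrt 2 * \<bar>x\<bar> * \<bar>hermite (Suc n) x\<bar> + sqrt (real n + 1) * \<bar>hermite n x\<bar>)"
      by (intro mult_left_mono) auto
    also have "\<dots> = sqrt 2 * (\<bar>x\<bar> ^ Suc k * \<bar>hermite (Suc n) x\<bar>) + sqrt (real n + 1) * (\<bar>x\<bar> ^ k * \<bar>hermite n x\<bar>)"
      by (simp add: algebra_simps)
    also have "\<dots> \<le> sqrt 2 * D + sqrt (real n + 1) * C"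
      using C D by (intro add_mono mult_left_mono) auto
    finally show ?thesis .
  qed
  then show ?case by blast
qed

lemma tendsto_hermite_at_infinity: "((\<lambda>x. x ^ k * hermite n x) \<longlongrightarrow> 0) at_infinity"
proof -
  obtain C where C: "\<And>x. \<bar>x\<bar> ^ Suc k * \<bar>hermite n x\<bar> \<le> C" using hermite_decay by blast
  show ?thesis
  proof (rule Lim_null_comparison)
    show "\<forall>\<^sub>F x in at_infinity. norm (x ^ k * hermite n x) \<le> C * inverse (norm x)"
      unfolding eventually_at_infinity
    proof (intro exI allI impI)
      fix x :: real assume "norm x \<ge> 1"
      then show "norm (x ^ k * hermite n x) \<le> C * inverse (norm x)"
        using C[of x] by (simp add: abs_mult power_abs field_simps)
    qed
    have "((\<lambda>x::real. C * inverse (norm x)) \<longlongrightarrow> C * 0) at_infinity"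
      by (intro tendsto_mult_left tendsto_inverse_0_at_top filterlim_at_infinity_imp_norm_at_top filterlim_ident)
    then show "((\<lambda>x::real. C * inverse (norm x)) \<longlongrightarrow> 0) at_infinity" by simp
  qed
qed

lemma tendsto_power_mult_hermite: "((\<lambda>x. x ^ k * hermite n x) \<longlongrightarrow> 0) at_top"
  by (rule tendsto_mono[OF at_top_le_at_infinity tendsto_hermite_at_infinity])

lemma tendsto_hermite_deriv: "(hermite_deriv n \<longlongrightarrow> 0) at_top"
proof -
  have "((\<lambda>x. sqrt (2 * real n) * (x ^ 0 * hermite (n - 1) x) - x ^ 1 * hermite n x)
      \<longlongrightarrow> sqrt (2 * real n) * 0 - 0) at_top"
    by (intro tendsto_intros tendsto_power_mult_hermite)
  then show ?thesis by (simp add: hermite_deriv_def[abs_def])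
qed

section \<open>Energy of the oscillation, and pointwise bounds across the turning point\<close>

definition hermite_energy :: "nat \<Rightarrow> real \<Rightarrow> real" where
  "hermite_energy n x = (hermite_deriv n x)\<^sup>2 + (2 * real n + 1 - x\<^sup>2) * (hermite n x)\<^sup>2"

text \<open>Since \<open>h'' = - q h\<close>, the energy \<open>h'\<^sup>2 + q h\<^sup>2\<close>
  changes only through \<open>q' = - 2 x\<close>; hence it decreases on the positive
  half-line.\<close>

lemma has_real_derivative_hermite_energy:
  "(hermite_energy n has_real_derivative - 2 * x * (hermite n x)\<^sup>2) (at x)"
  unfolding hermite_energy_def[abs_def]
  by (rule derivative_eq_intros has_real_derivative_hermite has_real_derivative_hermite_deriv refl)+
    (simp add: power2_eq_square algebra_simps)

lemma hermite_energy_antimono: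
  assumes "0 \<le> x" "x \<le> y"
  shows "hermite_energy n y \<le> hermite_energy n x"
  using assms(2)
proof (rule DERIV_nonpos_imp_nonincreasing)
  fix z assume "x \<le> z" "z \<le> y"
  then show "\<exists>d. (hermite_energy n has_real_derivative d) (at z) \<and> d \<le> 0"
    using has_real_derivative_hermite_energy[of n z] assms by (intro exI conjI) auto
qed

text \<open>The energy decreases to its limit 0 at infinity. Beyond the turning point, where its
  second term is negative, this says \<open>\<bar>h'\<bar> \<ge> sqrt (x\<^sup>2 - 2n - 1) *
  \<bar>h\<bar>\<close>.\<close>

lemma hermite_energy_nonneg:
  assumes "0 \<le> x"
  shows "0 \<le> hermite_energy n x"
proof (rule tendsto_upperbound)
  have "((\<lambda>y. (hermite_deriv n y)\<^sup>2 + (2 * real n + 1) * (y ^ 0 * hermite n y)\<^sup>2 - (y ^ 1 * hermite n y)\<^sup>2)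
      \<longlongrightarrow> 0\<^sup>2 + (2 * real n + 1) * 0\<^sup>2 - 0\<^sup>2) at_top"
    by (intro tendsto_intros tendsto_power_mult_hermite tendsto_hermite_deriv)
  then show "(hermite_energy n \<longlongrightarrow> 0) at_top"
    by (simp add: hermite_energy_def[abs_def] algebra_simps power_mult_distrib)
  show "\<forall>\<^sub>F y in at_top. hermite_energy n y \<le> hermite_energy n x"
    using eventually_ge_at_top[of x] by eventually_elim (use assms hermite_energy_antimono in auto)
qed simp

text \<open>The derivative at 0 is \<open>sqrt (2 n) * hermite (n - 1) 0\<close>, so both terms
  reduce to values at the origin; each is allotted half of the constant 3.\<close>

lemma hermite_energy_zero_le: "hermite_energy n 0 \<le> 3 * sqrt (2 * real n + 1)"
proof -
  have "(hermite_deriv n 0)\<^sup>2 \<le> (3 / 2) * sqrt (2 * real n + 1)"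
  proof (cases n)
    case (Suc m)
    have "(hermite_deriv n 0)\<^sup>2 = 2 * (real m + 1) * (hermite m 0)\<^sup>2"
      by (simp add: Suc hermite_deriv_Suc power_mult_distrib)
    also have "\<dots> \<le> 2 * (real m + 1) * (1 / sqrt (real m + 1))"
      using hermite_zero_square_le by (intro mult_left_mono) auto
    also have "\<dots> = 2 * sqrt (real m + 1)"
    proof -
      define r where "r = sqrt (real m + 1)"
      have "r > 0" "r * r = real m + 1" by (simp_all add: r_def)
      then show ?thesis unfolding r_def[symmetric] by (simp add: field_simps)
    qed
    also have "\<dots> = sqrt (4 * (real m + 1))" unfolding real_sqrt_mult by simp
    also have "\<dots> \<le> sqrt ((3 / 2)\<^sup>2 * (2 * real n + 1))"
      by (intro real_sqrt_le_mono) (simp add: Suc power2_eq_square)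
    finally show ?thesis by (simp add: real_sqrt_mult)
  qed (simp add: hermite_deriv_def)
  moreover have "(2 * real n + 1) * (hermite n 0)\<^sup>2 \<le> (3 / 2) * sqrt (2 * real n + 1)"
  proof -
    have "(2 * real n + 1) * (hermite n 0)\<^sup>2 \<le> (2 * real n + 1) * (1 / sqrt (real n + 1))"
      using hermite_zero_square_le by (intro mult_left_mono) auto
    also have "\<dots> = sqrt (2 * real n + 1) * sqrt (2 * real n + 1) / sqrt (real n + 1)" by simp
    also have "\<dots> \<le> sqrt (2 * real n + 1) * (3 / 2 * sqrt (real n + 1)) / sqrt (real n + 1)"
    proof -
      have "sqrt (2 * real n + 1) \<le> sqrt ((3 / 2)\<^sup>2 * (real n + 1))"
        by (intro real_sqrt_le_mono) (simp add: power2_eq_square)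
      also have "\<dots> = 3 / 2 * sqrt (real n + 1)" unfolding real_sqrt_mult real_sqrt_abs by simp
      finally show ?thesis by (rule divide_right_mono[OF mult_left_mono]) auto
    qed
    finally show ?thesis by simp
  qed
  ultimately show ?thesis by (simp add: hermite_energy_def)
qed

text \<open>The WKB amplitude is \<open>hermite_energy n y / sqrt q\<close> with \<open>q = 2n + 1 - y\<^sup>2\<close>.  Subtracting
  \<open>p h h'\<close> with \<open>p = y / q\<^bsup>3/2\<^esup>\<close> cancels the non-oscillating part of its derivative.\<close>

lemma hermite_energy_le_sqrt:
  assumes x: "0 \<le> x" and q: "x\<^sup>2 < 2 * real n + 1"
    and zone: "x \<le> sqrt (2 * real n + 1 - x\<^sup>2) ^ 3"
  shows "hermite_energy n x \<le> 18 * sqrt (2 * real n + 1 - x\<^sup>2)"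
proof -
  define s where "s y = sqrt (2 * real n + 1 - y\<^sup>2)" for y
  define h where "h = hermite n"
  define h' where "h' = hermite_deriv n"
  define p where "p y = y / s y ^ 3" for y
  define V where "V y = (h' y)\<^sup>2 / s y + s y * (h y)\<^sup>2 - p y * (h y * h' y)" for y
  have sx: "s x > 0" using q by (simp add: s_def)
  have s_ge: "s x \<le> s y" if "0 \<le> y" "y \<le> x" for y
    unfolding s_def using that by (intro real_sqrt_le_mono) (simp add: power_mono)
  have s_pos: "s y > 0" if "0 \<le> y" "y \<le> x" for y
    using s_ge[OF that] sx by linarith
  have s_sq: "(s y)\<^sup>2 = 2 * real n + 1 - y\<^sup>2" if "0 \<le> y" "y \<le> x" for y
    using s_pos[OF that] by (simp add: s_def)
  \<comment> \<open>\<open>zone\<close> says that \<open>p x \<le> 1\<close>; since \<open>s\<close>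
    decreases, \<open>p\<close> is no larger at earlier points.\<close>
  have p_le: "p y \<le> 1" "0 \<le> p y" if "0 \<le> y" "y \<le> x" for y
  proof -
    have "y \<le> x" using that by simp
    also have "x \<le> s x ^ 3" using zone by (simp add: s_def)
    also have "\<dots> \<le> s y ^ 3" using s_ge[OF that] sx by (intro power_mono) auto
    finally show "p y \<le> 1" using s_pos[OF that] by (simp add: p_def)
    show "0 \<le> p y" using s_pos[OF that] that by (simp add: p_def)
  qed
  have hh: "2 * \<bar>h y * h' y\<bar> \<le> (h' y)\<^sup>2 / s y + s y * (h y)\<^sup>2" if "0 \<le> y" "y \<le> x" for y
  proof -
    have "0 \<le> (\<bar>h' y\<bar> - s y * \<bar>h y\<bar>)\<^sup>2 / s y" using s_pos[OF that] by simp
    also have "\<dots> = (h' y)\<^sup>2 / s y + s y * (h y)\<^sup>2 - 2 * \<bar>h y * h' y\<bar>"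
      using s_pos[OF that] by (simp add: power2_diff field_simps power2_eq_square abs_mult)
    finally show ?thesis by simp
  qed
  \<comment> \<open>By \<open>hh\<close>, subtracting \<open>p h h'\<close> with
    \<open>p \<le> 1\<close> removes at most half of the amplitude, so \<open>V\<close> controls
    both the amplitude and \<open>\<bar>h h'\<bar>\<close>.\<close>
  have V_ge: "\<bar>h y * h' y\<bar> \<le> V y \<and> (h' y)\<^sup>2 / s y + s y * (h y)\<^sup>2 \<le> 2 * V y"
    if "0 \<le> y" "y \<le> x" for y
  proof -
    have "p y * (h y * h' y) \<le> p y * \<bar>h y * h' y\<bar>"
      using p_le[OF that] by (intro mult_left_mono) auto
    also have "\<dots> \<le> 1 * \<bar>h y * h' y\<bar>"
      using p_le[OF that] by (intro mult_right_mono) auto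
    finally have "p y * (h y * h' y) \<le> \<bar>h y * h' y\<bar>" by simp
    moreover have "c \<le> a + b - d \<and> a + b \<le> 2 * (a + b - d)" if "d \<le> c" "2 * c \<le> a + b" for a b c d :: real
      using that by auto
    ultimately show ?thesis using hh[OF that] unfolding V_def by blast
  qed
  \<comment> \<open>After the cancellation \<open>V' = - p' h h'\<close>, and
    \<open>\<bar>h h'\<bar> \<le> V\<close> gives \<open>V' \<le> p' V\<close>. This is Gronwall's
    inequality with integrating factor \<open>exp (- p)\<close>; its total cost is
    \<open>exp (p x) \<le> exp 1\<close>.\<close>
  have "V x * exp (- p x) \<le> V 0 * exp (- p 0)"
    using x
  proof (rule DERIV_nonpos_imp_nonincreasing)
    fix y assume y: "0 \<le> y" "y \<le> x"
    note sp = s_pos[OF y]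
    have ds: "(s has_real_derivative - y / s y) (at y)"
      using sp unfolding s_def[abs_def]
      by (auto intro!: derivative_eq_intros simp: field_simps)
    have dh: "(h has_real_derivative h' y) (at y)"
      unfolding h_def h'_def by (rule has_real_derivative_hermite)
    have dh': "(h' has_real_derivative - (s y)\<^sup>2 * h y) (at y)"
      unfolding h_def h'_def s_sq[OF y] using has_real_derivative_hermite_deriv[of n y]
      by (simp add: algebra_simps)
    define p' where "p' = 1 / s y ^ 3 + 3 * y\<^sup>2 / s y ^ 5"
    have dp: "(p has_real_derivative p') (at y)"
      unfolding p_def[abs_def] p'_def using sp
      by (auto intro!: derivative_eq_intros ds simp: field_simps power2_eq_square eval_nat_numeral)
    have dA: "((\<lambda>y. (h' y)\<^sup>2) has_real_derivative 2 * h' y * (- (s y)\<^sup>2 * h y)) (at y)"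
      by (rule derivative_eq_intros dh' refl)+ simp
    have dC: "((\<lambda>y. (h y)\<^sup>2) has_real_derivative 2 * h y * h' y) (at y)"
      by (rule derivative_eq_intros dh refl)+ simp
    have "(V has_real_derivative
        (2 * h' y * (- (s y)\<^sup>2 * h y) * s y - (h' y)\<^sup>2 * (- y / s y)) / (s y * s y)
        + (- y / s y * (h y)\<^sup>2 + 2 * h y * h' y * s y)
        - (p' * (h y * h' y) + (h' y * h' y + - (s y)\<^sup>2 * h y * h y) * p y)) (at y)"
      unfolding V_def[abs_def]
      using DERIV_diff[OF DERIV_add[OF DERIV_divide[OF dA ds] DERIV_mult[OF ds dC]]
          DERIV_mult[OF dp DERIV_mult[OF dh dh']]] sp by simp
    moreover have "(2 * h' y * (- (s y)\<^sup>2 * h y) * s y - (h' y)\<^sup>2 * (- y / s y)) / (s y * s y)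
        + (- y / s y * (h y)\<^sup>2 + 2 * h y * h' y * s y)
        - (p' * (h y * h' y) + (h' y * h' y + - (s y)\<^sup>2 * h y * h y) * p y) = - p' * (h y * h' y)"
      unfolding p_def using sp by (simp add: field_simps power2_eq_square eval_nat_numeral)
    ultimately have dV: "(V has_real_derivative - p' * (h y * h' y)) (at y)" by (simp only:)
    have "((\<lambda>y. V y * exp (- p y)) has_real_derivative - p' * (h y * h' y + V y) * exp (- p y)) (at y)"
      by (auto intro!: derivative_eq_intros dV dp simp: algebra_simps)
    moreover have "- p' * (h y * h' y + V y) * exp (- p y) \<le> 0"
    proof -
      have "p' \<ge> 0" unfolding p'_def using sp by auto
      moreover have "h y * h' y + V y \<ge> 0" using V_ge[OF y] by linarith
      ultimately show ?thesis by (simp add: mult_nonneg_nonneg)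
    qed
    ultimately show "\<exists>d. ((\<lambda>y. V y * exp (- p y)) has_real_derivative d) (at y) \<and> d \<le> 0" by blast
  qed
  then have "V x \<le> exp (p x) * V 0"
    by (simp add: p_def exp_minus field_simps)
  also have "V 0 = hermite_energy n 0 / s 0"
  proof -
    have "hermite_energy n 0 = (h' 0)\<^sup>2 + (s 0)\<^sup>2 * (h 0)\<^sup>2"
      using s_sq[of 0] x by (simp add: hermite_energy_def h_def h'_def)
    then show ?thesis
      using s_pos[of 0] x by (simp add: V_def p_def field_simps power2_eq_square)
  qed
  \<comment> \<open>The constants multiply: \<open>V 0 \<le> 3\<close> and
    \<open>exp 1 \<le> 3\<close> give \<open>V x \<le> 9\<close>, and the amplitude is at most
    \<open>2 * V x\<close>.\<close>
  also have "\<dots> \<le> 3"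
    using hermite_energy_zero_le[of n] by (simp add: s_def field_simps)
  also have "exp (p x) * 3 \<le> exp 1 * 3" using p_le(1)[of x] x by simp
  also have "\<dots> \<le> 9" using exp_le by simp
  finally have Vx: "V x \<le> 9" by simp
  have "hermite_energy n x = s x * ((h' x)\<^sup>2 / s x + s x * (h x)\<^sup>2)"
  proof -
    have "hermite_energy n x = (h' x)\<^sup>2 + (s x)\<^sup>2 * (h x)\<^sup>2"
      using s_sq[of x] x by (simp add: hermite_energy_def h_def h'_def)
    then show ?thesis using sx by (simp add: field_simps power2_eq_square)
  qed
  also have "\<dots> \<le> s x * 18"
    using V_ge[of x] x Vx sx by (intro mult_left_mono) auto
  finally show ?thesis by (simp add: s_def mult.commute)
qed

text \<open>Here \<open>(h h')' = h'\<^sup>2 + (x\<^sup>2 - 2n - 1) h\<^sup>2 \<ge> 0\<close>. A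
  positive value of \<open>h h'\<close> would persist and make \<open>h\<^sup>2\<close>
  nondecreasing from there on, against its decay to 0.\<close>

lemma hermite_sq_convex_region:
  assumes "2 * real n + 1 \<le> x\<^sup>2" "0 \<le> x"
  shows "hermite n x * hermite_deriv n x \<le> 0"
proof (rule ccontr)
  assume "\<not> ?thesis"
  then have pos: "hermite n x * hermite_deriv n x > 0" by simp
  have inc: "hermite n x * hermite_deriv n x \<le> hermite n y * hermite_deriv n y" if "x \<le> y" for y
    using that
  proof (rule DERIV_nonneg_imp_nondecreasing)
    fix z assume z: "x \<le> z" "z \<le> y"
    have "((\<lambda>z. hermite n z * hermite_deriv n z) has_real_derivative
        (hermite_deriv n z)\<^sup>2 + (z\<^sup>2 - (2 * real n + 1)) * (hermite n z)\<^sup>2) (at z)"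
      by (rule derivative_eq_intros has_real_derivative_hermite has_real_derivative_hermite_deriv refl)+
        (simp add: power2_eq_square algebra_simps)
    moreover have "x\<^sup>2 \<le> z\<^sup>2" using z assms by (intro power_mono) auto
    then have "0 \<le> (hermite_deriv n z)\<^sup>2 + (z\<^sup>2 - (2 * real n + 1)) * (hermite n z)\<^sup>2"
      using assms by simp
    ultimately show "\<exists>d. ((\<lambda>z. hermite n z * hermite_deriv n z) has_real_derivative d) (at z) \<and> 0 \<le> d"
      by blast
  qed
  have inc2: "(hermite n x)\<^sup>2 \<le> (hermite n y)\<^sup>2" if "x \<le> y" for y
    using that
  proof (rule DERIV_nonneg_imp_nondecreasing)
    fix z assume z: "x \<le> z" "z \<le> y"
    have "((\<lambda>z. (hermite n z)\<^sup>2) has_real_derivative 2 * (hermite n z * hermite_deriv n z)) (at z)"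
      by (rule derivative_eq_intros has_real_derivative_hermite refl)+ simp
    then show "\<exists>d. ((\<lambda>z. (hermite n z)\<^sup>2) has_real_derivative d) (at z) \<and> 0 \<le> d"
      using inc[OF z(1)] pos by (intro exI[of _ "2 * (hermite n z * hermite_deriv n z)"] conjI) auto
  qed
  have "(hermite n x)\<^sup>2 \<le> 0"
  proof (rule tendsto_lowerbound)
    have "((\<lambda>y. (y ^ 0 * hermite n y)\<^sup>2) \<longlongrightarrow> 0\<^sup>2) at_top"
      by (intro tendsto_intros tendsto_power_mult_hermite)
    then show "((\<lambda>y. (hermite n y)\<^sup>2) \<longlongrightarrow> 0) at_top" by simp
    show "\<forall>\<^sub>F y in at_top. (hermite n x)\<^sup>2 \<le> (hermite n y)\<^sup>2"
      using eventually_ge_at_top[of x] by eventually_elim (rule inc2)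
  qed simp
  then show False using pos by auto
qed

text \<open>The twelfth root \<open>u\<close> makes the exponents integral: the turning point is
  \<open>u ^ 6\<close>, the Airy zone before it has width at most \<open>1 / u\<^sup>2\<close>, and
  in it \<open>h\<^sup>2\<close> and \<open>h'\<^sup>2\<close> are at most of order
  \<open>1 / u\<^sup>2\<close> and \<open>u\<^sup>2\<close>. The amplitude bound serves up to
  \<open>x1\<close>, the mean value theorem crosses the Airy zone, and monotonicity takes over
  beyond.\<close>

lemma hermite_uniform_bounds:
  fixes n :: nat and x u :: real
  assumes x: "0 \<le> x" and u: "u \<ge> 0" "u ^ 12 = 2 * real n + 1"
  shows "(hermite n x)\<^sup>2 \<le> 72 / u\<^sup>2"
    and "sqrt \<bar>2 * real n + 1 - x\<^sup>2\<bar> * (hermite n x)\<^sup>2 \<le> 72"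
    and "2 * real n + 1 < x\<^sup>2 \<Longrightarrow>
      (hermite n x)\<^sup>2 \<le> 72 / u\<^sup>2 * (9 / 2 * x\<^sup>2 / (x\<^sup>2 - (2 * real n + 1)) ^ 3)"
proof -
  have u1: "u \<ge> 1"
  proof (rule ccontr)
    assume "\<not> u \<ge> 1"
    then have "u ^ 12 < 1" using u power_strict_mono[of u 1 12] by simp
    then show False using u by simp
  qed
  define h where "h = hermite n"
  define h' where "h' = hermite_deriv n"
  \<comment> \<open>At \<open>x1\<close> one has \<open>q = u ^ 4\<close>, hence
    \<open>sqrt q ^ 3 = u ^ 6\<close>, the turning point; so the condition \<open>zone\<close> of
    \<open>hermite_energy_le_sqrt\<close> holds up to \<open>x1\<close>.\<close>
  define x1 where "x1 = sqrt (u ^ 12 - u ^ 4)"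
  have u4: "u ^ 4 \<le> u ^ 12" using u1 by (intro power_increasing) auto
  have x1: "x1 \<ge> 0" "x1\<^sup>2 = u ^ 12 - u ^ 4" using u4 by (simp_all add: x1_def)
  have x1_le: "x1 \<le> u ^ 6"
  proof (rule power2_le_imp_le)
    show "x1\<^sup>2 \<le> (u ^ 6)\<^sup>2" unfolding x1(2) using u(1) by simp
  qed (use u in simp)
  have sqrt_u4: "sqrt (u ^ 4) = u\<^sup>2"
    using u1 real_sqrt_abs[of "u\<^sup>2"] by simp
  have A: "hermite_energy n y \<le> 18 * sqrt (u ^ 12 - y\<^sup>2)" if "0 \<le> y" "y \<le> x1" for y
  proof -
    have y2: "y\<^sup>2 \<le> u ^ 12 - u ^ 4" using that x1 by (metis power_mono)
    have pos: "0 < u ^ 4" using u1 by simp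
    have "u\<^sup>2 \<le> sqrt (u ^ 12 - y\<^sup>2)"
      unfolding sqrt_u4[symmetric] using y2 by (intro real_sqrt_le_mono) linarith
    then have "(u\<^sup>2) ^ 3 \<le> sqrt (u ^ 12 - y\<^sup>2) ^ 3" by (intro power_mono) auto
    then have "y \<le> sqrt (u ^ 12 - y\<^sup>2) ^ 3"
      using that x1_le by simp
    then show ?thesis using hermite_energy_le_sqrt[of y n] that y2 pos u by simp
  qed
  have Ex1: "hermite_energy n x1 \<le> 18 * u\<^sup>2"
    using A[of x1] x1 sqrt_u4 by simp
  have E_eq: "hermite_energy n y = (h' y)\<^sup>2 + (u ^ 12 - y\<^sup>2) * (h y)\<^sup>2" for y
    by (simp add: hermite_energy_def h_def h'_def u)
  have zone1: "sqrt (u ^ 12 - y\<^sup>2) * (h y)\<^sup>2 \<le> 18" "(h y)\<^sup>2 \<le> 18 / u\<^sup>2" if "0 \<le> y" "y \<le> x1" for y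
  proof -
    have y2: "y\<^sup>2 \<le> u ^ 12 - u ^ 4" using that x1 by (metis power_mono)
    have pos: "0 < u ^ 4" using u1 by simp
    define s where "s = sqrt (u ^ 12 - y\<^sup>2)"
    have "y\<^sup>2 < u ^ 12" using y2 pos by linarith
    then have s: "s > 0" "s\<^sup>2 = u ^ 12 - y\<^sup>2" by (simp_all add: s_def)
    have su: "u\<^sup>2 \<le> s"
      unfolding sqrt_u4[symmetric] s_def using y2 by (intro real_sqrt_le_mono) linarith
    have "s * (s * (h y)\<^sup>2) \<le> hermite_energy n y"
      unfolding E_eq s(2)[symmetric] by (simp add: power2_eq_square)
    also have "\<dots> \<le> s * 18" using A[OF that] by (simp add: s_def)
    finally have *: "s * (h y)\<^sup>2 \<le> 18" using s by simp
    then show "sqrt (u ^ 12 - y\<^sup>2) * (h y)\<^sup>2 \<le> 18" by (simp add: s_def)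
    have "u\<^sup>2 * (h y)\<^sup>2 \<le> s * (h y)\<^sup>2" using su by (intro mult_right_mono) auto
    then show "(h y)\<^sup>2 \<le> 18 / u\<^sup>2" using * u1 by (simp add: field_simps)
  qed
  have hx1: "\<bar>h x1\<bar> \<le> sqrt 18 / u"
    using real_sqrt_le_mono[OF zone1(2)[of x1]] x1 u by (simp add: real_sqrt_divide)
  have h'_zone2: "(h' y)\<^sup>2 \<le> 18 * u\<^sup>2" if "x1 \<le> y" "y \<le> u ^ 6" for y
  proof -
    have "y\<^sup>2 \<le> (u ^ 6)\<^sup>2" using that x1 by (intro power_mono) auto
    then have "0 \<le> (u ^ 12 - y\<^sup>2) * (h y)\<^sup>2" by simp
    then have "(h' y)\<^sup>2 \<le> hermite_energy n y" unfolding E_eq by simp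
    also have "\<dots> \<le> hermite_energy n x1" using that x1 by (intro hermite_energy_antimono) auto
    finally show ?thesis using Ex1 by simp
  qed
  have zone2: "(h y)\<^sup>2 \<le> 72 / u\<^sup>2" if "x1 \<le> y" "y \<le> u ^ 6" for y
  proof -
    \<comment> \<open>The product \<open>(u ^ 6 - x1) * (u ^ 6 + x1)\<close> is
      \<open>u ^ 4\<close>, and its second factor is at least \<open>u ^ 6\<close>.\<close>
    have gap: "(u ^ 6 - x1) * u\<^sup>2 \<le> 1"
    proof -
      have "(u ^ 6 - x1) * u ^ 6 \<le> (u ^ 6 - x1) * (u ^ 6 + x1)"
        using x1_le x1 by (intro mult_left_mono) auto
      also have "\<dots> = (u ^ 6)\<^sup>2 - x1\<^sup>2" by (simp add: power2_eq_square algebra_simps)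
      also have "\<dots> = u ^ 4" unfolding x1(2) by simp
      finally have "((u ^ 6 - x1) * u\<^sup>2) * u ^ 4 \<le> 1 * u ^ 4"
        by (simp add: algebra_simps flip: power_add)
      then show ?thesis using u1 by simp
    qed
    have "\<bar>h y - h x1\<bar> \<le> sqrt 18 * u * (y - x1)"
    proof (cases "y = x1")
      case False
      then have "x1 < y" using that by simp
      then obtain z where z: "x1 < z" "z < y" "h y - h x1 = (y - x1) * h' z"
        using MVT2[of x1 y h h'] has_real_derivative_hermite unfolding h_def h'_def by blast
      have "\<bar>h' z\<bar> \<le> sqrt 18 * u"
        using real_sqrt_le_mono[OF h'_zone2[of z]] z that u by (simp add: real_sqrt_mult)
      then have "\<bar>h' z\<bar> * (y - x1) \<le> sqrt 18 * u * (y - x1)"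
        using that by (intro mult_right_mono) auto
      then show ?thesis using z that by (simp add: abs_mult mult.commute)
    qed simp
    also have "\<dots> \<le> sqrt 18 * u * (u ^ 6 - x1)"
      using that u by (intro mult_left_mono) auto
    also have "\<dots> \<le> sqrt 18 / u"
    proof -
      have "(u * (u ^ 6 - x1)) * u \<le> 1" using gap by (simp add: power2_eq_square mult_ac)
      then have "u * (u ^ 6 - x1) \<le> 1 / u" using u1 by (simp add: pos_le_divide_eq)
      then have "sqrt 18 * (u * (u ^ 6 - x1)) \<le> sqrt 18 * (1 / u)" by (intro mult_left_mono) auto
      then show ?thesis by (simp add: mult.assoc)
    qed
    finally have "\<bar>h y\<bar> \<le> 2 * (sqrt 18 / u)" using hx1 by linarith
    then have "\<bar>h y\<bar>\<^sup>2 \<le> (2 * (sqrt 18 / u))\<^sup>2" by (intro power_mono) auto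
    then show ?thesis by (simp add: power_mult_distrib power_divide)
  qed
  have tp: "x1 \<le> u ^ 6" by (rule x1_le)
  have lam: "2 * real n + 1 = (u ^ 6)\<^sup>2" using u by simp
  have hh'_nonpos: "h y * h' y \<le> 0" if "u ^ 6 \<le> y" for y
    unfolding h_def h'_def
  proof (rule hermite_sq_convex_region)
    show "2 * real n + 1 \<le> y\<^sup>2" unfolding lam using that u by (intro power_mono) auto
    show "0 \<le> y" using that u by (smt (verit) zero_le_power)
  qed
  \<comment> \<open>Both squares decrease because \<open>h h' \<le> 0\<close> and \<open>h''\<close>
    has the sign of \<open>h\<close> there.\<close>
  have zone3: "(h y)\<^sup>2 \<le> (h (u ^ 6))\<^sup>2" "(h' y)\<^sup>2 \<le> (h' (u ^ 6))\<^sup>2" if "u ^ 6 \<le> y" for y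
  proof -
    show "(h y)\<^sup>2 \<le> (h (u ^ 6))\<^sup>2"
      using that
    proof (rule DERIV_nonpos_imp_nonincreasing)
      fix z assume z: "u ^ 6 \<le> z" "z \<le> y"
      have "((\<lambda>z. (h z)\<^sup>2) has_real_derivative 2 * (h z * h' z)) (at z)"
        unfolding h_def h'_def
        by (rule derivative_eq_intros has_real_derivative_hermite refl)+ simp
      moreover have "2 * (h z * h' z) \<le> 0" using hh'_nonpos[OF z(1)] by linarith
      ultimately show "\<exists>d. ((\<lambda>z. (h z)\<^sup>2) has_real_derivative d) (at z) \<and> d \<le> 0" by blast
    qed
    show "(h' y)\<^sup>2 \<le> (h' (u ^ 6))\<^sup>2"
      using that
    proof (rule DERIV_nonpos_imp_nonincreasing)
      fix z assume z: "u ^ 6 \<le> z" "z \<le> y"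
      have "((\<lambda>z. (h' z)\<^sup>2) has_real_derivative 2 * (z\<^sup>2 - (u ^ 6)\<^sup>2) * (h z * h' z)) (at z)"
        unfolding h_def h'_def lam[symmetric]
        by (rule derivative_eq_intros has_real_derivative_hermite_deriv refl)+ simp
      moreover have "2 * (z\<^sup>2 - (u ^ 6)\<^sup>2) * (h z * h' z) \<le> 0"
      proof (rule mult_nonneg_nonpos)
        have "(u ^ 6)\<^sup>2 \<le> z\<^sup>2" using z u by (intro power_mono) auto
        then show "0 \<le> 2 * (z\<^sup>2 - (u ^ 6)\<^sup>2)" by simp
      qed (rule hh'_nonpos[OF z(1)])
      ultimately show "\<exists>d. ((\<lambda>z. (h' z)\<^sup>2) has_real_derivative d) (at z) \<and> d \<le> 0"
        by blast
    qed
  qed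
  show first: "(hermite n x)\<^sup>2 \<le> 72 / u\<^sup>2"
  proof -
    consider "x \<le> x1" | "x1 \<le> x" "x \<le> u ^ 6" | "u ^ 6 \<le> x" by linarith
    then show ?thesis
    proof cases
      case 1
      then have "(h x)\<^sup>2 \<le> 18 / u\<^sup>2" using zone1 x by simp
      also have "\<dots> \<le> 72 / u\<^sup>2" by (intro divide_right_mono) auto
      finally show ?thesis by (simp add: h_def)
    next
      case 2
      then show ?thesis using zone2 by (simp add: h_def)
    next
      case 3
      then show ?thesis using zone3(1)[of x] zone2[of "u ^ 6"] tp by (simp add: h_def)
    qed
  qed
  have E_nn: "(x\<^sup>2 - u ^ 12) * (h x)\<^sup>2 \<le> (h' x)\<^sup>2"
    using hermite_energy_nonneg[OF x, of n] unfolding E_eq by (simp add: algebra_simps)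
  show "sqrt \<bar>2 * real n + 1 - x\<^sup>2\<bar> * (hermite n x)\<^sup>2 \<le> 72"
  proof -
    consider "x \<le> x1" | "x1 \<le> x" "x \<le> u ^ 6" | "u ^ 6 \<le> x" by linarith
    then show ?thesis
    proof cases
      case 1
      then have "x\<^sup>2 \<le> x1\<^sup>2" using x by (intro power_mono) auto
      then have "x\<^sup>2 \<le> u ^ 12" unfolding x1(2) using u by (smt (verit) zero_le_power)
      then show ?thesis using zone1(1)[OF x 1] u by (simp add: h_def)
    next
      case 2
      have "x1\<^sup>2 \<le> x\<^sup>2" using 2 x1(1) by (intro power_mono)
      moreover have "x\<^sup>2 \<le> (u ^ 6)\<^sup>2" using 2 x by (intro power_mono)
      ultimately have "\<bar>u ^ 12 - x\<^sup>2\<bar> \<le> u ^ 4" unfolding x1(2) by simp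
      then have "sqrt \<bar>u ^ 12 - x\<^sup>2\<bar> \<le> u\<^sup>2" unfolding sqrt_u4[symmetric] by (rule real_sqrt_le_mono)
      then have "sqrt \<bar>u ^ 12 - x\<^sup>2\<bar> * (h x)\<^sup>2 \<le> u\<^sup>2 * (72 / u\<^sup>2)"
        using zone2[OF 2] by (intro mult_mono) auto
      then show ?thesis using u1 u by (simp add: h_def)
    next
      case 3
      have "(u ^ 6)\<^sup>2 \<le> x\<^sup>2" using 3 u by (intro power_mono) auto
      then have q: "u ^ 12 \<le> x\<^sup>2" by simp
      have "sqrt ((x\<^sup>2 - u ^ 12) * (h x)\<^sup>2) \<le> sqrt ((h' x)\<^sup>2)"
        using E_nn by (rule real_sqrt_le_mono)
      then have "sqrt (x\<^sup>2 - u ^ 12) * \<bar>h x\<bar> \<le> \<bar>h' x\<bar>" by (simp add: real_sqrt_mult)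
      then have "(sqrt (x\<^sup>2 - u ^ 12) * \<bar>h x\<bar>) * \<bar>h x\<bar> \<le> \<bar>h' x\<bar> * \<bar>h x\<bar>"
        by (intro mult_right_mono) auto
      also have "\<dots> \<le> 72"
      proof (rule power2_le_imp_le)
        \<comment> \<open>The bounds of \<open>h'\<close> and \<open>h\<close> scale reciprocally in
          \<open>u\<close>, so their product is free of \<open>u\<close>.\<close>
        have "(h' x)\<^sup>2 * (h x)\<^sup>2 \<le> (18 * u\<^sup>2) * (72 / u\<^sup>2)"
          using zone3(2)[OF 3] h'_zone2[OF tp] first u by (intro mult_mono) (auto simp: h_def)
        also have "\<dots> \<le> 72\<^sup>2" using u1 by simp
        finally show "(\<bar>h' x\<bar> * \<bar>h x\<bar>)\<^sup>2 \<le> 72\<^sup>2" by (simp add: power_mult_distrib)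
      qed simp
      finally show ?thesis using q u by (simp add: h_def power2_eq_square mult.assoc)
    qed
  qed
  show "(hermite n x)\<^sup>2 \<le> 72 / u\<^sup>2 * (9 / 2 * x\<^sup>2 / (x\<^sup>2 - (2 * real n + 1)) ^ 3)"
    if "2 * real n + 1 < x\<^sup>2"
  proof -
    have "(u ^ 6)\<^sup>2 < x\<^sup>2" using that u by simp
    then have ux: "u ^ 6 < x" using x by (rule power2_less_imp_less)
    then have xpos: "x > 0" using u by (smt (verit) zero_le_power)
    define s where "s y = sqrt (y\<^sup>2 - (u ^ 6)\<^sup>2)" for y
    \<comment> \<open>An explicit lower bound for the decay exponent, zero at the turning point. Its
      derivative \<open>s y * y / x\<close> is at most \<open>s y\<close>, and
      \<open>\<bar>h'\<bar> \<ge> s \<bar>h\<bar>\<close> with \<open>h h' \<le> 0\<close> then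
      makes \<open>h\<^sup>2 * exp (2 * m)\<close> nonincreasing.\<close>
    define m where "m y = s y ^ 3 / (3 * x)" for y
    have "(h x)\<^sup>2 * exp (2 * m x) \<le> (h (u ^ 6))\<^sup>2 * exp (2 * m (u ^ 6))"
    proof (rule DERIV_nonpos_imp_decreasing_open[where f = "\<lambda>y. (h y)\<^sup>2 * exp (2 * m y)" and a = "u ^ 6" and b = x])
      show "u ^ 6 \<le> x" using ux by simp
      have "continuous_on {u ^ 6..x} h"
        unfolding h_def using has_real_derivative_hermite
        by (meson DERIV_isCont continuous_at_imp_continuous_on)
      then show "continuous_on {u ^ 6..x} (\<lambda>y. (h y)\<^sup>2 * exp (2 * m y))"
        unfolding m_def s_def using xpos by (intro continuous_intros) auto
      fix y assume y: "u ^ 6 < y" "y < x"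
      have sy: "s y > 0" "(s y)\<^sup>2 = y\<^sup>2 - u ^ 12"
      proof -
        have "(u ^ 6)\<^sup>2 < y\<^sup>2" using y u by (intro power_strict_mono) auto
        then show "s y > 0" "(s y)\<^sup>2 = y\<^sup>2 - u ^ 12" by (simp_all add: s_def)
      qed
      have ds: "(s has_real_derivative y / s y) (at y)"
        using sy unfolding s_def[abs_def]
        by (auto intro!: derivative_eq_intros simp: field_simps)
      have dm: "(m has_real_derivative s y * y / x) (at y)"
        unfolding m_def[abs_def] using sy xpos
        by (auto intro!: derivative_eq_intros ds simp: field_simps power2_eq_square)
      have dh: "(h has_real_derivative h' y) (at y)"
        unfolding h_def h'_def by (rule has_real_derivative_hermite)
      have "((\<lambda>y. (h y)\<^sup>2 * exp (2 * m y)) has_real_derivative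
          2 * exp (2 * m y) * (h y * h' y + (s y * y / x) * (h y)\<^sup>2)) (at y)"
        by (rule derivative_eq_intros dh dm refl)+ (simp add: power2_eq_square algebra_simps)
      moreover have "h y * h' y + (s y * y / x) * (h y)\<^sup>2 \<le> 0"
      proof -
        have y0: "0 \<le> y" using y u by (smt (verit) zero_le_power)
        have "(y\<^sup>2 - u ^ 12) * (h y)\<^sup>2 \<le> (h' y)\<^sup>2"
          using hermite_energy_nonneg[OF y0, of n] unfolding E_eq by (simp add: algebra_simps)
        then have "sqrt ((s y * h y)\<^sup>2) \<le> sqrt ((h' y)\<^sup>2)"
          by (intro real_sqrt_le_mono) (simp add: power_mult_distrib sy)
        then have *: "s y * \<bar>h y\<bar> \<le> \<bar>h' y\<bar>" using sy by (simp add: abs_mult)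
        have "(s y * y / x) * (h y)\<^sup>2 \<le> (s y * 1) * (h y)\<^sup>2"
          using y xpos sy by (intro mult_right_mono) (simp_all add: field_simps)
        also have "\<dots> = (s y * \<bar>h y\<bar>) * \<bar>h y\<bar>" by (simp add: power2_eq_square)
        also have "\<dots> \<le> \<bar>h' y\<bar> * \<bar>h y\<bar>" using * by (intro mult_right_mono) auto
        also have "\<dots> = - (h y * h' y)"
          using hh'_nonpos[of y] y by (simp add: abs_mult[symmetric] mult.commute)
        finally show ?thesis by simp
      qed
      ultimately show "\<exists>d. ((\<lambda>y. (h y)\<^sup>2 * exp (2 * m y)) has_real_derivative d) (at y) \<and> d \<le> 0"
        by (meson exp_ge_zero mult_nonneg_nonpos mult_nonneg_nonneg zero_le_numeral)
    qed
    also have "\<dots> = (h (u ^ 6))\<^sup>2" by (simp add: m_def s_def)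
    also have "\<dots> \<le> 72 / u\<^sup>2" using zone2[of "u ^ 6"] tp by simp
    finally have 1: "(h x)\<^sup>2 * exp (2 * m x) \<le> 72 / u\<^sup>2" .
    define S where "S = x\<^sup>2 - (2 * real n + 1)"
    have S: "S > 0" using that by (simp add: S_def)
    have sx: "s x = sqrt S" by (simp add: s_def S_def lam)
    have m0: "0 \<le> 2 * m x" using S xpos by (simp add: m_def sx)
    \<comment> \<open>Of the exponential only the quadratic Taylor term is kept; it yields the
      factor \<open>S ^ 3\<close>.\<close>
    have "(2 * m x)\<^sup>2 / 2 = 2 / 9 * (sqrt S ^ 3)\<^sup>2 / x\<^sup>2"
      using xpos by (simp add: m_def sx power_divide power_mult_distrib)
    also have "(sqrt S ^ 3)\<^sup>2 = (sqrt S ^ 2) ^ 3" by simp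
    also have "\<dots> = S ^ 3" using S by simp
    finally have "2 / 9 * S ^ 3 / x\<^sup>2 \<le> exp (2 * m x)"
      using exp_lower_Taylor_quadratic[OF m0] m0 by linarith
    then have "(h x)\<^sup>2 * (2 / 9 * S ^ 3 / x\<^sup>2) \<le> (h x)\<^sup>2 * exp (2 * m x)"
      by (intro mult_left_mono) auto
    then have "(h x)\<^sup>2 * (2 / 9 * S ^ 3 / x\<^sup>2) \<le> 72 / u\<^sup>2" using 1 by linarith
    then have "(h x)\<^sup>2 \<le> (72 / u\<^sup>2) / (2 / 9 * S ^ 3 / x\<^sup>2)"
      using S xpos by (subst pos_le_divide_eq) auto
    then show ?thesis by (simp add: h_def S_def mult_ac)
  qed
qed

subsection \<open>Uniform bounds for sums of squares\<close>

text \<open>The same bounds for all real \<open>x\<close>, by parity, with \<open>u\<close> the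
  actual twelfth root. The scale \<open>(2n + 1) powr (1 / 6)\<close> is the origin of
  \<open>gamma_exp 1\<close>.\<close>

lemma hermite_sq_le: "(hermite n x)\<^sup>2 \<le> 72 / (2 * real n + 1) powr (1 / 6)"
  and hermite_sq_le_turning: "sqrt \<bar>2 * real n + 1 - x\<^sup>2\<bar> * (hermite n x)\<^sup>2 \<le> 72"
  and hermite_sq_le_beyond: "2 * real n + 1 < x\<^sup>2 \<Longrightarrow> (hermite n x)\<^sup>2
    \<le> 72 / (2 * real n + 1) powr (1 / 6) * (9 / 2 * x\<^sup>2 / (x\<^sup>2 - (2 * real n + 1)) ^ 3)"
proof -
  define u where "u = (2 * real n + 1) powr (1 / 12)"
  have u: "u \<ge> 0" "u ^ 12 = 2 * real n + 1" "u\<^sup>2 = (2 * real n + 1) powr (1 / 6)"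
    by (simp_all add: u_def flip: powr_realpow powr_realpow' add: powr_powr powr_power)
  note core = hermite_uniform_bounds[of "\<bar>x\<bar>" u n, OF _ u(1,2), unfolded hermite_abs_square u(3), simplified]
  show "(hermite n x)\<^sup>2 \<le> 72 / (2 * real n + 1) powr (1 / 6)"
    "sqrt \<bar>2 * real n + 1 - x\<^sup>2\<bar> * (hermite n x)\<^sup>2 \<le> 72" using core(1,2) by auto
  show "2 * real n + 1 < x\<^sup>2 \<Longrightarrow> (hermite n x)\<^sup>2
    \<le> 72 / (2 * real n + 1) powr (1 / 6) * (9 / 2 * x\<^sup>2 / (x\<^sup>2 - (2 * real n + 1)) ^ 3)"
    using core(3) by simp
qed

lemma hermite_sq_le_const: "(hermite n x)\<^sup>2 \<le> 72"
proof -
  have "(2 * real n + 1) powr (1 / 6) \<ge> 1" by (intro ge_one_powr_ge_zero) auto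
  then have "72 / (2 * real n + 1) powr (1 / 6) \<le> 72" by (simp add: field_simps)
  then show ?thesis using hermite_sq_le[of n x] by linarith
qed

text \<open>The Christoffel-Darboux formula on the diagonal, in energy form: by the two ladder forms
  consecutive energies differ by
  \<open>(hermite k x)\<^sup>2 + (hermite (Suc k) x)\<^sup>2\<close>.\<close>

lemma sum_hermite_sq: "(\<Sum>a\<le>k. (hermite a x)\<^sup>2) = (hermite_energy k x + (hermite k x)\<^sup>2) / 2"
proof (induction k)
  case 0
  show ?case
    by (simp add: hermite_energy_def hermite_deriv_def power2_eq_square algebra_simps)
next
  case (Suc k)
  define r where "r = sqrt (2 * (real k + 1))"
  have r2: "r\<^sup>2 = 2 * (real k + 1)" by (simp add: r_def)
  have a: "hermite_deriv (Suc k) x = r * hermite k x - x * hermite (Suc k) x"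
    by (simp only: hermite_deriv_Suc r_def)
  have b: "hermite_deriv k x = x * hermite k x - r * hermite (Suc k) x"
    by (simp only: hermite_deriv_eq_raise r_def)
  have "hermite_energy (Suc k) x - hermite_energy k x
      = (r\<^sup>2 - 2 * real k - 1) * (hermite k x)\<^sup>2 + (2 * real k + 3 - r\<^sup>2) * (hermite (Suc k) x)\<^sup>2"
    unfolding hermite_energy_def a b by (simp add: power2_eq_square algebra_simps)
  then have "hermite_energy (Suc k) x = hermite_energy k x + (hermite k x)\<^sup>2 + (hermite (Suc k) x)\<^sup>2"
    unfolding r2 by simp
  then show ?case using Suc by (simp del: hermite.simps)
qed

text \<open>On the half-line the energy is largest at the origin, where it is
  \<open>O(sqrt k)\<close>. The constant 39 is \<open>(6 + 72) / 2\<close>, with 72 from the uniform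
  bound of a single square.\<close>

lemma sum_hermite_sq_le: "(\<Sum>a\<le>k. (hermite a x)\<^sup>2) \<le> 39 * sqrt (real k + 1)"
proof -
  have "(\<Sum>a\<le>k. (hermite a x)\<^sup>2) = (\<Sum>a\<le>k. (hermite a \<bar>x\<bar>)\<^sup>2)"
    by (simp only: hermite_abs_square)
  also have "\<dots> = (hermite_energy k \<bar>x\<bar> + (hermite k \<bar>x\<bar>)\<^sup>2) / 2"
    by (rule sum_hermite_sq)
  also have "\<dots> = (hermite_energy k \<bar>x\<bar> + (hermite k x)\<^sup>2) / 2"
    by (simp only: hermite_abs_square)
  also have "\<dots> \<le> (3 * sqrt (2 * real k + 1) + 72) / 2"
    using hermite_energy_antimono[of 0 "\<bar>x\<bar>" k] hermite_energy_zero_le[of k] hermite_sq_le_const[of k x]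
    by simp
  also have "\<dots> \<le> (3 * (2 * sqrt (real k + 1)) + 72 * sqrt (real k + 1)) / 2"
  proof -
    have "sqrt (2 * real k + 1) \<le> sqrt (2\<^sup>2 * (real k + 1))" by (intro real_sqrt_le_mono) simp
    also have "\<dots> = 2 * sqrt (real k + 1)" unfolding real_sqrt_mult real_sqrt_abs by simp
    finally have "sqrt (2 * real k + 1) \<le> 2 * sqrt (real k + 1)" .
    moreover have "1 \<le> sqrt (real k + 1)" by simp
    moreover have "(3 * a + 72) / 2 \<le> (3 * (2 * r) + 72 * r) / 2" if "a \<le> 2 * r" "1 \<le> r" for a r :: real
      using that by simp
    ultimately show ?thesis by blast
  qed
  finally show ?thesis by simp
qed

section \<open>Elementary sums, and the two-dimensional sum on an axis\<close>

lemma sum_inverse_sqrt_le: "(\<Sum>i<n. 1 / sqrt (real i + 1)) \<le> 2 * sqrt (real n)"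
proof (induction n)
  case (Suc n)
  have "2 * sqrt (real n) + 1 / sqrt (real n + 1) \<le> 2 * sqrt (real n + 1)"
  proof -
    define r where "r = sqrt (real n + 1)"
    have r: "r > 0" "r\<^sup>2 = real n + 1" by (simp_all add: r_def)
    have "2 * sqrt (real n) * r \<le> (sqrt (real n))\<^sup>2 + r\<^sup>2"
      using zero_le_power2[of "sqrt (real n) - r"] by (simp add: power2_diff)
    also have "\<dots> = 2 * r\<^sup>2 - 1" by (simp add: r)
    finally show ?thesis using r unfolding r_def[symmetric]
      by (simp add: field_simps power2_eq_square)
  qed
  then show ?case using Suc by (simp add: add.commute)
qed simp

text \<open>A discrete Beta integral with both parameters 1/2. The two arguments add up to
  \<open>t + 1\<close>, so the larger one is at least half of it, which turns the product into a
  sum.\<close>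

lemma sum_inverse_sqrt_beta_le:
  "(\<Sum>b<t. 1 / sqrt (real b + 1) * (1 / sqrt (real (t - b)))) \<le> 4 * sqrt 2"
proof (cases "t = 0")
  case False
  define c where "c = sqrt 2 / sqrt (real t + 1)"
  have term_le: "1 / sqrt (real b + 1) * (1 / sqrt (real (t - b)))
      \<le> c * (1 / sqrt (real b + 1) + 1 / sqrt (real (t - b)))" if "b < t" for b
  proof -
    have key: "1 / sqrt p * (1 / sqrt q) \<le> c * (1 / sqrt p + 1 / sqrt q)"
      if "p > 0" "q > 0" "real t + 1 = p + q" "p \<le> q" for p q :: real
    proof -
      have "1 / sqrt q \<le> 1 / sqrt ((real t + 1) / 2)"
        using that by (intro divide_left_mono real_sqrt_le_mono) auto
      also have "\<dots> = c" by (simp add: c_def real_sqrt_divide)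
      finally have "1 / sqrt p * (1 / sqrt q) \<le> 1 / sqrt p * c"
        using that by (intro mult_left_mono) auto
      also have "\<dots> \<le> (1 / sqrt p + 1 / sqrt q) * c"
        using that by (intro mult_right_mono) (auto simp: c_def)
      finally show ?thesis by (simp add: mult.commute)
    qed
    show ?thesis
      using key[of "real b + 1" "real (t - b)"] key[of "real (t - b)" "real b + 1"] that
      by (cases "real b + 1 \<le> real (t - b)") (auto simp: add.commute mult.commute of_nat_diff)
  qed
  have "(\<Sum>b<t. 1 / sqrt (real b + 1) * (1 / sqrt (real (t - b))))
      \<le> (\<Sum>b<t. c * (1 / sqrt (real b + 1) + 1 / sqrt (real (t - b))))"
    by (intro sum_mono term_le) auto
  also have "\<dots> = c * ((\<Sum>b<t. 1 / sqrt (real b + 1)) + (\<Sum>b<t. 1 / sqrt (real (t - b))))"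
    by (simp only: sum_distrib_left[symmetric] sum.distrib)
  also have "(\<Sum>b<t. 1 / sqrt (real (t - b))) = (\<Sum>b<t. 1 / sqrt (real b + 1))"
    by (rule sum.reindex_bij_witness[of _ "\<lambda>b. t - 1 - b" "\<lambda>b. t - 1 - b"]) (auto simp: of_nat_diff)
  also have "c * ((\<Sum>b<t. 1 / sqrt (real b + 1)) + (\<Sum>b<t. 1 / sqrt (real b + 1)))
      \<le> c * (2 * sqrt (real t) + 2 * sqrt (real t))"
    by (intro mult_left_mono add_mono sum_inverse_sqrt_le) (simp add: c_def)
  also have "\<dots> = 4 * sqrt 2 * (sqrt (real t) / sqrt (real t + 1))" by (simp add: c_def)
  also have "\<dots> \<le> 4 * sqrt 2 * 1" by (intro mult_left_mono) auto
  finally show ?thesis by simp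
qed simp

lemma sum_inverse_squares_le: "(\<Sum>i=2..n. 1 / (real i)\<^sup>2) \<le> 1"
proof -
  have "(\<Sum>i=2..n. 1 / (real i)\<^sup>2) \<le> 1 - 1 / real n" if "n \<ge> 1"
    using that
  proof (induction n rule: dec_induct)
    case (step n)
    have "1 / (real (Suc n))\<^sup>2 \<le> 1 / real n - 1 / real (Suc n)"
    proof -
      have "1 / (real (Suc n))\<^sup>2 \<le> 1 / (real n * real (Suc n))"
        using step(1) unfolding power2_eq_square by (intro divide_left_mono mult_right_mono) auto
      also have "\<dots> = 1 / real n - 1 / real (Suc n)" using step(1) by (simp add: field_simps)
      finally show ?thesis .
    qed
    then show ?case using step by (simp add: sum.cl_ivl_Suc)
  qed simp
  then show ?thesis by (cases "n = 0") (auto intro: order_trans)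
qed

text \<open>Comparison with the telescoping sum of \<open>2 arctan (sqrt (i / L))\<close>.\<close>

lemma sum_arctan_majorant_le:
  assumes "L > 0"
  shows "(\<Sum>i=1..n. sqrt L / (sqrt (real i) * (L + real i))) \<le> 4"
proof -
  define f where "f x = 2 * arctan (sqrt (x / L))" for x
  have le: "sqrt L / (sqrt (real i) * (L + real i)) \<le> f (real i) - f (real i - 1)" if "i \<ge> 1" for i :: nat
  proof -
    \<comment> \<open>The value at the right end point \<open>i\<close> of the decreasing derivative
      of \<open>f\<close>, hence a lower bound for the slope on the whole unit interval.\<close>
    define c where "c = sqrt L / (sqrt (real i) * (L + real i))"
    have "f (real i - 1) - c * (real i - 1) \<le> f (real i) - c * real i"
    proof (rule DERIV_nonneg_imp_increasing_open[where f = "\<lambda>x. f x - c * x"])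
      show "continuous_on {real i - 1..real i} (\<lambda>x. f x - c * x)"
        unfolding f_def by (intro continuous_intros) (use assms in auto)
      fix x assume x: "real i - 1 < x" "x < real i"
      have x0: "x > 0" using x that by linarith
      have "((\<lambda>x. sqrt (x / L)) has_real_derivative 1 / (L * (2 * sqrt (x / L)))) (at x)"
        using x0 assms by (auto intro!: derivative_eq_intros simp: field_simps)
      then have "(f has_real_derivative 2 * (inverse (1 + (sqrt (x / L))\<^sup>2) * (1 / (L * (2 * sqrt (x / L)))))) (at x)"
        unfolding f_def[abs_def] by (intro DERIV_cmult DERIV_chain2[OF DERIV_arctan])
      moreover have "2 * (inverse (1 + (sqrt (x / L))\<^sup>2) * (1 / (L * (2 * sqrt (x / L))))) = sqrt L / (sqrt x * (L + x))"
      proof -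
        have "1 + (sqrt (x / L))\<^sup>2 = (L + x) / L" using x0 assms by (simp add: field_simps)
        moreover have "2 * (inverse (S / L) * (1 / (L * (2 * (r / l))))) = l / (r * S)"
          if "S > 0" "r > 0" "l > 0" for S r l :: real
          using that assms by (simp add: field_simps)
        ultimately show ?thesis using x0 assms by (simp add: real_sqrt_divide)
      qed
      ultimately have "((\<lambda>x. f x - c * x) has_real_derivative sqrt L / (sqrt x * (L + x)) - c) (at x)"
        by (auto intro!: derivative_eq_intros)
      moreover have "c \<le> sqrt L / (sqrt x * (L + x))"
        unfolding c_def using x x0 assms by (intro divide_left_mono mult_mono) auto
      ultimately show "\<exists>d. ((\<lambda>x. f x - c * x) has_real_derivative d) (at x) \<and> 0 \<le> d"
        by (intro exI conjI) auto
    qed simp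
    then have "c \<le> f (real i) - f (real i - 1)" by (simp add: right_diff_distrib)
    then show ?thesis by (simp only: c_def)
  qed
  have "(\<Sum>i=1..n. sqrt L / (sqrt (real i) * (L + real i))) \<le> (\<Sum>i=1..n. f (real i) - f (real i - 1))"
    by (intro sum_mono le) auto
  also have "\<dots> = f (real n) - f 0"
    by (induction n) (auto simp: f_def)
  also have "\<dots> \<le> 4"
    using arctan_ubound[of "sqrt (real n / L)"] pi_less_4 by (simp add: f_def)
  finally show ?thesis .
qed

text \<open>\<open>L\<close> is the width of the Airy zone measured in
  \<open>x\<^sup>2 - (2n + 1)\<close>. For \<open>i \<le> L\<close> the uniform bound
  \<open>72 / sqrt L\<close> applies; for \<open>i > L\<close> the cubic decay does, with
  \<open>x\<^sup>2\<close> split as \<open>s + lam\<close>. The majorant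
  \<open>sqrt L / (L + i)\<close> covers both and can be summed against
  \<open>1 / sqrt i\<close>.\<close>

lemma hermite_sq_le_beyond_index:
  fixes i :: nat
  assumes i: "2 \<le> i" "real i \<le> x\<^sup>2 - (2 * real n + 1)" and m: "m \<ge> 1" "m \<le> 2 * real n + 1" "2 * real n + 1 \<le> 2 * m"
  defines "L \<equiv> m powr (1 / 3)"
  shows "(hermite n x)\<^sup>2 \<le> 324 / (real i)\<^sup>2 + 1296 * (sqrt L / (L + real i))"
proof -
  define lam where "lam = 2 * real n + 1"
  define s where "s = x\<^sup>2 - lam"
  have L: "L > 0" "L ^ 3 = m" using m by (simp_all add: L_def powr_power)
  have sqrtL: "sqrt L = m powr (1 / 6)" using m by (simp add: L_def powr_half_sqrt[symmetric] powr_powr)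
  have s: "real i \<le> s" "s > 0" using i by (simp_all add: s_def lam_def)
  have ipos: "real i > 0" using i by simp
  have mp: "m powr (1 / 6) \<le> lam powr (1 / 6)" using m by (intro powr_mono2) (auto simp: lam_def)
  have h1: "(hermite n x)\<^sup>2 \<le> 72 / sqrt L"
  proof -
    have "(hermite n x)\<^sup>2 \<le> 72 / lam powr (1 / 6)" using hermite_sq_le[of n x] by (simp add: lam_def)
    also have "\<dots> \<le> 72 / m powr (1 / 6)" using mp m by (intro divide_left_mono) (auto simp: lam_def)
    finally show ?thesis by (simp add: sqrtL)
  qed
  have h2: "(hermite n x)\<^sup>2 \<le> 72 / sqrt L * (9 / 2 / (real i)\<^sup>2 + 9 * L ^ 3 / real i ^ 3)"
  proof -
    have "(hermite n x)\<^sup>2 \<le> 72 / lam powr (1 / 6) * (9 / 2 * x\<^sup>2 / s ^ 3)"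
      using hermite_sq_le_beyond[of n x] s by (simp add: lam_def s_def)
    also have "\<dots> \<le> 72 / m powr (1 / 6) * (9 / 2 / (real i)\<^sup>2 + 9 * L ^ 3 / real i ^ 3)"
    proof (rule mult_mono)
      show "72 / lam powr (1 / 6) \<le> 72 / m powr (1 / 6)"
        using mp m by (intro divide_left_mono) (auto simp: lam_def)
      have "9 / 2 * x\<^sup>2 / s ^ 3 = 9 / 2 / s\<^sup>2 + 9 / 2 * lam / s ^ 3"
        using s by (simp add: s_def[symmetric] field_simps power2_eq_square eval_nat_numeral)
          (simp add: s_def power2_eq_square algebra_simps)
      also have "\<dots> \<le> 9 / 2 / (real i)\<^sup>2 + 9 / 2 * (2 * m) / real i ^ 3"
        using s ipos m by (intro add_mono frac_le mult_left_mono power_mono) (auto simp: lam_def)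
      finally show "9 / 2 * x\<^sup>2 / s ^ 3 \<le> 9 / 2 / (real i)\<^sup>2 + 9 * L ^ 3 / real i ^ 3"
        by (simp add: L)
    qed (use s in auto)
    finally show ?thesis by (simp add: sqrtL)
  qed
  have sL: "sqrt L > 0" "L = sqrt L * sqrt L" using L by simp_all
  show ?thesis
  proof (cases "real i \<le> L")
    case True
    have "72 / sqrt L = 144 * (sqrt L / (L + L))" using sL by (simp add: field_simps)
    also have "\<dots> \<le> 144 * (sqrt L / (L + real i))"
      using True L ipos by (intro mult_left_mono divide_left_mono) auto
    also have "\<dots> \<le> 1296 * (sqrt L / (L + real i))" using L by (intro mult_right_mono) auto
    finally have "(hermite n x)\<^sup>2 \<le> 1296 * (sqrt L / (L + real i))" using h1 by linarith
    moreover have "0 \<le> 324 / (real i)\<^sup>2" by simp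
    ultimately show ?thesis by linarith
  next
    case False
    have r1: "sqrt L \<ge> 1" unfolding sqrtL using m by (intro ge_one_powr_ge_zero) auto
    have "72 / sqrt L * (9 / 2 / (real i)\<^sup>2) \<le> 72 / 1 * (9 / 2 / (real i)\<^sup>2)"
      using r1 by (intro mult_right_mono divide_left_mono) auto
    moreover have "72 / sqrt L * (9 * L ^ 3 / real i ^ 3) \<le> 1296 * (sqrt L / (L + real i))"
    proof -
      define r where "r = sqrt L"
      have r: "r > 0" "L = r * r" using sL by (simp_all add: r_def)
      have "72 / r * (9 * L ^ 3 / real i ^ 3) = 648 * (r * (L\<^sup>2 / (real i)\<^sup>2) / real i)"
        using r ipos by (simp add: field_simps power2_eq_square eval_nat_numeral)
      also have "\<dots> \<le> 648 * (r * 1 / real i)"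
      proof -
        have "L\<^sup>2 \<le> (real i)\<^sup>2" using False L(1) by (intro power_mono) auto
        then have "L\<^sup>2 / (real i)\<^sup>2 \<le> 1" using ipos by (simp add: divide_le_eq_1)
        then show ?thesis using r(1) ipos by (intro mult_left_mono divide_right_mono) auto
      qed
      also have "\<dots> = 1296 * (r / (real i + real i))" by simp
      also have "\<dots> \<le> 1296 * (r / (L + real i))"
        using r(1) ipos False L(1) by (intro mult_left_mono divide_left_mono) auto
      finally show ?thesis by (simp add: r_def)
    qed
    ultimately show ?thesis using h2 by (simp add: distrib_left)
  qed
qed

text \<open>Three ranges. In \<open>A\<close> the second factor is \<open>O(1 / sqrt k)\<close> and
  the first factors sum to \<open>O(sqrt k)\<close>. For \<open>2 * b \<le> k\<close>,
  \<open>B\<close> holds the \<open>b\<close> for which \<open>x\<close> lies before the turning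
  point of degree \<open>k - b\<close>, where a bound of order \<open>1 / sqrt (t - b)\<close> leads
  to the discrete Beta sum; \<open>D\<close> holds those at or beyond it.\<close>

lemma sum_hermite_sq_mult_zero_le:
  "(\<Sum>b\<le>k. (hermite (k - b) x)\<^sup>2 * (hermite b 0)\<^sup>2) \<le> 7000"
proof -
  define A where "A = {b. b \<le> k \<and> k < 2 * b}"
  \<comment> \<open>The real number \<open>b\<close> that makes \<open>\<bar>x\<bar>\<close> the
    turning point of degree \<open>k - b\<close>, that is
    \<open>2 * (k - b) + 1 = x\<^sup>2\<close>.\<close>
  define T where "T = real k + 1 / 2 - x\<^sup>2 / 2"
  define t where "t = nat \<lceil>T\<rceil>"
  define B where "B = {b. 2 * b \<le> k \<and> b < t}"
  define D where "D = {b. 2 * b \<le> k \<and> t \<le> b}"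
  define f where "f b = (hermite (k - b) x)\<^sup>2 * (hermite b 0)\<^sup>2" for b
  have fin: "finite A" "finite B" "finite D"
    by (auto simp: A_def B_def D_def intro!: finite_subset[of _ "{..k}"])
  have f_le: "f b \<le> (hermite (k - b) x)\<^sup>2 * (1 / sqrt (real b + 1))" for b
    unfolding f_def by (intro mult_left_mono hermite_zero_square_le) auto
  have A_le: "sum f A \<le> 78"
  proof -
    define c where "c = 1 / sqrt ((real k + 1) / 2)"
    have "sum f A \<le> (\<Sum>b\<in>A. (hermite (k - b) x)\<^sup>2 * c)"
    proof (rule sum_mono)
      fix b assume "b \<in> A"
      then have "1 / sqrt (real b + 1) \<le> c"
        unfolding c_def A_def by (intro divide_left_mono real_sqrt_le_mono) auto
      then have "(hermite (k - b) x)\<^sup>2 * (1 / sqrt (real b + 1)) \<le> (hermite (k - b) x)\<^sup>2 * c"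
        by (intro mult_left_mono) auto
      then show "f b \<le> (hermite (k - b) x)\<^sup>2 * c" using f_le[of b] by linarith
    qed
    also have "\<dots> \<le> (\<Sum>b\<le>k. (hermite (k - b) x)\<^sup>2 * c)"
      by (intro sum_mono2) (auto simp: A_def c_def)
    also have "\<dots> = c * (\<Sum>b\<le>k. (hermite b x)\<^sup>2)"
      unfolding sum_distrib_left
      by (rule sum.reindex_bij_witness[of _ "\<lambda>b. k - b" "\<lambda>b. k - b"]) (auto simp: mult.commute)
    also have "\<dots> \<le> c * (39 * sqrt (real k + 1))"
      by (intro mult_left_mono sum_hermite_sq_le) (auto simp: c_def)
    also have "\<dots> = 39 * sqrt 2" by (simp add: c_def real_sqrt_divide)
    also have "\<dots> \<le> 39 * 2" using sqrt2_less_2 by simp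
    finally show ?thesis by simp
  qed
  have B_le: "sum f B \<le> 576"
  proof -
    have "sum f B \<le> (\<Sum>b\<in>B. 72 * sqrt 2 * (1 / sqrt (real b + 1) * (1 / sqrt (real (t - b)))))"
    proof (rule sum_mono)
      fix b assume b: "b \<in> B"
      then have bt: "b < t" "2 * b \<le> k" by (auto simp: B_def)
      then have Tt: "T > real t - 1" unfolding t_def by linarith
      \<comment> \<open>If \<open>t - b = 1\<close>, then \<open>T - b\<close> can be arbitrarily
        small and the constant bound is used; if \<open>t - b \<ge> 2\<close>, then
        \<open>T > t - 1\<close> gives \<open>2 * (T - b) \<ge> t - b\<close>.\<close>
      have "(hermite (k - b) x)\<^sup>2 \<le> 72 * sqrt 2 / sqrt (real (t - b))"
      proof (cases "t - b = 1")
        case True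
        have "(hermite (k - b) x)\<^sup>2 \<le> 72 * sqrt 2"
          by (rule order_trans[OF hermite_sq_le_const]) simp
        then show ?thesis using True by simp
      next
        case False
        then have tb: "real (t - b) \<ge> 2" using bt by linarith
        have eq: "2 * real (k - b) + 1 - x\<^sup>2 = 2 * (T - real b)"
          using bt by (simp add: T_def of_nat_diff)
        have "real (t - b) \<le> 2 * (T - real b)" using tb Tt bt by (simp add: of_nat_diff)
        then have "sqrt (real (t - b)) \<le> sqrt \<bar>2 * real (k - b) + 1 - x\<^sup>2\<bar>"
          unfolding eq by (intro real_sqrt_le_mono) linarith
        then have "sqrt (real (t - b)) * (hermite (k - b) x)\<^sup>2
            \<le> sqrt \<bar>2 * real (k - b) + 1 - x\<^sup>2\<bar> * (hermite (k - b) x)\<^sup>2"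
          by (intro mult_right_mono) auto
        also have "\<dots> \<le> 72" by (rule hermite_sq_le_turning)
        also have "72 \<le> 72 * sqrt (2::real)" by simp
        finally show ?thesis using bt by (simp add: pos_le_divide_eq mult.commute)
      qed
      then have "(hermite (k - b) x)\<^sup>2 * (1 / sqrt (real b + 1))
          \<le> 72 * sqrt 2 / sqrt (real (t - b)) * (1 / sqrt (real b + 1))"
        by (intro mult_right_mono) auto
      then show "f b \<le> 72 * sqrt 2 * (1 / sqrt (real b + 1) * (1 / sqrt (real (t - b))))"
        using f_le[of b] by (simp add: mult_ac)
    qed
    also have "\<dots> \<le> (\<Sum>b<t. 72 * sqrt 2 * (1 / sqrt (real b + 1) * (1 / sqrt (real (t - b)))))"
      by (intro sum_mono2) (auto simp: B_def)
    also have "\<dots> \<le> 72 * sqrt 2 * (4 * sqrt 2)"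
      unfolding sum_distrib_left[symmetric] by (intro mult_left_mono sum_inverse_sqrt_beta_le) auto
    also have "\<dots> = 576" by simp
    finally show ?thesis .
  qed
  have D_le: "sum f D \<le> 5600"
  proof -
    define m where "m = real k + 1"
    define L where "L = m powr (1 / 3)"
    have L: "L > 0" by (simp add: L_def m_def)
    \<comment> \<open>The index is \<open>i = b + 1 - t\<close>. For \<open>i = 1\<close> the
      distance \<open>2 * (b - T)\<close> to the turning point may vanish, whence the constant 72;
      for \<open>i \<ge> 2\<close> it is at least \<open>2 * (i - 1) \<ge> i\<close>.\<close>
    define g where "g i = (if i = 1 then 72 else
      324 * (1 / (real i)\<^sup>2) + 1296 * (sqrt L / (sqrt (real i) * (L + real i))))" for i :: nat
    have g0: "g i \<ge> 0" for i using L by (simp add: g_def)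
    have "sum f D \<le> (\<Sum>b\<in>D. g (b + 1 - t))"
    proof (rule sum_mono)
      fix b assume b: "b \<in> D"
      then have bt: "t \<le> b" "2 * b \<le> k" by (auto simp: D_def)
      define i where "i = b + 1 - t"
      have i: "i \<ge> 1" "i \<le> b + 1" "real i = real b + 1 - real t" using bt by (auto simp: i_def of_nat_diff)
      have Tt: "T \<le> real t" unfolding t_def by linarith
      have "1 / sqrt (real b + 1) \<le> 1 / sqrt (real i)"
        using i by (intro divide_left_mono real_sqrt_le_mono) auto
      then have "(hermite (k - b) x)\<^sup>2 * (1 / sqrt (real b + 1)) \<le> (hermite (k - b) x)\<^sup>2 * (1 / sqrt (real i))"
        by (intro mult_left_mono) auto
      then have fb: "f b \<le> (hermite (k - b) x)\<^sup>2 * (1 / sqrt (real i))" using f_le[of b] by linarith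
      also have "\<dots> \<le> g i"
      proof (cases "i = 1")
        case True
        then show ?thesis using hermite_sq_le_const[of "k - b" x] by (simp add: g_def)
      next
        case False
        then have i2: "i \<ge> 2" using i by simp
        have "x\<^sup>2 - (2 * real (k - b) + 1) = 2 * (real b - T)"
          using bt by (simp add: T_def of_nat_diff)
        then have "real i \<le> x\<^sup>2 - (2 * real (k - b) + 1)" using Tt i i2 by simp
        \<comment> \<open>As \<open>2 * b \<le> k\<close>, the eigenvalue of degree
          \<open>k - b\<close> stays between \<open>m\<close> and \<open>2 * m\<close>, so one
          \<open>L\<close> serves all terms.\<close>
        moreover have "1 \<le> m" "m \<le> 2 * real (k - b) + 1" "2 * real (k - b) + 1 \<le> 2 * m"
          using bt by (auto simp: m_def of_nat_diff)
        ultimately have "(hermite (k - b) x)\<^sup>2 \<le> 324 / (real i)\<^sup>2 + 1296 * (sqrt L / (L + real i))"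
          using i2 unfolding L_def by (intro hermite_sq_le_beyond_index) auto
        then have "(hermite (k - b) x)\<^sup>2 * (1 / sqrt (real i))
            \<le> (324 / (real i)\<^sup>2 + 1296 * (sqrt L / (L + real i))) * (1 / sqrt (real i))"
          by (intro mult_right_mono) auto
        also have "\<dots> = 324 / (real i)\<^sup>2 * (1 / sqrt (real i)) + 1296 * (sqrt L / (sqrt (real i) * (L + real i)))"
          by (simp add: add_divide_distrib mult.commute)
        also have "\<dots> \<le> 324 / (real i)\<^sup>2 * 1 + 1296 * (sqrt L / (sqrt (real i) * (L + real i)))"
          using i2 by (intro add_right_mono mult_left_mono) auto
        finally show ?thesis using False by (simp add: g_def)
      qed
      finally show "f b \<le> g (b + 1 - t)" by (simp add: i_def)
    qed
    also have "\<dots> = sum g ((\<lambda>b. b + 1 - t) ` D)"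
      by (subst sum.reindex) (auto simp: inj_on_def D_def)
    also have "\<dots> \<le> sum g {1..k + 1}"
      using g0 by (intro sum_mono2) (auto simp: D_def)
    also have "\<dots> = 72 + sum g {2..k + 1}"
      by (subst sum.atLeast_Suc_atMost) (auto simp: g_def numeral_2_eq_2)
    also have "sum g {2..k + 1} = 324 * (\<Sum>i=2..k+1. 1 / (real i)\<^sup>2)
        + 1296 * (\<Sum>i=2..k+1. sqrt L / (sqrt (real i) * (L + real i)))"
      unfolding sum_distrib_left sum.distrib[symmetric] by (intro sum.cong) (auto simp: g_def)
    also have "(\<Sum>i=2..k+1. sqrt L / (sqrt (real i) * (L + real i)))
        \<le> (\<Sum>i=1..k+1. sqrt L / (sqrt (real i) * (L + real i)))"
      using L by (intro sum_mono2) auto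
    also have "\<dots> \<le> 4" using L by (rule sum_arctan_majorant_le)
    also have "(\<Sum>i=2..k+1. 1 / (real i)\<^sup>2) \<le> 1" by (rule sum_inverse_squares_le)
    finally show ?thesis by simp
  qed
  have "sum f {..k} = sum f A + (sum f B + sum f D)"
  proof -
    have "{..k} = A \<union> (B \<union> D)" "A \<inter> (B \<union> D) = {}" "B \<inter> D = {}"
      by (auto simp: A_def B_def D_def)
    then show ?thesis using fin by (simp add: sum.union_disjoint)
  qed
  then show ?thesis using A_le B_le D_le by (simp add: f_def)
qed

section \<open>Generating series in the degree, and the passage to several variables\<close>

unbundle no vec_syntax and fps_syntax

text \<open>A series in the degree, because the coefficient of index \<open>k\<close> of a product
  over coordinates is the sum over all multi-indices of total degree \<open>k\<close>, the quantity
  to be bounded.\<close>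

definition hermite_fps :: "real \<Rightarrow> real fps" where
  "hermite_fps x = Abs_fps (\<lambda>a. (hermite a x)\<^sup>2)"

definition hermite_fps_deriv :: "real \<Rightarrow> real fps" where
  "hermite_fps_deriv x = Abs_fps (\<lambda>a. 2 * hermite a x * hermite_deriv a x)"

text \<open>The logarithmic derivative of Mehler's formula, obtained coefficientwise: with lowering
  at \<open>Suc m\<close> and raising at \<open>m\<close> the mixed products cancel.\<close>

lemma hermite_fps_deriv_eq:
  "(1 + fps_X) * hermite_fps_deriv x = fps_const (- 2 * x) * (1 - fps_X) * hermite_fps x"
proof (rule fps_ext)
  fix n
  show "((1 + fps_X) * hermite_fps_deriv x) $ n = (fps_const (- 2 * x) * (1 - fps_X) * hermite_fps x) $ n"
  proof (cases n)
    case 0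
    then show ?thesis
      by (simp add: hermite_fps_deriv_def hermite_fps_def hermite_deriv_def power2_eq_square)
  next
    case (Suc m)
    have "((1 + fps_X) * hermite_fps_deriv x) $ n
        = 2 * hermite (Suc m) x * hermite_deriv (Suc m) x + 2 * hermite m x * hermite_deriv m x"
      by (simp add: Suc hermite_fps_deriv_def distrib_right)
    also have "\<dots> = - 2 * x * ((hermite (Suc m) x)\<^sup>2 - (hermite m x)\<^sup>2)"
      unfolding hermite_deriv_Suc hermite_deriv_eq_raise[of m]
      by (simp add: power2_eq_square algebra_simps)
    also have "\<dots> = (fps_const (- 2 * x) * (1 - fps_X) * hermite_fps x) $ n"
      by (simp add: Suc hermite_fps_def left_diff_distrib mult.assoc)
    finally show ?thesis .
  qed
qed

text \<open>The logarithmic derivative of \<open>hermite_fps x\<close> is \<open>x\<close> times a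
  series independent of \<open>x\<close>, so along a circle the contributions of the two factors are
  opposite. The factor \<open>1 + fps_X\<close> is removed because power series over a field have no
  zero divisors.\<close>

lemma hermite_fps_rotation:
  "hermite_fps (r * cos t) * hermite_fps (r * sin t) = hermite_fps r * hermite_fps 0"
proof (rule fps_ext)
  fix k
  define f where "f t = (hermite_fps (r * cos t) * hermite_fps (r * sin t)) $ k" for t
  have "(f has_real_derivative 0) (at t)" for t
  proof -
    define x y where "x = r * cos t" and "y = r * sin t"
    define D where "D = fps_const (- y) * hermite_fps_deriv x * hermite_fps y
        + fps_const x * hermite_fps x * hermite_fps_deriv y"
    have "(1 + fps_X) * D = fps_const (- y) * ((1 + fps_X) * hermite_fps_deriv x) * hermite_fps y
        + fps_const x * hermite_fps x * ((1 + fps_X) * hermite_fps_deriv y)"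
      by (simp add: D_def algebra_simps)
    also have "\<dots> = (fps_const (- y) * fps_const (- 2 * x) + fps_const x * fps_const (- 2 * y))
        * (1 - fps_X) * hermite_fps x * hermite_fps y"
      unfolding hermite_fps_deriv_eq by (simp only: algebra_simps)
    also have "fps_const (- y) * fps_const (- 2 * x) + fps_const x * fps_const (- 2 * y) = 0"
      by (simp flip: fps_const_mult)
    finally have "(1 + fps_X) * D = 0" by simp
    moreover have "(1 + fps_X :: real fps) $ 0 \<noteq> 0 $ 0" by simp
    ultimately have D0: "D = 0" by (metis mult_eq_0_iff)
    have "(f has_real_derivative D $ k) (at t)"
    proof -
      have d: "((\<lambda>t. (hermite a (r * cos t))\<^sup>2) has_real_derivative
          - y * (2 * hermite a x * hermite_deriv a x)) (at t)" for a
      proof -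
        have "((\<lambda>t. r * cos t) has_real_derivative - y) (at t)"
          by (auto intro!: derivative_eq_intros simp: y_def)
        from DERIV_chain2[OF has_real_derivative_hermite this, of a]
        have "((\<lambda>t. hermite a (r * cos t)) has_real_derivative hermite_deriv a x * - y) (at t)"
          by (simp add: x_def)
        from DERIV_power[OF this, of 2] show ?thesis by (simp add: x_def algebra_simps)
      qed
      have e: "((\<lambda>t. (hermite a (r * sin t))\<^sup>2) has_real_derivative
          x * (2 * hermite a y * hermite_deriv a y)) (at t)" for a
      proof -
        have "((\<lambda>t. r * sin t) has_real_derivative x) (at t)"
          by (auto intro!: derivative_eq_intros simp: x_def)
        from DERIV_chain2[OF has_real_derivative_hermite this, of a]
        have "((\<lambda>t. hermite a (r * sin t)) has_real_derivative hermite_deriv a y * x) (at t)"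
          by (simp add: y_def)
        from DERIV_power[OF this, of 2] show ?thesis by (simp add: y_def algebra_simps)
      qed
      have "(f has_real_derivative (\<Sum>i=0..k.
          - y * (2 * hermite i x * hermite_deriv i x) * (hermite (k - i) y)\<^sup>2
          + x * (2 * hermite (k - i) y * hermite_deriv (k - i) y) * (hermite i x)\<^sup>2)) (at t)"
        unfolding f_def[abs_def] fps_mult_nth hermite_fps_def fps_nth_Abs_fps
        using DERIV_mult[OF d e] by (intro DERIV_sum) (simp add: x_def y_def)
      also have "(\<Sum>i=0..k.
          - y * (2 * hermite i x * hermite_deriv i x) * (hermite (k - i) y)\<^sup>2
          + x * (2 * hermite (k - i) y * hermite_deriv (k - i) y) * (hermite i x)\<^sup>2) = D $ k"
      proof -
        have "D $ k = - y * (hermite_fps_deriv x * hermite_fps y) $ k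
            + x * (hermite_fps x * hermite_fps_deriv y) $ k"
          by (simp add: D_def mult.assoc)
        then show ?thesis
          unfolding fps_mult_nth hermite_fps_def hermite_fps_deriv_def fps_nth_Abs_fps
            sum_distrib_left sum.distrib[symmetric]
          by (auto intro!: sum.cong simp: algebra_simps)
      qed
      finally show ?thesis .
    qed
    then show ?thesis by (simp add: D0)
  qed
  then have "f t = f 0" by (metis DERIV_isconst_all)
  then show "(hermite_fps (r * cos t) * hermite_fps (r * sin t)) $ k
      = (hermite_fps r * hermite_fps 0) $ k"
    by (simp add: f_def)
qed

lemma hermite_fps_mult_nth_le: "(hermite_fps x * hermite_fps y) $ k \<le> 7000"
proof -
  obtain r t where "x = r * cos t" "y = r * sin t" using polar_Ex by blast
  then have "(hermite_fps x * hermite_fps y) $ k = (hermite_fps 0 * hermite_fps r) $ k"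
    by (simp add: hermite_fps_rotation mult.commute)
  also have "\<dots> = (\<Sum>b\<le>k. (hermite (k - b) r)\<^sup>2 * (hermite b 0)\<^sup>2)"
    by (simp add: fps_mult_nth hermite_fps_def atMost_atLeast0 mult.commute)
  also have "\<dots> \<le> 7000" by (rule sum_hermite_sq_mult_zero_le)
  finally show ?thesis .
qed

lemma fps_mult_nth_nonneg:
  fixes f g :: "real fps"
  assumes "\<And>n. f $ n \<ge> 0" "\<And>n. g $ n \<ge> 0"
  shows "(f * g) $ n \<ge> 0"
  using assms by (auto simp: fps_mult_nth intro!: sum_nonneg mult_nonneg_nonneg)

lemma hermite_fps_prod_nonneg: "(\<Prod>b\<in>S. hermite_fps (x b)) $ n \<ge> 0"
proof (induction S arbitrary: n rule: infinite_finite_induct)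
  case (insert b S)
  have "hermite_fps (x b) $ n \<ge> 0" for n by (simp add: hermite_fps_def)
  then show ?case using insert fps_mult_nth_nonneg by simp
qed auto

text \<open>With nonnegative coefficients the triangle \<open>i + j \<le> n\<close> may be enlarged
  to a square.\<close>

lemma fps_mult_partial_sum_le:
  fixes f g :: "real fps"
  assumes "\<And>n. f $ n \<ge> 0" "\<And>n. g $ n \<ge> 0"
  shows "(\<Sum>k\<le>n. (f * g) $ k) \<le> (\<Sum>k\<le>n. f $ k) * (\<Sum>k\<le>n. g $ k)"
proof -
  have "(\<Sum>k\<le>n. (f * g) $ k) = (\<Sum>(i, j)\<in>{(i, j). i + j \<le> n}. f $ i * g $ j)"
    unfolding fps_mult_nth
    by (subst sum.triangle_reindex_eq) (simp add: atMost_atLeast0)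
  also have "\<dots> \<le> (\<Sum>(i, j)\<in>{..n} \<times> {..n}. f $ i * g $ j)"
    using assms by (intro sum_mono2) auto
  also have "\<dots> = (\<Sum>k\<le>n. f $ k) * (\<Sum>k\<le>n. g $ k)"
    by (simp add: sum_product sum.cartesian_product)
  finally show ?thesis .
qed

lemma hermite_fps_prod_partial_sum_le:
  assumes "finite S"
  shows "(\<Sum>k\<le>n. (\<Prod>b\<in>S. hermite_fps (x b)) $ k) \<le> (39 * sqrt (real n + 1)) ^ card S"
  using assms
proof (induction S rule: finite_induct)
  case empty
  have "(\<Sum>k\<le>n. (1::real fps) $ k) = (\<Sum>k\<in>{0}. (1::real fps) $ k)"
    by (rule sum.mono_neutral_right) auto
  then show ?case by simp
next
  case (insert b S)
  have "(\<Sum>k\<le>n. (\<Prod>b\<in>insert b S. hermite_fps (x b)) $ k)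
      \<le> (\<Sum>k\<le>n. hermite_fps (x b) $ k) * (\<Sum>k\<le>n. (\<Prod>b\<in>S. hermite_fps (x b)) $ k)"
    using insert fps_mult_partial_sum_le[OF _ hermite_fps_prod_nonneg, of "hermite_fps (x b)"]
    by (simp add: hermite_fps_def)
  also have "\<dots> \<le> (39 * sqrt (real n + 1)) * (39 * sqrt (real n + 1)) ^ card S"
    using insert by (intro mult_mono) (auto simp: hermite_fps_def sum_hermite_sq_le intro!: sum_nonneg hermite_fps_prod_nonneg[unfolded hermite_fps_def])
  finally show ?case using insert by simp
qed

text \<open>One pair of coordinates has bounded coefficients, and each of the remaining
  \<open>card S - 2\<close> contributes a factor \<open>sqrt (k + 1)\<close>; this is the exponent
  \<open>d / 2 - 1\<close>. A single coordinate is the Airy bound.\<close>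

lemma hermite_fps_prod_nth_le:
  assumes "finite S" "S \<noteq> {}"
  shows "(\<Prod>b\<in>S. hermite_fps (x b)) $ k \<le> 7000 * 39 ^ card S * (real k + 1) powr gamma_exp (card S)"
proof (cases "card S = 1")
  case True
  then obtain b where S: "S = {b}" using card_1_singletonE by blast
  have "(hermite k (x b))\<^sup>2 \<le> 72 / (2 * real k + 1) powr (1 / 6)" by (rule hermite_sq_le)
  also have "\<dots> \<le> 72 / (real k + 1) powr (1 / 6)"
    by (intro divide_left_mono powr_mono2) auto
  also have "\<dots> \<le> 7000 * 39 / (real k + 1) powr (1 / 6)"
    by (intro divide_right_mono) auto
  also have "\<dots> = 7000 * 39 ^ card S * (real k + 1) powr gamma_exp (card S)"
    by (simp add: True gamma_exp_def powr_minus_divide)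
  finally show ?thesis by (simp add: S hermite_fps_def)
next
  case False
  obtain b where b: "b \<in> S" using assms by blast
  have "S - {b} \<noteq> {}" using False b assms by (metis card_1_singleton_iff insert_Diff One_nat_def)
  then obtain c where c: "c \<in> S" "c \<noteq> b" by blast
  define U where "U = S - {b, c}"
  have S: "S = insert b (insert c U)" "b \<notin> insert c U" "c \<notin> U" "finite U"
    using b c assms by (auto simp: U_def)
  have card: "card S = card U + 2" using S by simp
  define g where "g = (\<Prod>b\<in>U. hermite_fps (x b))"
  have "(\<Prod>b\<in>S. hermite_fps (x b)) = (hermite_fps (x b) * hermite_fps (x c)) * g"
    using S by (simp add: g_def mult.assoc)
  then have "(\<Prod>b\<in>S. hermite_fps (x b)) $ k = (g * (hermite_fps (x b) * hermite_fps (x c))) $ k"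
    by (simp add: mult.commute)
  also have "\<dots> = (\<Sum>i=0..k. g $ i * (hermite_fps (x b) * hermite_fps (x c)) $ (k - i))"
    by (rule fps_mult_nth)
  also have "\<dots> \<le> (\<Sum>i=0..k. g $ i * 7000)"
    unfolding g_def
    by (intro sum_mono mult_left_mono hermite_fps_mult_nth_le hermite_fps_prod_nonneg)
  also have "\<dots> = 7000 * (\<Sum>i\<le>k. g $ i)"
    unfolding sum_distrib_left atMost_atLeast0 by (simp only: mult.commute)
  also have "\<dots> \<le> 7000 * (39 * sqrt (real k + 1)) ^ card U"
    unfolding g_def using S by (intro mult_left_mono hermite_fps_prod_partial_sum_le) auto
  also have "\<dots> = 7000 * 39 ^ card U * (real k + 1) powr gamma_exp (card S)"
  proof -
    have "sqrt (real k + 1) ^ card U = (real k + 1) powr gamma_exp (card S)"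
      by (simp add: card gamma_exp_def powr_half_sqrt[symmetric] powr_power add_divide_distrib)
    then show ?thesis by (simp add: power_mult_distrib)
  qed
  also have "\<dots> \<le> 7000 * 39 ^ card S * (real k + 1) powr gamma_exp (card S)"
    by (intro mult_right_mono mult_left_mono power_increasing) (auto simp: card)
  finally show ?thesis .
qed

text \<open>Extensional functions, so that each multi-index is represented once: the set is finite
  for finite \<open>S\<close>, its cardinality is meaningful, and two indices that agree on
  \<open>S\<close> are equal.\<close>

definition multi_indices :: "'b set \<Rightarrow> nat \<Rightarrow> ('b \<Rightarrow> nat) set" where
  "multi_indices S k = {\<alpha> \<in> S \<rightarrow>\<^sub>E UNIV. sum \<alpha> S = k}"

lemma multi_indices_subset:
  assumes "finite S"
  shows "multi_indices S k \<subseteq> S \<rightarrow>\<^sub>E {..k}"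
proof
  fix \<alpha> assume a: "\<alpha> \<in> multi_indices S k"
  then have "\<alpha> b \<le> k" if "b \<in> S" for b
    using member_le_sum[of b S \<alpha>] assms that by (auto simp: multi_indices_def)
  then show "\<alpha> \<in> S \<rightarrow>\<^sub>E {..k}" using a by (auto simp: multi_indices_def PiE_iff)
qed

lemma finite_multi_indices: "finite S \<Longrightarrow> finite (multi_indices S k)"
  by (rule finite_subset[OF multi_indices_subset]) (auto intro: finite_PiE)

lemma card_multi_indices_le: "finite S \<Longrightarrow> card (multi_indices S k) \<le> (k + 1) ^ card S"
  using card_mono[OF _ multi_indices_subset, of S k] by (simp add: card_PiE finite_PiE)

text \<open>Splitting off the value at one coordinate is the Cauchy product of series; that
  coordinate is reset to \<open>undefined\<close> to keep the rest extensional.\<close>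

lemma sum_multi_indices_prod:
  fixes f :: "'b \<Rightarrow> nat \<Rightarrow> real"
  assumes "finite S"
  shows "(\<Sum>\<alpha>\<in>multi_indices S k. \<Prod>b\<in>S. f b (\<alpha> b)) = (\<Prod>b\<in>S. Abs_fps (f b)) $ k"
  using assms
proof (induction S arbitrary: k rule: finite_induct)
  case empty
  have "multi_indices ({} :: 'b set) k = (if k = 0 then {\<lambda>_. undefined} else {})"
    by (auto simp: multi_indices_def)
  then show ?case by (cases "k = 0") auto
next
  case (insert b S)
  have "(\<Sum>\<alpha>\<in>multi_indices (insert b S) k. \<Prod>c\<in>insert b S. f c (\<alpha> c))
      = (\<Sum>(a, \<beta>)\<in>(SIGMA a:{0..k}. multi_indices S (k - a)). f b a * (\<Prod>c\<in>S. f c (\<beta> c)))"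
  proof (rule sum.reindex_bij_witness[of _ "\<lambda>(a, \<beta>). \<beta>(b := a)" "\<lambda>\<alpha>. (\<alpha> b, \<alpha>(b := undefined))"])
    fix \<alpha> assume a: "\<alpha> \<in> multi_indices (insert b S) k"
    then have s: "\<alpha> b + sum \<alpha> S = k" using insert by (simp add: multi_indices_def)
    have "sum (\<alpha>(b := undefined)) S = sum \<alpha> S" using insert by (intro sum.cong) auto
    then show "(\<alpha> b, \<alpha>(b := undefined)) \<in> (SIGMA a:{0..k}. multi_indices S (k - a))"
      using a s insert by (auto simp: multi_indices_def PiE_iff extensional_def)
    show "(case (\<alpha> b, \<alpha>(b := undefined)) of (a, \<beta>) \<Rightarrow> f b a * (\<Prod>c\<in>S. f c (\<beta> c)))
        = (\<Prod>c\<in>insert b S. f c (\<alpha> c))"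
      using insert by (auto intro!: prod.cong)
  next
    fix p assume p: "p \<in> (SIGMA a:{0..k}. multi_indices S (k - a))"
    obtain a \<beta> where ab: "p = (a, \<beta>)" by force
    have "sum (\<beta>(b := a)) S = sum \<beta> S" using insert by (intro sum.cong) auto
    then show "(case p of (a, \<beta>) \<Rightarrow> \<beta>(b := a)) \<in> multi_indices (insert b S) k"
      using p insert by (auto simp: ab multi_indices_def PiE_iff extensional_def)
    show "((case p of (a, \<beta>) \<Rightarrow> \<beta>(b := a)) b, (case p of (a, \<beta>) \<Rightarrow> \<beta>(b := a))(b := undefined)) = p"
      using p insert by (auto simp: ab multi_indices_def PiE_iff extensional_def)
  qed auto
  also have "\<dots> = (\<Sum>a=0..k. f b a * (\<Sum>\<beta>\<in>multi_indices S (k - a). \<Prod>c\<in>S. f c (\<beta> c)))"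
    using insert(1) by (subst sum.Sigma[symmetric]) (auto simp: finite_multi_indices sum_distrib_left)
  also have "\<dots> = (\<Prod>c\<in>insert b S. Abs_fps (f c)) $ k"
    using insert by (simp add: fps_mult_nth)
  finally show ?case .
qed

lemma sum_multi_indices_hermite_le:
  assumes "finite S" "S \<noteq> {}"
  shows "(\<Sum>\<alpha>\<in>multi_indices S k. \<Prod>b\<in>S. (hermite (\<alpha> b) (x b))\<^sup>2)
    \<le> 7000 * 39 ^ card S * (real k + 1) powr gamma_exp (card S)"
  using hermite_fps_prod_nth_le[OF assms, of x k]
  using sum_multi_indices_prod[OF assms(1), of "\<lambda>b a. (hermite a (x b))\<^sup>2" k]
  by (simp add: hermite_fps_def)

section \<open>Ladder identities, crude bounds and orthonormality on the line\<close>

lemma hermite_abs_le: "\<bar>hermite n x\<bar> \<le> 9"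
  by (rule power2_le_imp_le) (use hermite_sq_le_const[of n x] in auto)

lemma mult_hermite:
  "x * hermite n x = sqrt ((real n + 1) / 2) * hermite (Suc n) x + sqrt (real n / 2) * hermite (n - 1) x"
proof -
  have "sqrt 2 * (x * hermite n x) = sqrt (real n + 1) * hermite (Suc n) x + sqrt (real n) * hermite (n - 1) x"
    using hermite_Suc[of n x] by simp
  then show ?thesis by (simp add: real_sqrt_divide field_simps)
qed

lemma hermite_deriv_eq:
  "hermite_deriv n x = sqrt (real n / 2) * hermite (n - 1) x - sqrt ((real n + 1) / 2) * hermite (Suc n) x"
proof -
  have "sqrt (2 * real n) = 2 * sqrt (real n / 2)"
    using real_sqrt_mult[of "2\<^sup>2" "real n / 2"] by simp
  then show ?thesis unfolding hermite_deriv_def mult_hermite by simp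
qed

text \<open>Both expressions combine the two neighbouring degrees with coefficients at most
  \<open>n + 1\<close>, and every degree is bounded by 9. Polynomial growth in \<open>n\<close> is
  enough for the net argument.\<close>

lemma mult_hermite_abs_le: "\<bar>x * hermite n x\<bar> \<le> 18 * (real n + 1)"
  and hermite_deriv_abs_le: "\<bar>hermite_deriv n x\<bar> \<le> 18 * (real n + 1)"
proof -
  define a where "a = sqrt ((real n + 1) / 2) * hermite (Suc n) x"
  define b where "b = sqrt (real n / 2) * hermite (n - 1) x"
  have sq: "sqrt t \<le> real n + 1" if "t \<le> real n + 1" for t
  proof (rule real_le_lsqrt)
    show "t \<le> (real n + 1)\<^sup>2" by (rule order_trans[OF that]) (simp add: self_le_power)
  qed simp
  have "\<bar>a\<bar> \<le> (real n + 1) * 9"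
    unfolding a_def abs_mult by (rule mult_mono) (use sq[of "(real n + 1) / 2"] hermite_abs_le in auto)
  moreover have "\<bar>b\<bar> \<le> (real n + 1) * 9"
    unfolding b_def abs_mult by (rule mult_mono) (use sq[of "real n / 2"] hermite_abs_le in auto)
  ultimately show "\<bar>x * hermite n x\<bar> \<le> 18 * (real n + 1)" "\<bar>hermite_deriv n x\<bar> \<le> 18 * (real n + 1)"
    unfolding mult_hermite hermite_deriv_eq a_def[symmetric] b_def[symmetric] by linarith+
qed

lemma hermite_lipschitz: "\<bar>hermite n x - hermite n y\<bar> \<le> 18 * (real n + 1) * \<bar>x - y\<bar>"
  using field_differentiable_bound[of UNIV "hermite n" "hermite_deriv n" "18 * (real n + 1)" x y]
    has_real_derivative_hermite hermite_deriv_abs_le by simp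

lemma hermite_rapid_decay: "\<exists>C. \<forall>x. (1 + \<bar>x\<bar>) ^ k * \<bar>hermite n x\<bar> \<le> C"
proof -
  obtain C where C: "\<And>x. \<bar>x\<bar> ^ k * \<bar>hermite n x\<bar> \<le> C" using hermite_decay by blast
  have "(1 + \<bar>x\<bar>) ^ k * \<bar>hermite n x\<bar> \<le> 2 ^ k * (9 + C)" for x
  proof -
    have "(1 + \<bar>x\<bar>) ^ k \<le> (2 * max 1 \<bar>x\<bar>) ^ k" by (intro power_mono) auto
    also have "\<dots> \<le> 2 ^ k * (1 + \<bar>x\<bar> ^ k)"
      by (auto simp: power_mult_distrib max_def)
    finally have "(1 + \<bar>x\<bar>) ^ k * \<bar>hermite n x\<bar> \<le> 2 ^ k * (1 + \<bar>x\<bar> ^ k) * \<bar>hermite n x\<bar>"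
      by (intro mult_right_mono) auto
    also have "\<dots> = 2 ^ k * (\<bar>hermite n x\<bar> + \<bar>x\<bar> ^ k * \<bar>hermite n x\<bar>)" by (simp add: algebra_simps)
    also have "\<dots> \<le> 2 ^ k * (9 + C)"
      using C[of x] hermite_abs_le[of n x] by (intro mult_left_mono add_mono) auto
    finally show ?thesis .
  qed
  then show ?thesis by blast
qed

lemma continuous_on_hermite [continuous_intros]:
  "continuous_on S f \<Longrightarrow> continuous_on S (\<lambda>x. hermite n (f x))"
  by (rule continuous_on_compose2[of UNIV "hermite n"])
    (auto intro!: continuous_at_imp_continuous_on DERIV_isCont[OF has_real_derivative_hermite])

lemma borel_measurable_hermite [measurable]: "hermite n \<in> borel_measurable borel"
  by (intro borel_measurable_continuous_onI continuous_intros)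

lemma integrable_inverse_1_plus_square_lborel: "integrable lborel (\<lambda>x::real. inverse (1 + x\<^sup>2))"
  using integrable_inverse_1_plus_square by (simp add: set_integrable_def einterval_def)

lemma integrable_hermite_mult: "integrable lborel (\<lambda>x. hermite m x * hermite n x)"
proof -
  obtain C where C: "\<And>x. (1 + \<bar>x\<bar>) ^ 2 * \<bar>hermite m x\<bar> \<le> C" using hermite_rapid_decay by blast
  show ?thesis
  proof (rule Bochner_Integration.integrable_bound)
    show "integrable lborel (\<lambda>x. 9 * C * inverse (1 + x\<^sup>2))"
      by (intro integrable_mult_right integrable_inverse_1_plus_square_lborel)
    show "AE x in lborel. norm (hermite m x * hermite n x) \<le> norm (9 * C * inverse (1 + x\<^sup>2))"
    proof (rule AE_I2)
      fix x :: real
      have "(1 + x\<^sup>2) * \<bar>hermite m x\<bar> \<le> (1 + \<bar>x\<bar>) ^ 2 * \<bar>hermite m x\<bar>"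
        by (intro mult_right_mono) (auto simp: power2_sum)
      also have "\<dots> \<le> C" by (rule C)
      finally have h: "\<bar>hermite m x\<bar> \<le> C * inverse (1 + x\<^sup>2)"
        by (simp add: field_simps add_pos_nonneg)
      have "\<bar>hermite m x\<bar> * \<bar>hermite n x\<bar> \<le> (C * inverse (1 + x\<^sup>2)) * 9"
        using h by (intro mult_mono hermite_abs_le) auto
      also have "\<dots> \<le> \<bar>9 * C * inverse (1 + x\<^sup>2)\<bar>" by simp
      finally show "norm (hermite m x * hermite n x) \<le> norm (9 * C * inverse (1 + x\<^sup>2))"
        by (simp add: abs_mult)
    qed
  qed measurable
qed

lemma integral_deriv_eq_0:
  fixes F f :: "real \<Rightarrow> real"
  assumes "\<And>x. (F has_real_derivative f x) (at x)" "continuous_on UNIV f" "integrable lborel f"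
    and "(F \<longlongrightarrow> 0) at_infinity"
  shows "(LINT x|lborel. f x) = 0"
proof -
  have "(LBINT x=-\<infinity>..\<infinity>. f x) = 0 - 0"
  proof (rule interval_integral_FTC_integrable)
    show "((F \<circ> real_of_ereal) \<longlongrightarrow> 0) (at_right (- \<infinity>))"
      using tendsto_mono[OF at_bot_le_at_infinity assms(4)] by (simp add: ereal_tendsto_simps)
    show "((F \<circ> real_of_ereal) \<longlongrightarrow> 0) (at_left \<infinity>)"
      using tendsto_mono[OF at_top_le_at_infinity assms(4)] by (simp add: ereal_tendsto_simps)
    show "set_integrable lborel (einterval (- \<infinity>) \<infinity>) f"
      using assms(3) by (simp add: set_integrable_def einterval_def)
    show "isCont f x" for x using assms(2) by (simp add: continuous_on_eq_continuous_at)
    show "(F has_vector_derivative f x) (at x)" for x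
      using assms(1) by (simp add: has_real_derivative_iff_has_vector_derivative)
  qed simp
  then show ?thesis
    by (simp add: interval_lebesgue_integral_def einterval_def set_lebesgue_integral_def)
qed

lemma tendsto_hermite_mult_at_infinity:
  "((\<lambda>x. hermite m x * hermite n x) \<longlongrightarrow> 0) at_infinity"
  "((\<lambda>x. hermite m x * hermite_deriv n x) \<longlongrightarrow> 0) at_infinity"
proof -
  have h: "(hermite n \<longlongrightarrow> 0) at_infinity" for n
    using tendsto_hermite_at_infinity[of 0 n] by simp
  have "((\<lambda>x. hermite m x * hermite n x) \<longlongrightarrow> 0 * 0) at_infinity" by (intro tendsto_mult h)
  then show "((\<lambda>x. hermite m x * hermite n x) \<longlongrightarrow> 0) at_infinity" by simp
  have "((\<lambda>x. hermite m x * (sqrt (real n / 2) * hermite (n - 1) x - sqrt ((real n + 1) / 2) * hermite (Suc n) x))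
      \<longlongrightarrow> 0 * (sqrt (real n / 2) * 0 - sqrt ((real n + 1) / 2) * 0)) at_infinity"
    by (intro tendsto_mult tendsto_diff tendsto_mult_left h)
  then show "((\<lambda>x. hermite m x * hermite_deriv n x) \<longlongrightarrow> 0) at_infinity"
    by (simp only: hermite_deriv_eq mult_zero_left)
qed

text \<open>For different degrees, the derivative of the Wronskian is \<open>2 * (m - n)\<close>
  times the integrand. For equal ones, the derivative of
  \<open>hermite k x * hermite (Suc k) x\<close> shows that the norm does not depend on
  \<open>k\<close>, and the square of \<open>hermite 0\<close> is a normal density.\<close>

lemma integral_hermite_mult: "(LINT x|lborel. hermite m x * hermite n x) = (if m = n then 1 else 0)"
proof (cases "m = n")
  case False
  have "(LINT x|lborel. 2 * (real m - real n) * (hermite m x * hermite n x)) = 0"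
  proof (rule integral_deriv_eq_0)
    fix x
    show "((\<lambda>x. hermite m x * hermite_deriv n x - hermite n x * hermite_deriv m x)
        has_real_derivative 2 * (real m - real n) * (hermite m x * hermite n x)) (at x)"
      by (rule derivative_eq_intros has_real_derivative_hermite has_real_derivative_hermite_deriv refl)+
        (simp add: algebra_simps)
  next
    have "((\<lambda>x. hermite m x * hermite_deriv n x - hermite n x * hermite_deriv m x) \<longlongrightarrow> 0 - 0) at_infinity"
      by (intro tendsto_diff tendsto_hermite_mult_at_infinity)
    then show "((\<lambda>x. hermite m x * hermite_deriv n x - hermite n x * hermite_deriv m x) \<longlongrightarrow> 0) at_infinity"
      by simp
  qed (intro continuous_intros integrable_mult_right integrable_hermite_mult)+
  then show ?thesis using False by simp
next
  case True
  have step: "(LINT x|lborel. hermite (Suc k) x * hermite (Suc k) x) = (LINT x|lborel. hermite k x * hermite k x)" for k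
  proof -
    define c where "c = sqrt (2 * (real k + 1))"
    have c: "c > 0" by (simp add: c_def)
    have "(LINT x|lborel. c * (hermite k x * hermite k x - hermite (Suc k) x * hermite (Suc k) x)) = 0"
    proof (rule integral_deriv_eq_0)
      fix x
      show "((\<lambda>x. hermite k x * hermite (Suc k) x)
          has_real_derivative c * (hermite k x * hermite k x - hermite (Suc k) x * hermite (Suc k) x)) (at x)"
        apply (rule derivative_eq_intros has_real_derivative_hermite refl)+
        unfolding hermite_deriv_Suc hermite_deriv_eq_raise[of k] c_def
        by (simp only: algebra_simps)
    qed (intro continuous_intros integrable_mult_right Bochner_Integration.integrable_diff
        integrable_hermite_mult tendsto_hermite_mult_at_infinity)+
    then show ?thesis using c by (simp add: integrable_hermite_mult del: hermite.simps)
  qed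
  have "(LINT x|lborel. hermite 0 x * hermite 0 x) = (LINT x|lborel. normal_density 0 (1 / sqrt 2) x)"
  proof (rule Bochner_Integration.integral_cong)
    fix x :: real
    have "pi powr (- 1 / 4) * pi powr (- 1 / 4) = pi powr - (1 / 2)" by (simp flip: powr_add)
    then have "pi powr (- 1 / 4) * pi powr (- 1 / 4) = 1 / sqrt pi"
      by (simp add: powr_minus_divide powr_half_sqrt)
    moreover have "exp (- x\<^sup>2 / 2) * exp (- x\<^sup>2 / 2) = exp (- x\<^sup>2)" by (simp flip: exp_add)
    ultimately show "hermite 0 x * hermite 0 x = normal_density 0 (1 / sqrt 2) x"
      by (simp add: normal_density_def power_divide mult_ac)
  qed simp
  also have "\<dots> = 1" by (rule integral_normal_density) simp
  finally have "(LINT x|lborel. hermite k x * hermite k x) = 1" for k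
    by (induction k) (simp_all only: step)
  then show ?thesis using True by simp
qed

subsection \<open>Tensor products of Hermite functions\<close>

text \<open>The factor may vary with the coordinate, so that a partial derivative is the same
  expression with one factor updated.\<close>

definition tensor :: "('a::euclidean_space \<Rightarrow> real \<Rightarrow> real) \<Rightarrow> 'a \<Rightarrow> real" where
  "tensor F x = (\<Prod>b\<in>Basis. F b (x \<bullet> b))"

lemma tensor_fun_upd:
  assumes "b \<in> Basis"
  shows "tensor (F(b := g)) x = g (x \<bullet> b) * (\<Prod>c\<in>Basis - {b}. F c (x \<bullet> c))"
proof -
  have "tensor (F(b := g)) x = (F(b := g)) b (x \<bullet> b) * (\<Prod>c\<in>Basis - {b}. (F(b := g)) c (x \<bullet> c))"
    unfolding tensor_def using assms by (intro prod.remove) auto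
  also have "(\<Prod>c\<in>Basis - {b}. (F(b := g)) c (x \<bullet> c)) = (\<Prod>c\<in>Basis - {b}. F c (x \<bullet> c))"
    by (intro prod.cong) auto
  finally show ?thesis by (simp only: fun_upd_same)
qed

lemma has_derivative_tensor:
  fixes F F' :: "'a::euclidean_space \<Rightarrow> real \<Rightarrow> real"
  assumes "\<And>b t. b \<in> Basis \<Longrightarrow> (F b has_real_derivative F' b t) (at t)"
  shows "(tensor F has_derivative (\<lambda>v. \<Sum>b\<in>Basis. (v \<bullet> b) * tensor (F(b := F' b)) x)) (at x)"
proof -
  have "((\<lambda>x. F b (x \<bullet> b)) has_derivative (\<lambda>v. (v \<bullet> b) * F' b (x \<bullet> b))) (at x)" if "b \<in> Basis" for b
  proof -
    have "((\<lambda>x. x \<bullet> b) has_derivative (\<lambda>v. v \<bullet> b)) (at x)"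
      by (auto intro!: derivative_eq_intros)
    moreover have "(F b has_derivative (\<lambda>h. h * F' b (x \<bullet> b))) (at (x \<bullet> b))"
      using assms[OF that, of "x \<bullet> b"] by (simp add: has_field_derivative_def mult_commute_abs)
    ultimately show ?thesis by (rule has_derivative_compose)
  qed
  then have "((\<lambda>x. \<Prod>b\<in>Basis. F b (x \<bullet> b)) has_derivative
      (\<lambda>v. \<Sum>b\<in>Basis. (v \<bullet> b) * F' b (x \<bullet> b) * (\<Prod>c\<in>Basis - {b}. F c (x \<bullet> c)))) (at x)"
    by (rule has_derivative_prod)
  then show ?thesis
    unfolding tensor_def[of F, abs_def] by (simp add: tensor_fun_upd mult.assoc cong: sum.cong)
qed

lemma partial_deriv_eq:
  "(f has_derivative D) (at x) \<Longrightarrow> partial_deriv b f x = D b"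
  unfolding partial_deriv_def using frechet_derivative_at by metis

lemma tensor_complex_has_derivative:
  assumes "\<And>b t. b \<in> Basis \<Longrightarrow> (F b has_real_derivative F' b t) (at t)"
  shows "((\<lambda>x. complex_of_real (tensor F x)) has_derivative
    (\<lambda>v. of_real (\<Sum>b\<in>Basis. (v \<bullet> b) * tensor (F(b := F' b)) x))) (at x)"
  by (intro has_derivative_of_real has_derivative_tensor assms)

lemma partial_deriv_tensor:
  fixes F :: "'a::euclidean_space \<Rightarrow> real \<Rightarrow> real"
  assumes "\<And>b t. b \<in> Basis \<Longrightarrow> (F b has_real_derivative F' b t) (at t)" "b \<in> Basis"
  shows "partial_deriv b (\<lambda>x. complex_of_real (tensor F x)) = (\<lambda>x. of_real (tensor (F(b := F' b)) x))"
proof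
  fix x
  have "(\<Sum>c\<in>Basis. (b \<bullet> c) * tensor (F(c := F' c)) x) = tensor (F(b := F' b)) x"
  proof -
    have "(\<Sum>c\<in>Basis. (b \<bullet> c) * tensor (F(c := F' c)) x)
        = (\<Sum>c\<in>Basis. if c = b then tensor (F(c := F' c)) x else 0)"
      using assms(2) by (intro sum.cong) (auto simp: inner_Basis)
    then show ?thesis using assms(2) by simp
  qed
  moreover have "((\<lambda>x. complex_of_real (tensor F x)) has_derivative
      (\<lambda>v. of_real (\<Sum>b\<in>Basis. (v \<bullet> b) * tensor (F(b := F' b)) x))) (at x)"
    by (rule tensor_complex_has_derivative) (rule assms(1))
  ultimately show "partial_deriv b (\<lambda>x. complex_of_real (tensor F x)) x = of_real (tensor (F(b := F' b)) x)"
    by (simp only: partial_deriv_eq)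
qed

definition hermite_tensor :: "('a::euclidean_space \<Rightarrow> nat) \<Rightarrow> 'a \<Rightarrow> complex" where
  "hermite_tensor \<alpha> x = of_real (tensor (\<lambda>b. hermite (\<alpha> b)) x)"

lemma norm_hermite_tensor: "norm (hermite_tensor \<alpha> x) = (\<Prod>b\<in>Basis. \<bar>hermite (\<alpha> b) (x \<bullet> b)\<bar>)"
  unfolding hermite_tensor_def tensor_def norm_of_real by (rule abs_prod)

lemma hermite_tensor_fun_upd:
  assumes "b \<in> Basis"
  shows "hermite_tensor (\<alpha>(b := n)) x = of_real (tensor ((\<lambda>b. hermite (\<alpha> b))(b := hermite n)) x)"
  unfolding hermite_tensor_def by (rule arg_cong[where f = "\<lambda>F. of_real (tensor F x)"]) auto

lemma partial_deriv_hermite_tensor: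
  assumes "b \<in> Basis"
  shows "partial_deriv b (hermite_tensor \<alpha>)
    = (\<lambda>x. of_real (tensor ((\<lambda>b. hermite (\<alpha> b))(b := hermite_deriv (\<alpha> b))) x))"
  unfolding hermite_tensor_def[abs_def]
  by (rule partial_deriv_tensor[where F' = "\<lambda>b. hermite_deriv (\<alpha> b)"]) (auto simp: assms has_real_derivative_hermite)

lemma partial_deriv_hermite_tensor_ladder:
  assumes "b \<in> Basis"
  shows "partial_deriv b (hermite_tensor \<alpha>)
    = (\<lambda>x. of_real (sqrt (real (\<alpha> b) / 2)) * hermite_tensor (\<alpha>(b := \<alpha> b - 1)) x
         + of_real (- sqrt ((real (\<alpha> b) + 1) / 2)) * hermite_tensor (\<alpha>(b := Suc (\<alpha> b))) x)"
  unfolding partial_deriv_hermite_tensor[OF assms] hermite_tensor_fun_upd[OF assms] tensor_fun_upd[OF assms]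
    hermite_deriv_eq
  by (simp add: algebra_simps)

lemma inner_mult_hermite_tensor:
  assumes "b \<in> Basis"
  shows "of_real (x \<bullet> b) * hermite_tensor \<alpha> x
    = of_real (sqrt ((real (\<alpha> b) + 1) / 2)) * hermite_tensor (\<alpha>(b := Suc (\<alpha> b))) x
    + of_real (sqrt (real (\<alpha> b) / 2)) * hermite_tensor (\<alpha>(b := \<alpha> b - 1)) x"
proof -
  have "hermite_tensor \<alpha> x = hermite_tensor (\<alpha>(b := \<alpha> b)) x" by simp
  also have "of_real (x \<bullet> b) * \<dots> = of_real ((x \<bullet> b * hermite (\<alpha> b) (x \<bullet> b)) * (\<Prod>c\<in>Basis - {b}. hermite (\<alpha> c) (x \<bullet> c)))"
    unfolding hermite_tensor_fun_upd[OF assms] tensor_fun_upd[OF assms] by simp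
  finally show ?thesis
    unfolding mult_hermite hermite_tensor_fun_upd[OF assms] tensor_fun_upd[OF assms]
    by (simp add: algebra_simps)
qed

text \<open>Each second derivative multiplies the tensor by
  \<open>(x \<bullet> b)\<^sup>2 - (2 * \<alpha> b + 1)\<close>; the squares add up to the potential
  and cancel it.\<close>

lemma harm_osc_hermite_tensor:
  fixes \<alpha> :: "'a::euclidean_space \<Rightarrow> nat"
  shows "harm_osc (hermite_tensor \<alpha>)
    = (\<lambda>x. of_real (2 * real (sum \<alpha> Basis) + DIM('a)) * hermite_tensor \<alpha> x)"
proof
  fix x :: 'a
  have "partial_deriv b (partial_deriv b (hermite_tensor \<alpha>)) x
      = of_real ((x \<bullet> b)\<^sup>2 - (2 * real (\<alpha> b) + 1)) * hermite_tensor \<alpha> x" if b: "b \<in> Basis" for b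
  proof -
    define F where "F = (\<lambda>b. hermite (\<alpha> b))(b := hermite_deriv (\<alpha> b))"
    define F' where "F' = (\<lambda>b. hermite_deriv (\<alpha> b))(b := \<lambda>t. (t\<^sup>2 - (2 * real (\<alpha> b) + 1)) * hermite (\<alpha> b) t)"
    have "partial_deriv b (\<lambda>x. complex_of_real (tensor F x)) = (\<lambda>x. of_real (tensor (F(b := F' b)) x))"
      using b has_real_derivative_hermite has_real_derivative_hermite_deriv
      by (intro partial_deriv_tensor) (auto simp: F_def F'_def)
    then have "partial_deriv b (partial_deriv b (hermite_tensor \<alpha>)) x = of_real (tensor (F(b := F' b)) x)"
      unfolding partial_deriv_hermite_tensor[OF b] F_def by simp
    also have "F(b := F' b) = (\<lambda>b. hermite (\<alpha> b))(b := F' b)" by (simp add: F_def)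
    also have "of_real (tensor \<dots> x) = of_real ((x \<bullet> b)\<^sup>2 - (2 * real (\<alpha> b) + 1))
        * (of_real (tensor (\<lambda>b. hermite (\<alpha> b)) x) :: complex)"
    proof -
      have "tensor (\<lambda>b. hermite (\<alpha> b)) x = hermite (\<alpha> b) (x \<bullet> b) * (\<Prod>c\<in>Basis - {b}. hermite (\<alpha> c) (x \<bullet> c))"
        using tensor_fun_upd[OF b, of "\<lambda>b. hermite (\<alpha> b)" "hermite (\<alpha> b)" x] by (simp add: fun_upd_idem)
      then show ?thesis unfolding tensor_fun_upd[OF b] by (simp add: F'_def)
    qed
    finally show ?thesis unfolding hermite_tensor_def[of \<alpha> x] .
  qed
  then have "laplacian (hermite_tensor \<alpha>) x
      = (\<Sum>b\<in>Basis. of_real ((x \<bullet> b)\<^sup>2 - (2 * real (\<alpha> b) + 1)) * hermite_tensor \<alpha> x)"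
    unfolding laplacian_def by (intro sum.cong) auto
  also have "\<dots> = of_real (\<Sum>b\<in>Basis. (x \<bullet> b)\<^sup>2 - (2 * real (\<alpha> b) + 1)) * hermite_tensor \<alpha> x"
    by (simp add: sum_distrib_right)
  also have "(\<Sum>b\<in>Basis. (x \<bullet> b)\<^sup>2 - (2 * real (\<alpha> b) + 1)) = (norm x)\<^sup>2 - (2 * real (sum \<alpha> Basis) + DIM('a))"
  proof -
    have "(\<Sum>b\<in>Basis. (x \<bullet> b)\<^sup>2) = (norm x)\<^sup>2"
      unfolding power2_norm_eq_inner euclidean_inner[of x x] by (simp add: power2_eq_square)
    then show ?thesis by (simp add: sum_subtractf sum.distrib sum_distrib_left)
  qed
  finally show "harm_osc (hermite_tensor \<alpha>) x = of_real (2 * real (sum \<alpha> Basis) + DIM('a)) * hermite_tensor \<alpha> x"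
    by (simp add: harm_osc_def algebra_simps)
qed

text \<open>As an inductive predicate the span inherits from single tensors its closure under
  derivatives and under multiplication by coordinates, both given by the ladder identities, and its
  rapid decay.\<close>

inductive hermite_span :: "('a::euclidean_space \<Rightarrow> complex) \<Rightarrow> bool" where
  tensor: "hermite_span (hermite_tensor \<alpha>)"
| add: "hermite_span f \<Longrightarrow> hermite_span g \<Longrightarrow> hermite_span (\<lambda>x. f x + g x)"
| scale: "hermite_span f \<Longrightarrow> hermite_span (\<lambda>x. c * f x)"

lemma hermite_span_differentiable: "hermite_span f \<Longrightarrow> f differentiable (at x)"
proof (induction rule: hermite_span.induct)
  case (tensor \<alpha>)
  show ?case
    unfolding hermite_tensor_def[abs_def] differentiable_def
    using tensor_complex_has_derivative[where F = "\<lambda>b. hermite (\<alpha> b)" and F' = "\<lambda>b. hermite_deriv (\<alpha> b)",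
        OF has_real_derivative_hermite] by blast
qed (auto intro!: derivative_intros)

lemma hermite_span_partial_deriv:
  assumes "hermite_span f" "b \<in> Basis"
  shows "hermite_span (partial_deriv b f)"
  using assms(1)
proof (induction rule: hermite_span.induct)
  case (tensor \<alpha>)
  show ?case unfolding partial_deriv_hermite_tensor_ladder[OF assms(2)]
    by (intro hermite_span.intros)
next
  case (add f g)
  have "partial_deriv b (\<lambda>x. f x + g x) = (\<lambda>x. partial_deriv b f x + partial_deriv b g x)"
  proof
    fix x
    have "((\<lambda>x. f x + g x) has_derivative
        (\<lambda>v. frechet_derivative f (at x) v + frechet_derivative g (at x) v)) (at x)"
      using add hermite_span_differentiable by (intro has_derivative_add) (auto simp: frechet_derivative_works)
    from partial_deriv_eq[OF this] show "partial_deriv b (\<lambda>x. f x + g x) x = partial_deriv b f x + partial_deriv b g x"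
      by (simp add: partial_deriv_def)
  qed
  then show ?case using add by (auto intro: hermite_span.intros)
next
  case (scale f c)
  have "partial_deriv b (\<lambda>x. c * f x) = (\<lambda>x. c * partial_deriv b f x)"
  proof
    fix x
    have "((\<lambda>x. c * f x) has_derivative (\<lambda>v. c * frechet_derivative f (at x) v)) (at x)"
      using scale hermite_span_differentiable by (intro has_derivative_mult_right) (auto simp: frechet_derivative_works)
    from partial_deriv_eq[OF this] show "partial_deriv b (\<lambda>x. c * f x) x = c * partial_deriv b f x"
      by (simp add: partial_deriv_def)
  qed
  then show ?case using scale by (auto intro: hermite_span.intros)
qed

lemma hermite_span_iter_partial_deriv:
  "hermite_span f \<Longrightarrow> bs \<in> lists Basis \<Longrightarrow> hermite_span (iter_partial_deriv bs f)"
  by (induction bs) (auto intro: hermite_span_partial_deriv)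

text \<open>Reduces decay in the norm to decay in each coordinate, where products of one-dimensional
  bounds apply.\<close>

lemma one_plus_norm_le_prod: "1 + norm x \<le> (\<Prod>b\<in>Basis. 1 + \<bar>x \<bullet> b\<bar>)" for x :: "'a::euclidean_space"
proof -
  have "1 + sum f S \<le> (\<Prod>b\<in>S. 1 + f b)" if "finite S" "\<And>b. f b \<ge> 0" for S and f :: "'a \<Rightarrow> real"
    using that(1)
  proof (induction S rule: finite_induct)
    case (insert b S)
    have "1 + sum f (insert b S) \<le> 1 + f b + sum f S + f b * sum f S"
      using insert that(2) by (simp add: sum_nonneg)
    also have "\<dots> = (1 + f b) * (1 + sum f S)" by (simp add: algebra_simps)
    also have "\<dots> \<le> (1 + f b) * (\<Prod>b\<in>S. 1 + f b)"
      using insert that(2) by (intro mult_left_mono) (auto simp: add_nonneg_nonneg)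
    finally show ?case using insert by simp
  qed simp
  then have "1 + (\<Sum>b\<in>Basis. \<bar>x \<bullet> b\<bar>) \<le> (\<Prod>b\<in>Basis. 1 + \<bar>x \<bullet> b\<bar>)" by simp
  then show ?thesis using norm_le_l1[of x] by linarith
qed

lemma hermite_span_rapid_decay:
  "hermite_span f \<Longrightarrow> \<exists>C. \<forall>x. (1 + norm x) ^ k * norm (f x) \<le> C"
proof (induction rule: hermite_span.induct)
  case (tensor \<alpha>)
  have "\<forall>b. \<exists>C. \<forall>t. (1 + \<bar>t\<bar>) ^ k * \<bar>hermite (\<alpha> b) t\<bar> \<le> C" by (intro allI hermite_rapid_decay)
  then obtain C where C: "\<And>b t. (1 + \<bar>t\<bar>) ^ k * \<bar>hermite (\<alpha> b) t\<bar> \<le> C b" by metis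
  have "(1 + norm x) ^ k * norm (hermite_tensor \<alpha> x) \<le> (\<Prod>b\<in>Basis. C b)" for x
  proof -
    have "(1 + norm x) ^ k * norm (hermite_tensor \<alpha> x)
        \<le> (\<Prod>b\<in>Basis. 1 + \<bar>x \<bullet> b\<bar>) ^ k * norm (hermite_tensor \<alpha> x)"
      by (intro mult_right_mono power_mono one_plus_norm_le_prod) auto
    also have "\<dots> = (\<Prod>b\<in>Basis. (1 + \<bar>x \<bullet> b\<bar>) ^ k * \<bar>hermite (\<alpha> b) (x \<bullet> b)\<bar>)"
      by (simp add: norm_hermite_tensor prod.distrib prod_power_distrib)
    also have "\<dots> \<le> (\<Prod>b\<in>Basis. C b)" by (intro prod_mono) (auto simp: C)
    finally show ?thesis .
  qed
  then show ?case by blast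
next
  case (add f g)
  then obtain C D where CD: "\<And>x. (1 + norm x) ^ k * norm (f x) \<le> C" "\<And>x. (1 + norm x) ^ k * norm (g x) \<le> D" by blast
  have "(1 + norm x) ^ k * norm (f x + g x) \<le> C + D" for x
  proof -
    have "(1 + norm x) ^ k * norm (f x + g x) \<le> (1 + norm x) ^ k * (norm (f x) + norm (g x))"
      by (intro mult_left_mono norm_triangle_ineq) auto
    also have "\<dots> \<le> C + D" using CD[of x] by (simp add: distrib_left)
    finally show ?thesis .
  qed
  then show ?case by blast
next
  case (scale f c)
  then obtain C where C: "\<And>x. (1 + norm x) ^ k * norm (f x) \<le> C" by blast
  have "(1 + norm x) ^ k * norm (c * f x) \<le> norm c * C" for x
    using mult_left_mono[OF C[of x], of "norm c"] by (simp add: norm_mult mult_ac)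
  then show ?case by blast
qed

lemma hermite_span_schwartz: "hermite_span f \<Longrightarrow> schwartz f"
  unfolding schwartz_def
proof (intro ballI conjI allI)
  fix bs :: "'a list" and k x
  assume f: "hermite_span f" "bs \<in> lists Basis"
  note h = hermite_span_iter_partial_deriv[OF f]
  show "iter_partial_deriv bs f differentiable (at x)" using h by (rule hermite_span_differentiable)
  show "bounded (range (\<lambda>x. (1 + norm x) ^ k *\<^sub>R iter_partial_deriv bs f x))"
    using hermite_span_rapid_decay[OF h, of k] by (auto simp: bounded_iff)
qed

lemma schwartz_hermite_tensor: "schwartz (hermite_tensor \<alpha>)"
  by (intro hermite_span_schwartz hermite_span.tensor)

section \<open>Integrals and pointwise estimates of tensors\<close>

lemma
  fixes F :: "'a::euclidean_space \<Rightarrow> real \<Rightarrow> real"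
  assumes int: "\<And>b. b \<in> Basis \<Longrightarrow> integrable lborel (F b)"
  shows integrable_tensor: "integrable lborel (tensor F)"
    and integral_tensor: "(LINT x|lborel. tensor F x) = (\<Prod>b\<in>Basis. LINT t|lborel. F b t)"
proof -
  interpret product_sigma_finite "\<lambda>_::'a. lborel :: real measure" ..
  have [measurable]: "F b \<in> borel_measurable borel" if "b \<in> Basis" for b
    using borel_measurable_integrable[OF int[OF that]] by simp
  have m: "tensor F \<in> borel_measurable borel"
    unfolding tensor_def[abs_def] by measurable
  have g: "(\<lambda>f. \<Sum>b\<in>Basis. f b *\<^sub>R b) \<in> (\<Pi>\<^sub>M b\<in>Basis. lborel) \<rightarrow>\<^sub>M (borel :: 'a measure)"
    by measurable
  have t: "tensor F (\<Sum>b\<in>Basis. f b *\<^sub>R b) = (\<Prod>b\<in>Basis. F b (f b))" for f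
    unfolding tensor_def by (intro prod.cong) (auto simp: inner_sum_left_Basis)
  show "integrable lborel (tensor F)"
    unfolding lborel_eq[where 'a = 'a] integrable_distr_eq[OF g m] t
    by (rule product_integrable_prod) (auto intro: int)
  show "(LINT x|lborel. tensor F x) = (\<Prod>b\<in>Basis. LINT t|lborel. F b t)"
    unfolding lborel_eq[where 'a = 'a] integral_distr[OF g m] t
    by (rule product_integral_prod) (auto intro: int)
qed

lemma hermite_tensor_mult:
  "hermite_tensor \<alpha> x * hermite_tensor \<beta> x = of_real (tensor (\<lambda>b t. hermite (\<alpha> b) t * hermite (\<beta> b) t) x)"
  by (simp add: hermite_tensor_def tensor_def prod.distrib)

lemma integrable_hermite_tensor_mult:
  "integrable lborel (\<lambda>x. hermite_tensor \<alpha> x * hermite_tensor \<beta> x)"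
  unfolding hermite_tensor_mult by (intro integrable_of_real integrable_tensor integrable_hermite_mult)

lemma integral_hermite_tensor_mult:
  fixes \<alpha> \<beta> :: "'a::euclidean_space \<Rightarrow> nat"
  assumes "\<alpha> \<in> Basis \<rightarrow>\<^sub>E UNIV" "\<beta> \<in> Basis \<rightarrow>\<^sub>E UNIV"
  shows "(LINT x|lborel. hermite_tensor \<alpha> x * hermite_tensor \<beta> x) = (if \<alpha> = \<beta> then 1 else 0)"
proof -
  have "(LINT x|lborel. hermite_tensor \<alpha> x * hermite_tensor \<beta> x)
      = of_real (\<Prod>b\<in>Basis. if \<alpha> b = \<beta> b then 1 else 0)"
    unfolding hermite_tensor_mult
    by (subst integral_complex_of_real, subst integral_tensor)
      (simp_all add: integrable_hermite_mult integral_hermite_mult)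
  also have "(\<Prod>b\<in>Basis. if \<alpha> b = \<beta> b then 1 else (0::real)) = (if \<alpha> = \<beta> then 1 else 0)"
  proof (cases "\<alpha> = \<beta>")
    case False
    then obtain b where "b \<in> Basis" "\<alpha> b \<noteq> \<beta> b" using assms PiE_ext by blast
    then show ?thesis using False by (auto intro!: prod_zero)
  qed simp
  finally show ?thesis by simp
qed

lemma hermite_tensor_lipschitz:
  fixes x y :: "'a::euclidean_space"
  assumes "\<And>b. b \<in> Basis \<Longrightarrow> \<alpha> b \<le> k"
  shows "norm (hermite_tensor \<alpha> x - hermite_tensor \<alpha> y) \<le> 9 ^ DIM('a) * (DIM('a) * 2 * (real k + 1)) * norm (x - y)"
proof -
  \<comment> \<open>The factors are divided by their common bound 9, since
    \<open>norm_prod_diff\<close> asks for factors of norm at most 1.\<close>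
  define z where "z x b = hermite (\<alpha> b) (x \<bullet> b) / 9" for x :: 'a and b
  have z: "hermite_tensor \<alpha> x = of_real (9 ^ DIM('a) * (\<Prod>b\<in>Basis. z x b))" for x
    by (simp add: hermite_tensor_def tensor_def z_def prod_dividef)
  have "norm (hermite_tensor \<alpha> x - hermite_tensor \<alpha> y) = 9 ^ DIM('a) * norm ((\<Prod>b\<in>Basis. z x b) - (\<Prod>b\<in>Basis. z y b))"
    unfolding z of_real_diff[symmetric] norm_of_real right_diff_distrib[symmetric] by (simp add: abs_mult)
  also have "\<dots> \<le> 9 ^ DIM('a) * (\<Sum>b\<in>Basis. norm (z x b - z y b))"
    by (intro mult_left_mono norm_prod_diff) (auto simp: z_def hermite_abs_le)
  also have "\<dots> \<le> 9 ^ DIM('a) * (\<Sum>b\<in>(Basis::'a set). 2 * (real k + 1) * norm (x - y))"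
  proof (intro mult_left_mono sum_mono)
    fix b :: 'a assume b: "b \<in> Basis"
    have "norm (z x b - z y b) = \<bar>hermite (\<alpha> b) (x \<bullet> b) - hermite (\<alpha> b) (y \<bullet> b)\<bar> / 9"
      by (simp add: z_def diff_divide_distrib[symmetric])
    also have "\<dots> \<le> (18 * (real (\<alpha> b) + 1) * \<bar>x \<bullet> b - y \<bullet> b\<bar>) / 9"
      by (intro divide_right_mono hermite_lipschitz) auto
    also have "\<dots> = 2 * (real (\<alpha> b) + 1) * \<bar>(x - y) \<bullet> b\<bar>" by (simp add: inner_diff_left)
    also have "\<dots> \<le> 2 * (real k + 1) * norm (x - y)"
      using assms[OF b] b by (intro mult_mono Basis_le_norm) auto
    finally show "norm (z x b - z y b) \<le> 2 * (real k + 1) * norm (x - y)" .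
  qed simp
  also have "\<dots> = 9 ^ DIM('a) * (DIM('a) * 2 * (real k + 1)) * norm (x - y)" by simp
  finally show ?thesis .
qed

text \<open>Each coordinate of \<open>x\<close> is absorbed by its own factor through the bound of
  \<open>x * hermite n x\<close>. This estimate replaces the net outside a large ball.\<close>

lemma norm_mult_hermite_tensor_le:
  fixes x :: "'a::euclidean_space"
  assumes "\<And>b. b \<in> Basis \<Longrightarrow> \<alpha> b \<le> k"
  shows "norm x * norm (hermite_tensor \<alpha> x) \<le> 9 ^ DIM('a) * (DIM('a) * 2 * (real k + 1))"
proof -
  have "norm x * norm (hermite_tensor \<alpha> x) \<le> (\<Sum>b\<in>Basis. \<bar>x \<bullet> b\<bar>) * norm (hermite_tensor \<alpha> x)"
    by (intro mult_right_mono norm_le_l1) auto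
  also have "\<dots> = (\<Sum>b\<in>Basis. \<bar>x \<bullet> b\<bar> * norm (hermite_tensor \<alpha> x))" by (rule sum_distrib_right)
  also have "\<dots> \<le> (\<Sum>b\<in>(Basis::'a set). 9 ^ DIM('a) * (2 * (real k + 1)))"
  proof (rule sum_mono)
    fix b :: 'a assume b: "b \<in> Basis"
    have "norm (hermite_tensor \<alpha> x) = (\<Prod>c\<in>Basis. \<bar>hermite (\<alpha> c) (x \<bullet> c)\<bar>)"
      by (rule norm_hermite_tensor)
    also have "\<dots> = \<bar>hermite (\<alpha> b) (x \<bullet> b)\<bar> * (\<Prod>c\<in>Basis - {b}. \<bar>hermite (\<alpha> c) (x \<bullet> c)\<bar>)"
      using b by (intro prod.remove) auto
    finally have "\<bar>x \<bullet> b\<bar> * norm (hermite_tensor \<alpha> x)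
        = \<bar>x \<bullet> b * hermite (\<alpha> b) (x \<bullet> b)\<bar> * (\<Prod>c\<in>Basis - {b}. \<bar>hermite (\<alpha> c) (x \<bullet> c)\<bar>)"
      by (simp add: abs_mult mult.assoc)
    also have "\<dots> \<le> (18 * (real k + 1)) * (\<Prod>c\<in>(Basis::'a set) - {b}. 9)"
      using mult_hermite_abs_le[of "x \<bullet> b" "\<alpha> b"] assms[OF b]
      by (intro mult_mono prod_mono prod_nonneg) (auto simp: hermite_abs_le)
    also have "\<dots> = 2 * (real k + 1) * (9 * 9 ^ (DIM('a) - 1))"
      using b by (simp add: card_Diff_singleton)
    also have "9 * 9 ^ (DIM('a) - 1) = (9 :: real) ^ DIM('a)"
      using DIM_positive[where 'a = 'a] by (simp flip: power_Suc)
    finally show "\<bar>x \<bullet> b\<bar> * norm (hermite_tensor \<alpha> x) \<le> 9 ^ DIM('a) * (2 * (real k + 1))"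
      by (simp add: mult.commute)
  qed
  also have "\<dots> = 9 ^ DIM('a) * (DIM('a) * 2 * (real k + 1))" by simp
  finally show ?thesis .
qed

lemma sum_norm_hermite_tensor_le:
  fixes x :: "'a::euclidean_space"
  shows "(\<Sum>\<alpha>\<in>multi_indices Basis k. (norm (hermite_tensor \<alpha> x))\<^sup>2)
    \<le> 7000 * 39 ^ DIM('a) * (real k + 1) powr gamma_exp DIM('a)"
proof -
  have "(norm (hermite_tensor \<alpha> x))\<^sup>2 = (\<Prod>b\<in>Basis. (hermite (\<alpha> b) (x \<bullet> b))\<^sup>2)" for \<alpha>
    by (simp add: norm_hermite_tensor prod_power_distrib)
  then show ?thesis
    using sum_multi_indices_hermite_le[of "Basis :: 'a set" "\<lambda>b. x \<bullet> b" k] by simp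
qed

subsection \<open>Completeness\<close>

text \<open>The dominating function is a product of Cauchy densities up to normalisation, each
  factor costing two powers of \<open>1 + norm x\<close>. The explicit bound of the integral later
  gives the continuity of a tempered distribution.\<close>

lemma integrable_rapid_decay:
  fixes f :: "'a::euclidean_space \<Rightarrow> 'b::{banach, second_countable_topology}"
  assumes [measurable]: "f \<in> borel_measurable borel"
    and C: "\<And>x. (1 + norm x) ^ (2 * DIM('a)) * norm (f x) \<le> C"
  shows "integrable lborel f"
    and "(LINT x|lborel. norm (f x)) \<le> C * (LINT x|lborel. tensor (\<lambda>_::'a. \<lambda>t. inverse (1 + t\<^sup>2)) x)"
proof -
  let ?t = "tensor (\<lambda>_::'a. \<lambda>t. inverse (1 + t\<^sup>2))"
  have t: "integrable lborel ?t"
    by (intro integrable_tensor integrable_inverse_1_plus_square_lborel)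
  have b: "norm (f x) \<le> C * ?t x" for x
  proof -
    have "(\<Prod>b\<in>Basis. 1 + (x \<bullet> b)\<^sup>2) \<le> (\<Prod>b\<in>(Basis::'a set). (1 + norm x)\<^sup>2)"
    proof (intro prod_mono conjI)
      fix b :: 'a assume "b \<in> Basis"
      then have "(x \<bullet> b)\<^sup>2 \<le> (norm x)\<^sup>2" using Basis_le_norm[of b x] by (simp add: abs_le_square_iff[symmetric])
      also have "1 + (norm x)\<^sup>2 \<le> (1 + norm x)\<^sup>2" by (simp add: power2_sum)
      finally show "1 + (x \<bullet> b)\<^sup>2 \<le> (1 + norm x)\<^sup>2" by simp
    qed simp
    also have "\<dots> = (1 + norm x) ^ (2 * DIM('a))" by (simp add: power_mult)
    finally have "(\<Prod>b\<in>Basis. 1 + (x \<bullet> b)\<^sup>2) * norm (f x) \<le> (1 + norm x) ^ (2 * DIM('a)) * norm (f x)"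
      by (intro mult_right_mono) auto
    then have "(\<Prod>b\<in>Basis. 1 + (x \<bullet> b)\<^sup>2) * norm (f x) \<le> C" using C[of x] by linarith
    moreover have "(\<Prod>b\<in>Basis. 1 + (x \<bullet> b)\<^sup>2) > 0" by (intro prod_pos) (auto simp: add_pos_nonneg)
    ultimately have "norm (f x) \<le> C / (\<Prod>b\<in>Basis. 1 + (x \<bullet> b)\<^sup>2)"
      by (simp add: field_simps)
    then show ?thesis by (simp add: tensor_def prod_inversef[symmetric] divide_inverse o_def)
  qed
  show f: "integrable lborel f"
    by (rule Bochner_Integration.integrable_bound[of _ "\<lambda>x. C * ?t x"])
      (use t b in \<open>auto intro!: AE_I2 order_trans[OF b]\<close>)
  have "(LINT x|lborel. norm (f x)) \<le> (LINT x|lborel. C * ?t x)"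
    using f t b by (intro integral_mono) auto
  then show "(LINT x|lborel. norm (f x)) \<le> C * (LINT x|lborel. ?t x)" by simp
qed

lemma integrable_L2_mult:
  assumes "L2_fun f" "L2_fun g"
  shows "integrable lborel (\<lambda>x. f x * g x)"
proof (rule Bochner_Integration.integrable_bound)
  show "integrable lborel (\<lambda>x. (norm (f x))\<^sup>2 + (norm (g x))\<^sup>2)"
    using assms by (simp add: L2_fun_def)
  show "(\<lambda>x. f x * g x) \<in> borel_measurable lborel"
    using assms by (auto simp: L2_fun_def intro: borel_measurable_times)
  show "AE x in lborel. norm (f x * g x) \<le> norm ((norm (f x))\<^sup>2 + (norm (g x))\<^sup>2)"
  proof (rule AE_I2)
    fix x
    have "0 \<le> (norm (f x) - norm (g x))\<^sup>2" by simp
    then have "2 * (norm (f x) * norm (g x)) \<le> (norm (f x))\<^sup>2 + (norm (g x))\<^sup>2"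
      by (simp add: power2_diff)
    moreover have "0 \<le> norm (f x) * norm (g x)" by (intro mult_nonneg_nonneg norm_ge_zero)
    ultimately have "norm (f x) * norm (g x) \<le> (norm (f x))\<^sup>2 + (norm (g x))\<^sup>2" by linarith
    then show "norm (f x * g x) \<le> norm ((norm (f x))\<^sup>2 + (norm (g x))\<^sup>2)"
      by (simp add: norm_mult)
  qed
qed

lemma L2_fun_rapid_decay:
  fixes f :: "'a::euclidean_space \<Rightarrow> complex"
  assumes "continuous_on UNIV f" and C: "\<And>x. (1 + norm x) ^ (2 * DIM('a)) * norm (f x) \<le> C"
  shows "L2_fun f"
proof -
  have m[measurable]: "f \<in> borel_measurable borel"
    using assms(1) by (rule borel_measurable_continuous_onI)
  have "integrable lborel (\<lambda>x. (norm (f x))\<^sup>2)"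
  proof (rule integrable_rapid_decay(1))
    fix x
    have n: "norm (f x) \<le> C"
    proof -
      have "1 * norm (f x) \<le> (1 + norm x) ^ (2 * DIM('a)) * norm (f x)"
        by (intro mult_right_mono one_le_power) auto
      then show ?thesis using C[of x] by simp
    qed
    have "(1 + norm x) ^ (2 * DIM('a)) * norm (f x) * norm (f x) \<le> C * C"
      using C[of x] n by (intro mult_mono) (auto intro: order_trans[OF norm_ge_zero])
    then show "(1 + norm x) ^ (2 * DIM('a)) * norm ((norm (f x))\<^sup>2) \<le> C * C"
      by (simp add: power2_eq_square mult.assoc)
  qed measurable
  then show ?thesis by (simp add: L2_fun_def)
qed

lemma hermite_span_continuous: "hermite_span f \<Longrightarrow> continuous_on UNIV f"
  by (auto intro!: continuous_at_imp_continuous_on differentiable_imp_continuous_within hermite_span_differentiable)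

lemma hermite_span_L2:
  fixes f :: "'a::euclidean_space \<Rightarrow> complex"
  shows "hermite_span f \<Longrightarrow> L2_fun f"
  using hermite_span_rapid_decay[of f "2 * DIM('a)"] L2_fun_rapid_decay hermite_span_continuous
  by blast

section \<open>Polynomials times Gaussians\<close>

lemma hermite_span_sum:
  assumes "finite I" "\<And>i. i \<in> I \<Longrightarrow> hermite_span (f i)"
  shows "hermite_span (\<lambda>x. \<Sum>i\<in>I. f i x)"
  using assms
proof (induction I rule: finite_induct)
  case empty
  then show ?case using hermite_span.scale[OF hermite_span.tensor, of 0] by simp
qed (auto intro: hermite_span.add)

lemma hermite_span_inner_mult:
  assumes "hermite_span g" "b \<in> Basis"
  shows "hermite_span (\<lambda>x. of_real (x \<bullet> b) * g x)"
  using assms(1)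
proof (induction rule: hermite_span.induct)
  case (tensor \<alpha>)
  show ?case unfolding inner_mult_hermite_tensor[OF assms(2)] by (intro hermite_span.intros)
next
  case (add f g)
  then show ?case by (simp add: distrib_left hermite_span.add)
next
  case (scale f c)
  from hermite_span.scale[OF this(2), of c] show ?case by (simp add: mult.left_commute)
qed

text \<open>A linear form is a combination of coordinates, and these preserve the span. The
  induction runs over all \<open>g\<close> at once, because a product of polynomials acts in two
  steps.\<close>

lemma hermite_span_polynomial_mult:
  "real_polynomial_function P \<Longrightarrow> hermite_span g \<Longrightarrow> hermite_span (\<lambda>x. of_real (P x) * g x)"
proof (induction arbitrary: g rule: real_polynomial_function.induct)
  case (linear h)
  interpret bounded_linear h by fact
  define c where "c b = h b" for b
  have "h x = (\<Sum>b\<in>Basis. (x \<bullet> b) * c b)" for x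
  proof -
    have "h x = h (\<Sum>b\<in>Basis. (x \<bullet> b) *\<^sub>R b)" by (simp add: euclidean_representation)
    also have "\<dots> = (\<Sum>b\<in>Basis. (x \<bullet> b) * c b)" by (simp add: sum scaleR c_def)
    finally show ?thesis .
  qed
  then have "(\<lambda>x. of_real (h x) * g x) = (\<lambda>x. \<Sum>b\<in>Basis. of_real (c b) * (of_real (x \<bullet> b) * g x))"
    by (simp add: sum_distrib_left mult_ac)
  moreover have "hermite_span (\<lambda>x. \<Sum>b\<in>Basis. of_real (c b) * (of_real (x \<bullet> b) * g x))"
    using \<open>hermite_span g\<close> by (intro hermite_span_sum hermite_span.scale hermite_span_inner_mult) auto
  ultimately show ?case by (simp only:)
next
  case (const c)
  then show ?case by (rule hermite_span.scale)
next
  case (add P Q)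
  then show ?case by (simp add: distrib_right hermite_span.add)
next
  case (mult P Q)
  from mult.IH(1)[OF mult.IH(2)[OF mult.prems]] show ?case by (simp add: mult.assoc)
qed

lemma hermite_span_gaussian: "hermite_span (\<lambda>x::'a::euclidean_space. of_real (exp (- (norm x)\<^sup>2 / 2)))"
proof -
  define c :: complex where "c = of_real ((pi powr (- 1 / 4)) ^ DIM('a))"
  have "hermite_tensor (\<lambda>_. 0) x = c * of_real (exp (- (norm x)\<^sup>2 / 2))" for x :: 'a
  proof -
    have "(\<Sum>b\<in>Basis. - (x \<bullet> b)\<^sup>2 / 2) = - (norm x)\<^sup>2 / 2"
      unfolding power2_norm_eq_inner euclidean_inner[of x x]
      by (simp add: power2_eq_square sum_negf sum_divide_distrib)
    then have "(\<Prod>b\<in>Basis. exp (- (x \<bullet> b)\<^sup>2 / 2)) = exp (- (norm x)\<^sup>2 / 2)"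
      by (simp flip: exp_sum)
    then show ?thesis by (simp add: hermite_tensor_def tensor_def c_def prod.distrib)
  qed
  moreover have "c \<noteq> 0" by (simp add: c_def)
  ultimately have "(\<lambda>x::'a. of_real (exp (- (norm x)\<^sup>2 / 2))) = (\<lambda>x. inverse c * hermite_tensor (\<lambda>_. 0) x)"
    by (simp add: mult.assoc[symmetric])
  then show ?thesis by (metis hermite_span.scale hermite_span.tensor)
qed

lemma real_polynomial_function_growth:
  "real_polynomial_function P \<Longrightarrow> \<exists>C n. 0 \<le> C \<and> (\<forall>x. \<bar>P x\<bar> \<le> C * (1 + norm x) ^ n)"
proof (induction rule: real_polynomial_function.induct)
  case (linear h)
  then obtain K where "0 \<le> K" "\<And>x. norm (h x) \<le> norm x * K" using bounded_linear.nonneg_bounded by blast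
  then have "\<bar>h x\<bar> \<le> K * (1 + norm x) ^ 1" for x
    by (smt (verit) mult.commute mult_left_mono power_one_right real_norm_def)
  then show ?case using \<open>0 \<le> K\<close> by blast
next
  case (const c)
  show ?case by (rule exI[of _ "\<bar>c\<bar>"], rule exI[of _ 0]) simp
next
  case (add P Q)
  then obtain C n D m where h: "0 \<le> C" "\<And>x. \<bar>P x\<bar> \<le> C * (1 + norm x) ^ n"
    "0 \<le> D" "\<And>x. \<bar>Q x\<bar> \<le> D * (1 + norm x) ^ m" by blast
  have "\<bar>P x + Q x\<bar> \<le> (C + D) * (1 + norm x) ^ (n + m)" for x
  proof -
    have "C * (1 + norm x) ^ n \<le> C * (1 + norm x) ^ (n + m)"
      using h by (intro mult_left_mono power_increasing) auto
    moreover have "D * (1 + norm x) ^ m \<le> D * (1 + norm x) ^ (n + m)"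
      using h by (intro mult_left_mono power_increasing) auto
    ultimately show ?thesis using h(2)[of x] h(4)[of x] by (simp add: distrib_right)
  qed
  then show ?case using h by (intro exI[of _ "C + D"] exI[of _ "n + m"]) auto
next
  case (mult P Q)
  then obtain C n D m where h: "0 \<le> C" "\<And>x. \<bar>P x\<bar> \<le> C * (1 + norm x) ^ n"
    "0 \<le> D" "\<And>x. \<bar>Q x\<bar> \<le> D * (1 + norm x) ^ m" by blast
  have "\<bar>P x * Q x\<bar> \<le> (C * D) * (1 + norm x) ^ (n + m)" for x
  proof -
    have "\<bar>P x\<bar> * \<bar>Q x\<bar> \<le> (C * (1 + norm x) ^ n) * (D * (1 + norm x) ^ m)"
      using h by (intro mult_mono) auto
    then show ?thesis by (simp add: abs_mult power_add mult_ac)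
  qed
  then show ?case using h by (intro exI[of _ "C * D"] exI[of _ "n + m"]) auto
qed

lemma real_polynomial_function_continuous: "real_polynomial_function P \<Longrightarrow> continuous_on S P"
  for P :: "'a::real_normed_vector \<Rightarrow> real"
  by (induction rule: real_polynomial_function.induct)
    (auto intro: continuous_intros linear_continuous_on)

text \<open>By \<open>1 + r \<le> exp r\<close> any power of \<open>1 + norm x\<close> is at most
  \<open>exp (N * norm x)\<close>, and completing the square bounds this against the
  Gaussian.\<close>

lemma polynomial_gaussian_L2:
  fixes P :: "'a::euclidean_space \<Rightarrow> real"
  assumes P: "real_polynomial_function P" and s: "s > 0"
  shows "L2_fun (\<lambda>x. of_real (P x * exp (- s * (norm x)\<^sup>2)))"
proof -
  obtain C n where C: "0 \<le> C" "\<And>x. \<bar>P x\<bar> \<le> C * (1 + norm x) ^ n"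
    using real_polynomial_function_growth[OF P] by blast
  define N where "N = 2 * DIM('a) + n"
  show ?thesis
  proof (rule L2_fun_rapid_decay)
    show "continuous_on UNIV (\<lambda>x. complex_of_real (P x * exp (- s * (norm x)\<^sup>2)))"
      using real_polynomial_function_continuous[OF P] by (intro continuous_intros)
    fix x :: 'a
    have "(1 + norm x) ^ N * exp (- s * (norm x)\<^sup>2) \<le> exp (norm x) ^ N * exp (- s * (norm x)\<^sup>2)"
      by (intro mult_right_mono power_mono exp_ge_add_one_self) auto
    also have "\<dots> = exp (real N * norm x - s * (norm x)\<^sup>2)"
      by (simp add: exp_of_nat_mult[symmetric] exp_add[symmetric])
    also have "\<dots> \<le> exp ((real N)\<^sup>2 / (4 * s))"
    proof -
      have "0 \<le> (2 * s * norm x - real N)\<^sup>2 / (4 * s)" using s by simp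
      also have "\<dots> = (real N)\<^sup>2 / (4 * s) - (real N * norm x - s * (norm x)\<^sup>2)"
        using s by (simp add: power2_diff power2_eq_square field_simps)
      finally show ?thesis by simp
    qed
    finally have *: "(1 + norm x) ^ N * exp (- s * (norm x)\<^sup>2) \<le> exp ((real N)\<^sup>2 / (4 * s))" .
    have "(1 + norm x) ^ (2 * DIM('a)) * norm (complex_of_real (P x * exp (- s * (norm x)\<^sup>2)))
        = (1 + norm x) ^ (2 * DIM('a)) * (\<bar>P x\<bar> * exp (- s * (norm x)\<^sup>2))"
      by (simp only: norm_of_real abs_mult abs_exp_cancel)
    also have "\<dots> \<le> (1 + norm x) ^ (2 * DIM('a)) * ((C * (1 + norm x) ^ n) * exp (- s * (norm x)\<^sup>2))"
      using C by (intro mult_left_mono mult_right_mono) auto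
    also have "\<dots> = C * ((1 + norm x) ^ N * exp (- s * (norm x)\<^sup>2))" by (simp add: N_def power_add)
    also have "\<dots> \<le> C * exp ((real N)\<^sup>2 / (4 * s))" using * C by (intro mult_left_mono)
    finally show "(1 + norm x) ^ (2 * DIM('a)) * norm (complex_of_real (P x * exp (- s * (norm x)\<^sup>2)))
      \<le> C * exp ((real N)\<^sup>2 / (4 * s))" .
  qed
qed

text \<open>Orthogonality to all polynomials times a Gaussian is preserved by multiplication with
  \<open>exp Q\<close>, as the exponential series converges dominatedly.\<close>

definition gauss_orth :: "('a::euclidean_space \<Rightarrow> complex) \<Rightarrow> real \<Rightarrow> bool" where
  "gauss_orth f s \<longleftrightarrow> (\<forall>P. real_polynomial_function P \<longrightarrow>
     (LINT x|lborel. f x * of_real (P x * exp (- s * (norm x)\<^sup>2))) = 0)"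

lemma gauss_orth_exp:
  fixes f :: "'a::euclidean_space \<Rightarrow> complex"
  assumes f: "L2_fun f" and s: "s > 0" and orth: "gauss_orth f s"
    and P: "real_polynomial_function P" and Q: "real_polynomial_function Q"
    and Q_le: "\<And>x. \<bar>Q x\<bar> \<le> s / 2 * (norm x)\<^sup>2 + C"
  shows "(LINT x|lborel. f x * of_real (P x * exp (Q x) * exp (- s * (norm x)\<^sup>2))) = 0"
proof -
  define S where "S N x = f x * of_real (P x * (\<Sum>m<N. Q x ^ m / fact m) * exp (- s * (norm x)\<^sup>2))" for N x
  \<comment> \<open>By \<open>Q_le\<close> one half of the Gaussian absorbs
    \<open>exp \<bar>Q x\<bar>\<close> up to \<open>exp C\<close>; the other half times
    \<open>P\<close> is square integrable and pairs with \<open>f\<close>.\<close>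
  define w where "w x = norm (f x * of_real (P x * exp (- (s / 2) * (norm x)\<^sup>2))) * exp C" for x
  have [measurable]: "f \<in> borel_measurable borel" using f by (simp add: L2_fun_def)
  have [measurable]: "P \<in> borel_measurable borel" "Q \<in> borel_measurable borel"
    using P Q by (auto intro: borel_measurable_continuous_onI real_polynomial_function_continuous)
  have "(\<lambda>N. LINT x|lborel. S N x)
      \<longlonglongrightarrow> (LINT x|lborel. f x * of_real (P x * exp (Q x) * exp (- s * (norm x)\<^sup>2)))"
  proof (rule integral_dominated_convergence[where w = w])
    show "integrable lborel w"
      unfolding w_def using polynomial_gaussian_L2[OF P, of "s / 2"] f s
      by (intro integrable_mult_left integrable_norm integrable_L2_mult) auto
    show "AE x in lborel. (\<lambda>N. S N x) \<longlonglongrightarrow> f x * of_real (P x * exp (Q x) * exp (- s * (norm x)\<^sup>2))"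
    proof (rule AE_I2)
      fix x
      have "(\<lambda>N. \<Sum>m<N. Q x ^ m / fact m) \<longlonglongrightarrow> exp (Q x)"
        using exp_converges[of "Q x"] by (simp add: sums_def divide_inverse_commute)
      then show "(\<lambda>N. S N x) \<longlonglongrightarrow> f x * of_real (P x * exp (Q x) * exp (- s * (norm x)\<^sup>2))"
        unfolding S_def by (intro tendsto_intros)
    qed
    show "AE x in lborel. norm (S N x) \<le> w x" for N
    proof (rule AE_I2)
      fix x
      have "\<bar>\<Sum>m<N. Q x ^ m / fact m\<bar> \<le> (\<Sum>m<N. \<bar>Q x\<bar> ^ m / fact m)"
        by (rule order_trans[OF sum_abs]) (simp add: power_abs)
      also have "\<dots> = (\<Sum>m<N. \<bar>Q x\<bar> ^ m /\<^sub>R fact m)" by (simp add: divide_inverse_commute)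
      also have "\<dots> \<le> exp \<bar>Q x\<bar>"
        unfolding exp_def by (rule sum_le_suminf[OF summable_exp_generic]) auto
      also have "\<dots> \<le> exp (s / 2 * (norm x)\<^sup>2 + C)" using Q_le[of x] by simp
      finally have 1: "\<bar>\<Sum>m<N. Q x ^ m / fact m\<bar> * exp (- s * (norm x)\<^sup>2)
          \<le> exp (s / 2 * (norm x)\<^sup>2 + C) * exp (- s * (norm x)\<^sup>2)"
        by (intro mult_right_mono) auto
      also have "\<dots> = exp (- (s / 2) * (norm x)\<^sup>2) * exp C"
        by (simp flip: exp_add)
      finally have "norm (f x) * \<bar>P x\<bar> * (\<bar>\<Sum>m<N. Q x ^ m / fact m\<bar> * exp (- s * (norm x)\<^sup>2))
          \<le> norm (f x) * \<bar>P x\<bar> * (exp (- (s / 2) * (norm x)\<^sup>2) * exp C)"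
        by (intro mult_left_mono) auto
      then show "norm (S N x) \<le> w x"
        unfolding S_def w_def norm_mult norm_of_real abs_mult abs_exp_cancel by (simp add: mult.assoc)
    qed
  qed (simp_all add: S_def)
  moreover have "(LINT x|lborel. S N x) = 0" for N
  proof -
    have "real_polynomial_function (\<lambda>x. P x * (\<Sum>m<N. Q x ^ m / fact m))"
      using P Q by (intro real_polynomial_function.intros(4) real_polynomial_function_sum
          real_polynomial_function_divide real_polynomial_function_power) auto
    then show ?thesis using orth unfolding gauss_orth_def S_def by blast
  qed
  ultimately show ?thesis by (simp only: LIMSEQ_const_iff)
qed

lemma real_polynomial_function_inner: "real_polynomial_function (\<lambda>x. x \<bullet> y)"
  by (rule real_polynomial_function.intros(1)) (rule bounded_linear_inner_left)

lemma real_polynomial_function_norm_sq: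
  "real_polynomial_function (\<lambda>x::'a::euclidean_space. (norm x)\<^sup>2)"
proof -
  have "(\<lambda>x::'a. (norm x)\<^sup>2) = (\<lambda>x. \<Sum>b\<in>Basis. (x \<bullet> b) * (x \<bullet> b))"
    by (rule ext) (subst power2_norm_eq_inner, rule euclidean_inner)
  moreover have "real_polynomial_function (\<lambda>x::'a. \<Sum>b\<in>Basis. (x \<bullet> b) * (x \<bullet> b))"
    by (intro real_polynomial_function_sum real_polynomial_function.intros(4) real_polynomial_function_inner finite_Basis)
  ultimately show ?thesis by (simp only:)
qed

text \<open>The choice \<open>Q x = - (s / 2) * (norm x)\<^sup>2\<close> exhausts the growth allowed
  for \<open>Q\<close>, so one step multiplies the exponent by 3/2; iteration makes it arbitrarily
  large.\<close>

lemma gauss_orth_increase: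
  assumes "L2_fun f" "s > 0" "gauss_orth f s"
  shows "gauss_orth f (3 / 2 * s)"
  unfolding gauss_orth_def
proof (intro allI impI)
  fix P :: "'a \<Rightarrow> real" assume P: "real_polynomial_function P"
  have "real_polynomial_function (\<lambda>x::'a. - (s / 2) * (norm x)\<^sup>2)"
    by (intro real_polynomial_function.intros(4) real_polynomial_function_norm_sq real_polynomial_function.intros(2))
  from gauss_orth_exp[OF assms P this, of 0] assms(2)
  have "(LINT x|lborel. f x * of_real (P x * exp (- (s / 2) * (norm x)\<^sup>2) * exp (- s * (norm x)\<^sup>2))) = 0"
    by (simp add: abs_mult)
  moreover have "P x * exp (- (s / 2) * (norm x)\<^sup>2) * exp (- s * (norm x)\<^sup>2) = P x * exp (- (3 / 2 * s) * (norm x)\<^sup>2)" for x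
    by (simp add: mult.assoc algebra_simps flip: exp_add)
  ultimately show "(LINT x|lborel. f x * of_real (P x * exp (- (3 / 2 * s) * (norm x)\<^sup>2))) = 0"
    by (simp only:)
qed

lemma hermite_span_orth:
  assumes f: "L2_fun f" and orth: "\<And>\<alpha>. (LINT x|lborel. f x * hermite_tensor \<alpha> x) = 0"
  shows "hermite_span g \<Longrightarrow> (LINT x|lborel. f x * g x) = 0"
proof (induction rule: hermite_span.induct)
  case (add g h)
  have "integrable lborel (\<lambda>x. f x * g x)" "integrable lborel (\<lambda>x. f x * h x)"
    using add integrable_L2_mult[OF f hermite_span_L2] by auto
  then show ?case using add.IH by (simp add: distrib_left)
next
  case (scale g c)
  then show ?case by (simp add: mult.left_commute)
qed (rule orth)

text \<open>The iteration starts at exponent 1/2, the Gaussian contained in the Hermite functions,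
  and reaches \<open>\<sigma> i + 1 / 2\<close>. The surplus forms a Gaussian centred at
  \<open>y\<close>: expanding \<open>(norm (x - y))\<^sup>2\<close> leaves the linear exponent
  \<open>2 * \<sigma> i * (x \<bullet> y)\<close>, an admissible \<open>Q\<close>.\<close>

lemma gaussian_convolution_eq_0:
  fixes f :: "'a::euclidean_space \<Rightarrow> complex"
  assumes f: "L2_fun f" and orth: "\<And>\<alpha>. (LINT x|lborel. f x * hermite_tensor \<alpha> x) = 0"
  defines "\<sigma> i \<equiv> 1 / 2 * (3 / 2) ^ i - 1 / 2"
  shows "(LINT x|lborel. f x * of_real (exp (- (norm x)\<^sup>2 / 2)) * of_real (exp (- \<sigma> i * (norm (x - y))\<^sup>2))) = 0"
proof -
  define s where "s i = 1 / 2 * (3 / 2 :: real) ^ i" for i :: nat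
  have s_pos: "s i > 0" for i by (simp add: s_def)
  have "gauss_orth f (s i)"
  proof (induction i)
    case 0
    show ?case unfolding gauss_orth_def
    proof (intro allI impI)
      fix P :: "'a \<Rightarrow> real" assume P: "real_polynomial_function P"
      from hermite_span_orth[OF f orth hermite_span_polynomial_mult[OF P hermite_span_gaussian]]
      show "(LINT x|lborel. f x * of_real (P x * exp (- s 0 * (norm x)\<^sup>2))) = 0"
        by (simp add: s_def)
    qed
  next
    case (Suc i)
    have "s (Suc i) = 3 / 2 * s i" by (simp add: s_def)
    with gauss_orth_increase[OF f s_pos Suc] show ?case by (simp only:)
  qed
  moreover have "real_polynomial_function (\<lambda>x. 2 * \<sigma> i * (x \<bullet> y))"
    by (intro real_polynomial_function.intros(4) real_polynomial_function_inner real_polynomial_function.intros(2))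
  moreover have "\<bar>2 * \<sigma> i * (x \<bullet> y)\<bar> \<le> s i / 2 * (norm x)\<^sup>2 + 2 * (\<sigma> i)\<^sup>2 * (norm y)\<^sup>2 / s i" for x
  proof -
    have "\<bar>2 * \<sigma> i * (x \<bullet> y)\<bar> \<le> 2 * \<bar>\<sigma> i\<bar> * (norm x * norm y)"
      using Cauchy_Schwarz_ineq2[of x y] by (simp add: abs_mult mult_left_mono)
    moreover have "0 \<le> (s i * norm x - 2 * \<bar>\<sigma> i\<bar> * norm y)\<^sup>2 / (2 * s i)"
      using s_pos[of i] by simp
    moreover have "(s i * norm x - 2 * \<bar>\<sigma> i\<bar> * norm y)\<^sup>2 / (2 * s i)
        = s i / 2 * (norm x)\<^sup>2 + 2 * (\<sigma> i)\<^sup>2 * (norm y)\<^sup>2 / s i - 2 * \<bar>\<sigma> i\<bar> * (norm x * norm y)"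
      using s_pos[of i] by (simp add: power2_diff power_mult_distrib field_simps) (simp add: power2_eq_square)
    ultimately show ?thesis by linarith
  qed
  ultimately have "(LINT x|lborel. f x * of_real (1 * exp (2 * \<sigma> i * (x \<bullet> y)) * exp (- s i * (norm x)\<^sup>2))) = 0"
    by (intro gauss_orth_exp[OF f s_pos]) auto
  then have A: "of_real (exp (- \<sigma> i * (norm y)\<^sup>2)) *
      (LINT x|lborel. f x * of_real (1 * exp (2 * \<sigma> i * (x \<bullet> y)) * exp (- s i * (norm x)\<^sup>2))) = 0"
    by simp
  have B: "f x * of_real (exp (- (norm x)\<^sup>2 / 2)) * of_real (exp (- \<sigma> i * (norm (x - y))\<^sup>2))
      = of_real (exp (- \<sigma> i * (norm y)\<^sup>2)) *
        (f x * of_real (1 * exp (2 * \<sigma> i * (x \<bullet> y)) * exp (- s i * (norm x)\<^sup>2)))" for x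
  proof -
    have sg: "s i = \<sigma> i + 1 / 2" by (simp add: s_def \<sigma>_def)
    have "exp (- (norm x)\<^sup>2 / 2) * exp (- \<sigma> i * (norm (x - y))\<^sup>2)
        = exp (- \<sigma> i * (norm y)\<^sup>2) * (exp (2 * \<sigma> i * (x \<bullet> y)) * exp (- s i * (norm x)\<^sup>2))"
      unfolding sg exp_add[symmetric] power2_norm_eq_inner
      by (simp add: inner_diff algebra_simps inner_commute[of y x])
    then show ?thesis by (simp add: mult_ac flip: of_real_mult)
  qed
  show ?thesis unfolding B using A by (simp only: integral_mult_right_zero)
qed

section \<open>From vanishing Gaussian averages to vanishing functions\<close>

lemma integrable_gaussian: "integrable lborel (\<lambda>x::'a::euclidean_space. exp (- (norm x)\<^sup>2))"
proof -
  have "integrable lborel (\<lambda>x::'a. of_real (exp (- (norm x)\<^sup>2 / 2)) * of_real (exp (- (norm x)\<^sup>2 / 2)) :: complex)"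
    by (intro integrable_L2_mult hermite_span_L2 hermite_span_gaussian)
  moreover have "of_real (exp (- (norm x)\<^sup>2 / 2)) * of_real (exp (- (norm x)\<^sup>2 / 2)) = complex_of_real (exp (- (norm x)\<^sup>2))" for x :: 'a
    by (simp flip: of_real_mult exp_add)
  ultimately show ?thesis by (simp only: complex_of_real_integrable_eq)
qed

lemma integral_gaussian_pos: "(LINT x::'a::euclidean_space|lborel. exp (- (norm x)\<^sup>2)) > 0"
proof -
  have "(LINT x::'a|lborel. exp (- (norm x)\<^sup>2)) \<noteq> 0"
  proof
    assume "(LINT x::'a|lborel. exp (- (norm x)\<^sup>2)) = 0"
    then have "AE x::'a in lborel. exp (- (norm x)\<^sup>2) = 0"
      by (subst (asm) integral_nonneg_eq_0_iff_AE[OF integrable_gaussian]) auto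
    then show False by (simp add: eventually_False ae_filter_eq_bot_iff)
  qed
  moreover have "(LINT x::'a|lborel. exp (- (norm x)\<^sup>2)) \<ge> 0" by (intro Bochner_Integration.integral_nonneg) auto
  ultimately show ?thesis by linarith
qed

lemma
  fixes g :: "'a::euclidean_space \<Rightarrow> 'b::{banach, second_countable_topology}"
  assumes [measurable]: "g \<in> borel_measurable borel" and c: "c > 0"
  shows lborel_integrable_affine: "integrable lborel (\<lambda>z. g (t + c *\<^sub>R z)) \<Longrightarrow> integrable lborel g"
    and lborel_integral_affine: "(LINT y|lborel. g y) = c ^ DIM('a) *\<^sub>R (LINT z|lborel. g (t + c *\<^sub>R z))"
proof -
  have L: "lborel = density (distr lborel borel (\<lambda>x::'a. t + c *\<^sub>R x)) (\<lambda>_. ennreal (c ^ DIM('a)))"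
    using lborel_affine[of c t] c by (simp add: power_abs[symmetric])
  have [measurable]: "(\<lambda>x::'a. t + c *\<^sub>R x) \<in> lborel \<rightarrow>\<^sub>M borel" by measurable
  show "integrable lborel g" if "integrable lborel (\<lambda>z. g (t + c *\<^sub>R z))"
    by (subst L, subst integrable_density)
      (use c that in \<open>auto simp: integrable_distr_eq intro!: integrable_scaleR_right\<close>)
  show "(LINT y|lborel. g y) = c ^ DIM('a) *\<^sub>R (LINT z|lborel. g (t + c *\<^sub>R z))"
    by (subst L, subst integral_density) (use c in \<open>auto simp: integral_distr\<close>)
qed

text \<open>Fubini against Gaussians of vanishing width.\<close>

lemma integral_bounded_continuous_eq_0:
  fixes F :: "'a::euclidean_space \<Rightarrow> complex"
  assumes F: "integrable lborel F" and \<sigma>: "filterlim \<sigma> at_top sequentially"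
    and conv: "\<And>i y. (LINT x|lborel. F x * of_real (exp (- \<sigma> i * (norm (x - y))\<^sup>2))) = 0"
    and \<chi>: "continuous_on UNIV \<chi>" "\<And>x. norm (\<chi> x) \<le> B"
  shows "(LINT x|lborel. F x * \<chi> x) = 0"
proof -
  have [measurable]: "F \<in> borel_measurable borel" using borel_measurable_integrable[OF F] by simp
  have [measurable]: "\<chi> \<in> borel_measurable borel" using \<chi>(1) by (rule borel_measurable_continuous_onI)
  define G where "G z = exp (- (norm z)\<^sup>2)" for z :: 'a
  have [measurable]: "G \<in> borel_measurable borel" unfolding G_def[abs_def] by measurable
  have G: "integrable lborel G" unfolding G_def[abs_def] by (rule integrable_gaussian)
  have G0: "0 \<le> G z" "\<bar>G z\<bar> = G z" for z by (simp_all add: G_def)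
  have B0: "B \<ge> 0" using \<chi>(2)[of 0] norm_ge_zero order_trans by blast
  have bound_int: "integrable lborel (\<lambda>z. \<chi> (x + c *\<^sub>R z) * of_real (G z))" for x c
    by (rule Bochner_Integration.integrable_bound[of _ "\<lambda>z. B * G z"])
      (use G \<chi>(2) B0 in \<open>auto intro!: AE_I2 mult_right_mono simp: norm_mult G0\<close>)
  \<comment> \<open>The average of \<open>\<chi>\<close> about \<open>x\<close> at scale
    \<open>c\<close>, up to the total mass of \<open>G\<close>.\<close>
  define A where "A c x = (LINT z|lborel. \<chi> (x + c *\<^sub>R z) * of_real (G z))" for c x
  have A_le: "norm (A c x) \<le> B * (LINT z|lborel. G z)" for c x
  proof -
    have "norm (A c x) \<le> (LINT z|lborel. norm (\<chi> (x + c *\<^sub>R z) * of_real (G z)))"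
      unfolding A_def by (rule integral_norm_bound)
    also have "\<dots> \<le> (LINT z|lborel. B * G z)"
      using G \<chi>(2) by (intro integral_mono integrable_norm bound_int) (auto simp: norm_mult G0 intro!: mult_right_mono)
    finally show ?thesis by simp
  qed
  have [measurable]: "A c \<in> borel_measurable borel" for c unfolding A_def[abs_def] by measurable
  \<comment> \<open>By Fubini this becomes an integral in \<open>y\<close> of
    \<open>\<chi> y\<close> times the vanishing expression in \<open>conv\<close>; the substitution
    fits because \<open>\<sigma> i * c\<^sup>2 = 1\<close>.\<close>
  have zero: "(LINT x|lborel. F x * A c x) = 0" if c: "c > 0" "\<sigma> i = 1 / c\<^sup>2" for c i
  proof -
    define k where "k x y = \<chi> y * of_real (exp (- \<sigma> i * (norm (x - y))\<^sup>2))" for x y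
    have [measurable]: "(\<lambda>p. k (fst p) (snd p)) \<in> borel_measurable (borel \<Otimes>\<^sub>M borel)"
      unfolding k_def by measurable
    have [measurable]: "k x \<in> borel_measurable borel" for x unfolding k_def[abs_def] by measurable
    have k_affine: "k x (x + c *\<^sub>R z) = \<chi> (x + c *\<^sub>R z) * of_real (G z)" for x z
      using c by (simp add: k_def G_def power_mult_distrib)
    have k_int: "integrable lborel (k x)" for x
      by (rule lborel_integrable_affine[OF _ c(1), of _ x]) (simp_all add: k_affine bound_int)
    have k_eq: "(LINT y|lborel. k x y) = c ^ DIM('a) *\<^sub>R A c x" for x
      unfolding A_def by (subst lborel_integral_affine[OF _ c(1), of _ x]) (simp_all add: k_affine)
    have norm_k_le: "(LINT y|lborel. norm (k x y)) \<le> c ^ DIM('a) * (B * (LINT z|lborel. G z))" for x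
    proof -
      have "(LINT y|lborel. norm (k x y)) = c ^ DIM('a) * (LINT z|lborel. norm (k x (x + c *\<^sub>R z)))"
        by (subst lborel_integral_affine[OF _ c(1), of _ x]) simp_all
      also have "(LINT z|lborel. norm (k x (x + c *\<^sub>R z))) \<le> (LINT z|lborel. B * G z)"
        unfolding k_affine
        using G \<chi>(2) by (intro integral_mono integrable_norm bound_int) (auto simp: norm_mult G0 intro!: mult_right_mono)
      finally show ?thesis using c by simp
    qed
    have "integrable (lborel \<Otimes>\<^sub>M lborel) (\<lambda>p. F (fst p) * k (fst p) (snd p))"
    proof (rule lborel_pair.Fubini_integrable)
      show "(\<lambda>p. F (fst p) * k (fst p) (snd p)) \<in> borel_measurable (lborel \<Otimes>\<^sub>M lborel)" by measurable
      show "integrable lborel (\<lambda>x. LINT y|lborel. norm (F (fst (x, y)) * k (fst (x, y)) (snd (x, y))))"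
      proof (rule Bochner_Integration.integrable_bound)
        show "integrable lborel (\<lambda>x. norm (F x) * (c ^ DIM('a) * (B * (LINT z|lborel. G z))))"
          using F by auto
        show "AE x in lborel. norm (LINT y|lborel. norm (F (fst (x, y)) * k (fst (x, y)) (snd (x, y))))
            \<le> norm (norm (F x) * (c ^ DIM('a) * (B * (LINT z|lborel. G z))))"
        proof (rule AE_I2)
          fix x
          have "norm (LINT y|lborel. norm (F (fst (x, y)) * k (fst (x, y)) (snd (x, y))))
              = norm (F x) * (LINT y|lborel. norm (k x y))"
            by (simp add: norm_mult abs_mult)
          also have "\<dots> \<le> norm (F x) * (c ^ DIM('a) * (B * (LINT z|lborel. G z)))"
            by (intro mult_left_mono norm_k_le) auto
          finally show "norm (LINT y|lborel. norm (F (fst (x, y)) * k (fst (x, y)) (snd (x, y))))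
            \<le> norm (norm (F x) * (c ^ DIM('a) * (B * (LINT z|lborel. G z))))" by simp
        qed
      qed measurable
      show "AE x in lborel. integrable lborel (\<lambda>y. F (fst (x, y)) * k (fst (x, y)) (snd (x, y)))"
        by (intro AE_I2) (simp add: k_int)
    qed
    then have "(LINT y|lborel. LINT x|lborel. F x * k x y) = (LINT x|lborel. LINT y|lborel. F x * k x y)"
      by (intro lborel_pair.Fubini_integral) (simp add: case_prod_beta')
    moreover have "(LINT x|lborel. F x * k x y) = 0" for y
    proof -
      have "(LINT x|lborel. F x * k x y) = (LINT x|lborel. \<chi> y * (F x * of_real (exp (- \<sigma> i * (norm (x - y))\<^sup>2))))"
        by (simp add: k_def mult_ac)
      then show ?thesis using conv[of i y] by simp
    qed
    ultimately have "(LINT x|lborel. c ^ DIM('a) *\<^sub>R (F x * A c x)) = 0"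
      by (simp add: k_eq)
    then show ?thesis using c by simp
  qed
  define c where "c i = 1 / sqrt (\<sigma> i)" for i
  have c_lim: "c \<longlonglongrightarrow> 0"
  proof -
    have "filterlim (\<lambda>i. sqrt (\<sigma> i)) at_top sequentially"
      using \<sigma> by (rule filterlim_compose[OF sqrt_at_top])
    then show ?thesis unfolding c_def[abs_def] divide_inverse
      using tendsto_inverse_0_at_top by simp
  qed
  have A_lim: "(\<lambda>i. A (c i) x) \<longlonglongrightarrow> (LINT z|lborel. \<chi> x * of_real (G z))" for x
    unfolding A_def
  proof (rule integral_dominated_convergence[where w = "\<lambda>z. B * G z"])
    show "integrable lborel (\<lambda>z. B * G z)" using G by simp
    show "AE z in lborel. (\<lambda>i. \<chi> (x + c i *\<^sub>R z) * of_real (G z)) \<longlonglongrightarrow> \<chi> x * of_real (G z)"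
    proof (rule AE_I2)
      fix z
      have "(\<lambda>i. x + c i *\<^sub>R z) \<longlonglongrightarrow> x + 0 *\<^sub>R z" by (intro tendsto_intros c_lim)
      then have "(\<lambda>i. \<chi> (x + c i *\<^sub>R z)) \<longlonglongrightarrow> \<chi> x"
        using \<chi>(1) by (intro continuous_on_tendsto_compose[OF \<chi>(1)]) auto
      then show "(\<lambda>i. \<chi> (x + c i *\<^sub>R z) * of_real (G z)) \<longlonglongrightarrow> \<chi> x * of_real (G z)"
        by (intro tendsto_intros)
    qed
    show "AE z in lborel. norm (\<chi> (x + c i *\<^sub>R z) * of_real (G z)) \<le> B * G z" for i
      using \<chi>(2) by (auto intro!: AE_I2 mult_right_mono simp: norm_mult G0)
  qed measurable
  have lim: "(\<lambda>i. LINT x|lborel. F x * A (c i) x) \<longlonglongrightarrow> (LINT x|lborel. F x * (LINT z|lborel. \<chi> x * of_real (G z)))"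
  proof (rule integral_dominated_convergence[where w = "\<lambda>x. norm (F x) * (B * (LINT z|lborel. G z))"])
    show "AE x in lborel. (\<lambda>i. F x * A (c i) x) \<longlonglongrightarrow> F x * (LINT z|lborel. \<chi> x * of_real (G z))"
      by (intro AE_I2 tendsto_mult_left A_lim)
    show "AE x in lborel. norm (F x * A (c i) x) \<le> norm (F x) * (B * (LINT z|lborel. G z))" for i
      by (intro AE_I2) (simp add: norm_mult A_le mult_left_mono)
  qed (use F in \<open>auto intro: integrable_mult_left integrable_norm\<close>)
  have "eventually (\<lambda>i. (LINT x|lborel. F x * A (c i) x) = 0) sequentially"
  proof -
    have "eventually (\<lambda>i. \<sigma> i > 0) sequentially" using \<sigma> by (auto simp: filterlim_at_top_dense)
    then show ?thesis
      by eventually_elim (rule zero, auto simp: c_def power_divide)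
  qed
  then have "(LINT x|lborel. F x * (LINT z|lborel. \<chi> x * of_real (G z))) = 0"
    using LIMSEQ_unique[OF lim tendsto_eventually] by blast
  moreover have "F x * (LINT z|lborel. \<chi> x * of_real (G z)) = F x * \<chi> x * of_real (LINT z|lborel. G z)" for x
    by simp
  ultimately have "(LINT x|lborel. F x * \<chi> x) * of_real (LINT z|lborel. G z) = 0"
    by (simp only: integral_mult_left_zero)
  then show ?thesis using integral_gaussian_pos[where 'a = 'a] by (simp add: G_def)
qed

text \<open>The ideal test function is the conjugate sign of \<open>F\<close>, which produces the
  integral of \<open>norm (F x)\<close>. It is measurable, hence an almost everywhere limit of
  continuous functions, and these may be truncated to the unit ball without changing the
  limit.\<close>

lemma AE_eq_0_if_orth_bounded_continuous:
  fixes F :: "'a::euclidean_space \<Rightarrow> complex"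
  assumes F: "integrable lborel F"
    and orth: "\<And>\<chi>. continuous_on UNIV \<chi> \<Longrightarrow> (\<And>x. norm (\<chi> x) \<le> 1) \<Longrightarrow> (LINT x|lborel. F x * \<chi> x) = 0"
  shows "AE x in lborel. F x = 0"
proof -
  have m[measurable]: "F \<in> borel_measurable borel" using borel_measurable_integrable[OF F] by simp
  define S where "S x = cnj (sgn (F x))" for x
  have [measurable]: "(\<lambda>x. cnj (F x)) \<in> borel_measurable borel"
    by (rule borel_measurable_continuous_on[OF _ m]) (intro continuous_intros)
  have [measurable]: "S \<in> borel_measurable borel"
    unfolding S_def[abs_def] sgn_eq complex_cnj_divide complex_cnj_complex_of_real by measurable
  have "S \<in> borel_measurable lebesgue" by (rule borel_measurable_subalgebra[OF _ _ measurable_completion]) auto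
  then have "S measurable_on UNIV" by (intro lebesgue_measurable_imp_measurable_on) auto
  then obtain N g where N: "negligible N" and g: "\<And>n. continuous_on UNIV (g n)"
    "\<And>x. x \<notin> N \<Longrightarrow> (\<lambda>n. g n x) \<longlonglongrightarrow> S x"
    unfolding measurable_on_def by auto
  define h where "h n x = g n x / of_real (max 1 (norm (g n x)))" for n x
  have h_le: "norm (h n x) \<le> 1" for n x
    by (auto simp: h_def norm_divide divide_le_eq max_def)
  have h_cont: "continuous_on UNIV (h n)" for n
    unfolding h_def[abs_def] using g(1) by (intro continuous_intros) (auto simp: max_def)
  have [measurable]: "h n \<in> borel_measurable borel" for n using h_cont by (rule borel_measurable_continuous_onI)
  have S_le: "norm (S x) \<le> 1" for x by (simp add: S_def norm_sgn)
  have h_lim: "(\<lambda>n. h n x) \<longlonglongrightarrow> S x" if "x \<notin> N" for x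
  proof -
    have "(\<lambda>n. h n x) \<longlonglongrightarrow> S x / of_real (max 1 (norm (S x)))"
      unfolding h_def using g(2)[OF that] by (intro tendsto_intros) auto
    moreover have "max 1 (norm (S x)) = 1" using S_le[of x] by simp
    ultimately show ?thesis by simp
  qed
  have "AE x in lebesgue. x \<notin> N"
    using N by (intro AE_not_in) (simp add: negligible_iff_null_sets)
  then have N_AE: "AE x in lborel. x \<notin> N" by (simp add: AE_completion_iff)
  have "(\<lambda>n. LINT x|lborel. F x * h n x) \<longlonglongrightarrow> (LINT x|lborel. F x * S x)"
  proof (rule integral_dominated_convergence[where w = "\<lambda>x. norm (F x)"])
    show "AE x in lborel. (\<lambda>n. F x * h n x) \<longlonglongrightarrow> F x * S x"
      using N_AE by eventually_elim (intro tendsto_mult_left h_lim)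
    show "AE x in lborel. norm (F x * h n x) \<le> norm (F x)" for n
      using h_le by (intro AE_I2) (simp add: norm_mult mult_left_le)
  qed (use F in auto)
  moreover have "(LINT x|lborel. F x * h n x) = 0" for n using h_cont h_le by (rule orth)
  ultimately have "(LINT x|lborel. F x * S x) = 0" by (simp add: LIMSEQ_const_iff)
  moreover have "F x * S x = of_real (norm (F x))" for x
  proof -
    have "F x * cnj (F x) = of_real (norm (F x)) * of_real (norm (F x))"
      using complex_norm_square[of "F x"] by (simp add: power2_eq_square)
    then show ?thesis by (cases "F x = 0") (simp_all add: S_def sgn_eq)
  qed
  ultimately have "(LINT x|lborel. norm (F x)) = 0" by simp
  then have "AE x in lborel. norm (F x) = 0"
    using integral_nonneg_eq_0_iff_AE[of lborel "\<lambda>x. norm (F x)"] F by simp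
  then show ?thesis by simp
qed

text \<open>\<open>f\<close> is only square integrable; times the Gaussian it becomes integrable,
  and the Gaussian, having no zeros, is divided out at the end.\<close>

lemma hermite_tensor_complete:
  fixes f :: "'a::euclidean_space \<Rightarrow> complex"
  assumes f: "L2_fun f" and orth: "\<And>\<alpha>. (LINT x|lborel. f x * hermite_tensor \<alpha> x) = 0"
  shows "AE x in lborel. f x = 0"
proof -
  define F where "F x = f x * of_real (exp (- (norm x)\<^sup>2 / 2))" for x
  have F: "integrable lborel F"
    unfolding F_def by (intro integrable_L2_mult f hermite_span_L2 hermite_span_gaussian)
  have "AE x in lborel. F x = 0"
  proof (rule AE_eq_0_if_orth_bounded_continuous[OF F])
    fix \<chi> :: "'a \<Rightarrow> complex" assume "continuous_on UNIV \<chi>" "\<And>x. norm (\<chi> x) \<le> 1"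
    then show "(LINT x|lborel. F x * \<chi> x) = 0"
    proof (rule integral_bounded_continuous_eq_0[OF F, rotated 2])
      show "filterlim (\<lambda>i. 1 / 2 * (3 / 2) ^ i - 1 / 2 :: real) at_top sequentially" by real_asymp
      show "(LINT x|lborel. F x * of_real (exp (- (1 / 2 * (3 / 2) ^ i - 1 / 2) * (norm (x - y))\<^sup>2))) = 0" for i y
        unfolding F_def using gaussian_convolution_eq_0[OF f orth, of i y] by simp
    qed
  qed
  then show ?thesis by (simp add: F_def)
qed

subsection \<open>Subgaussian series of functions\<close>

text \<open>Integrability of the exponentials is an assumption of its own because the Bochner
  integral of a nonintegrable function is 0, which would satisfy \<open>mgf_le\<close>
  vacuously.\<close>

locale subgaussian_sequence = prob_space M for M :: "'w measure" +
  fixes X :: "nat \<Rightarrow> 'w \<Rightarrow> real" and \<sigma> :: real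
  assumes indep: "indep_vars (\<lambda>_. borel) X UNIV"
    and \<sigma>_pos: "\<sigma> > 0"
    and integrable_mgf: "\<And>n r. integrable M (\<lambda>\<omega>. exp (r * X n \<omega>))"
    and mgf_le: "\<And>n r. expectation (\<lambda>\<omega>. exp (r * X n \<omega>)) \<le> exp (1 / 2 * \<sigma>\<^sup>2 * r\<^sup>2)"
begin

lemma measurable_X [measurable]: "X n \<in> borel_measurable M"
  using indep by (auto simp: indep_vars_def)

lemma sum_tail:
  assumes A: "finite A" and v: "(\<Sum>n\<in>A. (b n)\<^sup>2) \<le> v" "v > 0" and t: "t > 0"
  shows "prob {\<omega> \<in> space M. t \<le> (\<Sum>n\<in>A. b n * X n \<omega>)} \<le> exp (- t\<^sup>2 / (2 * \<sigma>\<^sup>2 * v))"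
proof -
  \<comment> \<open>Chernoff's parameter, minimising
    \<open>\<sigma>\<^sup>2 * r\<^sup>2 * v / 2 - r * t\<close>.\<close>
  define r where "r = t / (\<sigma>\<^sup>2 * v)"
  have r: "r > 0" using t v \<sigma>_pos by (simp add: r_def)
  define Y where "Y n \<omega> = exp (r * b n * X n \<omega>)" for n \<omega>
  have Y_int: "integrable M (Y n)" for n unfolding Y_def[abs_def] by (rule integrable_mgf)
  have Y_indep: "indep_vars (\<lambda>_. borel) Y A"
    unfolding Y_def[abs_def]
    by (rule indep_vars_compose2[where X = X and Y = "\<lambda>n x. exp (r * b n * x)"])
      (auto intro: indep_vars_subset[OF indep])
  have exp_eq: "exp (r * (\<Sum>n\<in>A. b n * X n \<omega>)) = (\<Prod>n\<in>A. Y n \<omega>)" for \<omega>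
    using A by (simp add: Y_def exp_sum[symmetric] sum_distrib_left mult.assoc)
  have int: "integrable M (\<lambda>\<omega>. exp (r * (\<Sum>n\<in>A. b n * X n \<omega>)))"
    unfolding exp_eq using A Y_indep Y_int by (intro indep_vars_integrable) auto
  have "expectation (\<lambda>\<omega>. exp (r * (\<Sum>n\<in>A. b n * X n \<omega>))) = (\<Prod>n\<in>A. expectation (Y n))"
    unfolding exp_eq using A Y_indep Y_int by (intro indep_vars_lebesgue_integral) auto
  also have "\<dots> \<le> (\<Prod>n\<in>A. exp (1 / 2 * \<sigma>\<^sup>2 * (r * b n)\<^sup>2))"
  proof (intro prod_mono conjI)
    fix n
    show "0 \<le> expectation (Y n)" by (intro Bochner_Integration.integral_nonneg) (simp add: Y_def)
    show "expectation (Y n) \<le> exp (1 / 2 * \<sigma>\<^sup>2 * (r * b n)\<^sup>2)" unfolding Y_def[abs_def] by (rule mgf_le)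
  qed
  also have "\<dots> = exp (1 / 2 * \<sigma>\<^sup>2 * r\<^sup>2 * (\<Sum>n\<in>A. (b n)\<^sup>2))"
    using A by (simp add: exp_sum[symmetric] sum_distrib_left power_mult_distrib mult_ac)
  also have "\<dots> \<le> exp (1 / 2 * \<sigma>\<^sup>2 * r\<^sup>2 * v)"
    using v by (simp add: mult_left_mono)
  finally have E: "expectation (\<lambda>\<omega>. exp (r * (\<Sum>n\<in>A. b n * X n \<omega>))) \<le> exp (1 / 2 * \<sigma>\<^sup>2 * r\<^sup>2 * v)" .
  have "{\<omega> \<in> space M. t \<le> (\<Sum>n\<in>A. b n * X n \<omega>)}
      = {\<omega> \<in> space M. exp (r * t) \<le> exp (r * (\<Sum>n\<in>A. b n * X n \<omega>))}"
    using r by auto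
  also have "prob \<dots> \<le> expectation (\<lambda>\<omega>. exp (r * (\<Sum>n\<in>A. b n * X n \<omega>))) / exp (r * t)"
    using int by (intro integral_Markov_inequality_measure[where A = "{}"]) auto
  also have "\<dots> \<le> exp (1 / 2 * \<sigma>\<^sup>2 * r\<^sup>2 * v) / exp (r * t)"
    using E by (intro divide_right_mono) auto
  also have "\<dots> = exp (- t\<^sup>2 / (2 * \<sigma>\<^sup>2 * v))"
    using v \<sigma>_pos by (simp add: r_def exp_diff[symmetric] field_simps power2_eq_square)
  finally show ?thesis .
qed

text \<open>If the norm exceeds \<open>t\<close>, the real or the imaginary part exceeds
  \<open>t / sqrt 2\<close> in absolute value: four one-sided events, and a factor 2 lost in the
  exponent.\<close>

lemma complex_sum_tail:
  fixes a :: "nat \<Rightarrow> complex"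
  assumes A: "finite A" and v: "(\<Sum>n\<in>A. (norm (a n))\<^sup>2) \<le> v" "v > 0" and t: "t > 0"
  shows "prob {\<omega> \<in> space M. t < norm (\<Sum>n\<in>A. a n * of_real (X n \<omega>))} \<le> 4 * exp (- t\<^sup>2 / (4 * \<sigma>\<^sup>2 * v))"
proof -
  define u where "u = t / sqrt 2"
  have u: "u > 0" "u\<^sup>2 = t\<^sup>2 / 2" using t by (simp_all add: u_def power_divide)
  define E where "E b = {\<omega> \<in> space M. u \<le> (\<Sum>n\<in>A. b n * X n \<omega>)}" for b
  have E_le: "prob (E b) \<le> exp (- t\<^sup>2 / (4 * \<sigma>\<^sup>2 * v))" if "\<And>n. (b n)\<^sup>2 \<le> (norm (a n))\<^sup>2" for b
  proof -
    have "(\<Sum>n\<in>A. (b n)\<^sup>2) \<le> v" using sum_mono[of A "\<lambda>n. (b n)\<^sup>2", OF that] v by linarith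
    from sum_tail[OF A this v(2) u(1)] show ?thesis by (simp add: E_def u mult.assoc)
  qed
  have [measurable]: "E b \<in> sets M" for b unfolding E_def by measurable
  define re im where "re n = Re (a n)" and "im n = Im (a n)" for n
  have "{\<omega> \<in> space M. t < norm (\<Sum>n\<in>A. a n * of_real (X n \<omega>))}
      \<subseteq> (E re \<union> E (\<lambda>n. - re n)) \<union> (E im \<union> E (\<lambda>n. - im n))"
  proof
    fix \<omega> assume \<omega>: "\<omega> \<in> {\<omega> \<in> space M. t < norm (\<Sum>n\<in>A. a n * of_real (X n \<omega>))}"
    define S where "S = (\<Sum>n\<in>A. a n * of_real (X n \<omega>))"
    have Re: "Re S = (\<Sum>n\<in>A. re n * X n \<omega>)" and Im: "Im S = (\<Sum>n\<in>A. im n * X n \<omega>)"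
      by (simp_all add: S_def re_def im_def)
    have "t\<^sup>2 < (norm S)\<^sup>2" using \<omega> t by (intro power_strict_mono) (auto simp: S_def)
    then have "t\<^sup>2 < (Re S)\<^sup>2 + (Im S)\<^sup>2" by (simp add: cmod_power2)
    then have "u\<^sup>2 \<le> (Re S)\<^sup>2 \<or> u\<^sup>2 \<le> (Im S)\<^sup>2" unfolding u by linarith
    then have "u \<le> \<bar>Re S\<bar> \<or> u \<le> \<bar>Im S\<bar>"
      using u(1) abs_le_square_iff[of u "Re S"] abs_le_square_iff[of u "Im S"] by auto
    then have "u \<le> Re S \<or> u \<le> - Re S \<or> u \<le> Im S \<or> u \<le> - Im S" by linarith
    then show "\<omega> \<in> (E re \<union> E (\<lambda>n. - re n)) \<union> (E im \<union> E (\<lambda>n. - im n))"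
      using \<omega> by (auto simp: E_def Re Im sum_negf)
  qed
  then have "prob {\<omega> \<in> space M. t < norm (\<Sum>n\<in>A. a n * of_real (X n \<omega>))}
      \<le> prob ((E re \<union> E (\<lambda>n. - re n)) \<union> (E im \<union> E (\<lambda>n. - im n)))"
    by (intro finite_measure_mono) auto
  also have "\<dots> \<le> (prob (E re) + prob (E (\<lambda>n. - re n))) + (prob (E im) + prob (E (\<lambda>n. - im n)))"
    by (intro order_trans[OF measure_Un_le] add_mono measure_Un_le) auto
  also have "\<dots> \<le> (exp (- t\<^sup>2 / (4 * \<sigma>\<^sup>2 * v)) + exp (- t\<^sup>2 / (4 * \<sigma>\<^sup>2 * v)))
      + (exp (- t\<^sup>2 / (4 * \<sigma>\<^sup>2 * v)) + exp (- t\<^sup>2 / (4 * \<sigma>\<^sup>2 * v)))"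
    by (intro add_mono E_le) (auto simp: re_def im_def cmod_power2)
  finally show ?thesis by simp
qed

text \<open>Borel-Cantelli for single terms. It provides the crude size of the random coefficients
  that enters the Lipschitz constants of the blocks.\<close>

lemma AE_linear_growth: "AE \<omega> in M. \<exists>K\<ge>0. \<forall>n. \<bar>X n \<omega>\<bar> \<le> K * (real n + 1)"
proof -
  define E where "E n = {\<omega> \<in> space M. real n + 1 < norm (\<Sum>m\<in>{n}. 1 * complex_of_real (X m \<omega>))}" for n
  have [measurable]: "E n \<in> sets M" for n unfolding E_def by measurable
  define c where "c = 1 / (4 * \<sigma>\<^sup>2)"
  have c: "c > 0" using \<sigma>_pos by (simp add: c_def)
  have E_le: "prob (E n) \<le> 4 * exp (- c) ^ n" for n
  proof -
    have "prob (E n) \<le> 4 * exp (- (real n + 1)\<^sup>2 / (4 * \<sigma>\<^sup>2 * 1))"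
      unfolding E_def by (rule complex_sum_tail) auto
    also have "- (real n + 1)\<^sup>2 / (4 * \<sigma>\<^sup>2 * 1) = - c * (real n + 1)\<^sup>2" by (simp add: c_def)
    also have "exp (- c * (real n + 1)\<^sup>2) \<le> exp (- c * real n)"
    proof -
      have "real n \<le> (real n + 1)\<^sup>2" by (simp add: power2_eq_square algebra_simps)
      then show ?thesis using c by simp
    qed
    also have "exp (- c * real n) = exp (- c) ^ n" by (simp add: exp_of_nat_mult[symmetric] mult.commute)
    finally show ?thesis by simp
  qed
  have "AE \<omega> in M. eventually (\<lambda>n. \<omega> \<in> space M - E n) sequentially"
  proof (rule borel_cantelli_AE1)
    show "summable (\<lambda>n. prob (E n))"
      by (rule summable_comparison_test'[of "\<lambda>n. 4 * exp (- c) ^ n" 0])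
        (use E_le c in \<open>auto intro!: summable_mult summable_geometric\<close>)
  qed (auto simp: emeasure_eq_measure)
  then show ?thesis
  proof eventually_elim
    case (elim \<omega>)
    then obtain N where N: "\<And>n. n \<ge> N \<Longrightarrow> \<omega> \<in> space M - E n" by (auto simp: eventually_sequentially)
    \<comment> \<open>The sum absorbs the finitely many exceptional indices.\<close>
    define K where "K = 1 + (\<Sum>n<N. \<bar>X n \<omega>\<bar>)"
    have K1: "K \<ge> 1" by (simp add: K_def sum_nonneg)
    have "\<bar>X n \<omega>\<bar> \<le> K * (real n + 1)" for n
    proof (cases "n < N")
      case True
      then have "\<bar>X n \<omega>\<bar> \<le> (\<Sum>n<N. \<bar>X n \<omega>\<bar>)" by (intro member_le_sum) auto
      then have "\<bar>X n \<omega>\<bar> \<le> K * 1" by (simp add: K_def)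
      also have "\<dots> \<le> K * (real n + 1)" using K1 by (intro mult_left_mono) auto
      finally show ?thesis .
    next
      case False
      then have "\<bar>X n \<omega>\<bar> \<le> 1 * (real n + 1)" using N[of n] by (auto simp: E_def)
      also have "\<dots> \<le> K * (real n + 1)" using K1 by (intro mult_right_mono) auto
      finally show ?thesis .
    qed
    then show ?case using K1 by (intro exI[of _ K]) auto
  qed
qed

end

section \<open>Nets, block lengths and counting of indices\<close>

lemma exists_lattice_net:
  fixes Z :: nat and \<delta> :: real
  assumes \<delta>: "\<delta> > 0"
  shows "\<exists>G :: 'a::euclidean_space set. finite G \<and> card G \<le> (2 * Z + 1) ^ DIM('a) \<and>
    (\<forall>x. norm x \<le> real Z * \<delta> \<longrightarrow> (\<exists>y\<in>G. norm (x - y) \<le> DIM('a) * \<delta>))"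
proof -
  define D where "D = (Basis :: 'a set) \<rightarrow>\<^sub>E {- int Z..int Z}"
  define pt where "pt z = (\<Sum>b\<in>Basis. (real_of_int (z b) * \<delta>) *\<^sub>R b)" for z :: "'a \<Rightarrow> int"
  have D: "finite D" "card D = (2 * Z + 1) ^ DIM('a)"
    unfolding D_def by (simp_all add: finite_PiE card_PiE nat_mult_distrib nat_add_distrib)
  have "\<exists>y\<in>pt ` D. norm (x - y) \<le> DIM('a) * \<delta>" if x: "norm x \<le> real Z * \<delta>" for x
  proof -
    \<comment> \<open>Each coordinate is rounded down to the lattice of mesh
      \<open>\<delta>\<close>.\<close>
    define z where "z = (\<lambda>b\<in>Basis. \<lfloor>(x \<bullet> b) / \<delta>\<rfloor>)"
    have "z \<in> D"
      unfolding D_def z_def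
    proof (rule restrict_PiE_iff[THEN iffD2], rule ballI)
      fix b :: 'a assume "b \<in> Basis"
      then have "\<bar>x \<bullet> b\<bar> \<le> real Z * \<delta>" using Basis_le_norm[of b x] x by linarith
      then have "- real Z \<le> (x \<bullet> b) / \<delta>" "(x \<bullet> b) / \<delta> \<le> real Z"
        using \<delta> by (auto simp: field_simps abs_le_iff)
      then show "\<lfloor>(x \<bullet> b) / \<delta>\<rfloor> \<in> {- int Z..int Z}" by (simp add: le_floor_iff floor_le_iff) 
    qed
    moreover have "norm (x - pt z) \<le> DIM('a) * \<delta>"
    proof -
      have "norm (x - pt z) \<le> (\<Sum>b\<in>Basis. \<bar>(x - pt z) \<bullet> b\<bar>)" by (rule norm_le_l1)
      also have "\<dots> \<le> (\<Sum>b\<in>(Basis::'a set). \<delta>)"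
      proof (rule sum_mono)
        fix b :: 'a assume b: "b \<in> Basis"
        have "(x - pt z) \<bullet> b = ((x \<bullet> b) / \<delta> - of_int \<lfloor>(x \<bullet> b) / \<delta>\<rfloor>) * \<delta>"
          using b \<delta> by (simp add: pt_def inner_diff_left z_def field_simps)
        moreover have "\<bar>(x \<bullet> b) / \<delta> - of_int \<lfloor>(x \<bullet> b) / \<delta>\<rfloor>\<bar> \<le> 1" by linarith
        ultimately show "\<bar>(x - pt z) \<bullet> b\<bar> \<le> \<delta>"
          using \<delta> by (simp add: abs_mult mult_left_le_one_le)
      qed
      finally show ?thesis by simp
    qed
    ultimately show ?thesis by blast
  qed
  then show ?thesis using D card_image_le[of D pt] by (intro exI[of _ "pt ` D"]) auto
qed

text \<open>\<open>tower (m + 1)\<close> is the square of \<open>tower m\<close>, so the logarithm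
  of the level doubles from block to block.\<close>

definition tower :: "nat \<Rightarrow> nat" where
  "tower m = 2 ^ 2 ^ m"

lemma tower_ge: "m < tower m" "2 \<le> tower m"
proof -
  have "m < 2 ^ m" by (rule less_exp)
  also have "(2::nat) ^ m < 2 ^ 2 ^ m" by (rule less_exp)
  finally show "m < tower m" by (simp add: tower_def)
  have "(2::nat) ^ 1 \<le> 2 ^ 2 ^ m" by (intro power_increasing) auto
  then show "2 \<le> tower m" by (simp add: tower_def)
qed

lemma ln_tower: "ln (real (tower m)) = 2 ^ m * ln 2"
  by (simp add: tower_def ln_realpow)

lemma tower_mono: "m \<le> n \<Longrightarrow> tower m \<le> tower n"
  unfolding tower_def by (intro power_increasing) auto

text \<open>All indices up to \<open>n\<close> have level below \<open>N\<close>, and there are at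
  most \<open>N * N ^ p\<close> of those. A block thus has polynomially many cut-offs, which a union
  bound can afford.\<close>

lemma index_bound:
  fixes J :: "nat \<Rightarrow> nat"
  assumes J: "mono J" and fib: "\<And>j. finite {n. J n = j}" "\<And>j. card {n. J n = j} \<le> (j + 1) ^ p"
    and n: "J n < N"
  shows "n < N ^ (p + 1)"
proof -
  have "{..n} \<subseteq> (\<Union>j<N. {n. J n = j})" using monoD[OF J] n by (auto intro: le_less_trans)
  then have "card {..n} \<le> card (\<Union>j<N. {n. J n = j})" using fib by (intro card_mono) auto
  also have "\<dots> \<le> (\<Sum>j<N. card {n. J n = j})" by (rule card_UN_le) simp
  also have "\<dots> \<le> (\<Sum>j<N. N ^ p)"
    by (intro sum_mono order_trans[OF fib(2)] power_mono) auto
  finally show ?thesis by simp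
qed

text \<open>On levels \<open>j \<ge> N\<close> the weight \<open>ln j powr \<alpha>\<close> is at
  least \<open>ln N powr \<alpha>\<close>, which is traded for the decay of the tail.\<close>

lemma weighted_block_sum_le:
  fixes w :: "nat \<Rightarrow> real"
  assumes w: "\<And>j. w j \<ge> 0" and \<alpha>: "\<alpha> > 0"
    and summ: "summable (\<lambda>j. real j powr \<gamma> * ln (real j) powr \<alpha> * w j)"
    and T: "finite T" "\<And>j. j \<in> T \<Longrightarrow> N \<le> j" and N: "N \<ge> 2"
  shows "(\<Sum>j\<in>T. real j powr \<gamma> * w j)
    \<le> (\<Sum>j. real j powr \<gamma> * ln (real j) powr \<alpha> * w j) * ln (real N) powr - \<alpha>"
proof -
  define l where "l = ln (real N)"
  have l: "l > 0" using N by (simp add: l_def)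
  have "(\<Sum>j\<in>T. real j powr \<gamma> * w j) \<le> (\<Sum>j\<in>T. real j powr \<gamma> * ln (real j) powr \<alpha> * w j * l powr - \<alpha>)"
  proof (rule sum_mono)
    fix j assume "j \<in> T"
    then have j: "real N \<le> real j" using T by simp
    then have "l \<le> ln (real j)" using N by (simp add: l_def)
    then have "l powr \<alpha> \<le> ln (real j) powr \<alpha>" using l \<alpha> by (intro powr_mono2) auto
    then have "l powr \<alpha> * l powr - \<alpha> \<le> ln (real j) powr \<alpha> * l powr - \<alpha>" by (intro mult_right_mono) auto
    then have "1 \<le> ln (real j) powr \<alpha> * l powr - \<alpha>" using l by (simp flip: powr_add)
    then have "(real j powr \<gamma> * w j) * 1 \<le> (real j powr \<gamma> * w j) * (ln (real j) powr \<alpha> * l powr - \<alpha>)"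
      using w by (intro mult_left_mono) auto
    then show "real j powr \<gamma> * w j \<le> real j powr \<gamma> * ln (real j) powr \<alpha> * w j * l powr - \<alpha>"
      by (simp add: mult_ac)
  qed
  also have "\<dots> = (\<Sum>j\<in>T. real j powr \<gamma> * ln (real j) powr \<alpha> * w j) * l powr - \<alpha>"
    by (rule sum_distrib_right[symmetric])
  also have "\<dots> \<le> (\<Sum>j. real j powr \<gamma> * ln (real j) powr \<alpha> * w j) * l powr - \<alpha>"
    using w summ T by (intro mult_right_mono sum_le_suminf) auto
  finally show ?thesis by (simp add: l_def)
qed

context subgaussian_sequence
begin

text \<open>The indices are split into blocks on which the logarithm of the level \<open>J n\<close> doubles.  On
  each block the supremum over the whole space and over all partial sums is controlled by a
  union bound over polynomially many points and indices; the resulting bounds are summable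
  because \<open>\<alpha> > 1\<close>.\<close>

lemma AE_uniformly_convergent:
  fixes J :: "nat \<Rightarrow> nat" and \<psi> :: "nat \<Rightarrow> 'a::euclidean_space \<Rightarrow> complex" and c :: "nat \<Rightarrow> complex"
    and w :: "nat \<Rightarrow> real" and p :: nat and C \<alpha> \<gamma> :: real
  assumes J: "mono J" and fib: "\<And>j. finite {n. J n = j}" "\<And>j. card {n. J n = j} \<le> (j + 1) ^ p"
    and C: "C \<ge> 0"
    and lip: "\<And>n x y. norm (\<psi> n x - \<psi> n y) \<le> C * (real (J n) + 1) ^ p * norm (x - y)"
    and dec: "\<And>n x. norm x * norm (\<psi> n x) \<le> C * (real (J n) + 1) ^ p"
    and spec: "\<And>j x. j \<ge> 1 \<Longrightarrow> (\<Sum>n | J n = j. (norm (\<psi> n x))\<^sup>2) \<le> C * real j powr \<gamma>"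
    and w: "\<And>j. w j \<ge> 0" "\<And>n. (norm (c n))\<^sup>2 \<le> w (J n)"
    and \<alpha>: "\<alpha> > 1" and \<gamma>: "\<gamma> \<ge> - 1"
    and summ: "summable (\<lambda>j. real j powr \<gamma> * ln (real j) powr \<alpha> * w j)"
  shows "AE \<omega> in M. uniformly_convergent_on UNIV (\<lambda>r x. \<Sum>n<r. c n * of_real (X n \<omega>) * \<psi> n x)"
proof -
  define B where "B = (\<Sum>j. real j powr \<gamma> * ln (real j) powr \<alpha> * w j)"
  have B0: "B \<ge> 0" unfolding B_def using w summ by (intro suminf_nonneg) auto
  \<comment> \<open>Block 0 collects the levels below \<open>tower 1 = 4\<close>; block
    \<open>m \<ge> 1\<close> has the levels from \<open>tower m\<close> to below
    \<open>tower (m + 1)\<close>.\<close>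
  define \<beta> where "\<beta> n = (LEAST m. J n < tower (m + 1))" for n
  have \<beta>_ub: "J n < tower (\<beta> n + 1)" for n
    unfolding \<beta>_def
  proof (rule LeastI[of _ "J n"])
    show "J n < tower (J n + 1)" using tower_ge(1)[of "J n + 1"] by simp
  qed
  have \<beta>_lb: "tower (\<beta> n) \<le> J n" if "\<beta> n \<ge> 1" for n
  proof -
    have "\<not> J n < tower (\<beta> n - 1 + 1)"
      unfolding \<beta>_def by (rule not_less_Least) (use that in \<open>simp add: \<beta>_def\<close>)
    then show ?thesis using that by simp
  qed
  define R where "R m = tower (m + 1) ^ (p + 1)" for m
  have lt_R: "n < R m" if "\<beta> n = m" for n m
    unfolding R_def using index_bound[OF J fib, of n "tower (m + 1)"] \<beta>_ub[of n] that by simp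
  define bl where "bl m r = {n. n < r \<and> \<beta> n = m}" for m r
  have fin_bl: "finite (bl m r)" for m r by (simp add: bl_def)
  define T where "T m r x \<omega> = (\<Sum>n\<in>bl m r. c n * of_real (X n \<omega>) * \<psi> n x)" for m r x \<omega>
  \<comment> \<open>All indices of block \<open>m\<close> lie below \<open>R m\<close>, so every
    partial sum of the block is one with cut-off at most \<open>R m\<close>.\<close>
  have T_min: "T m r x \<omega> = T m (min r (R m)) x \<omega>" for m r x \<omega>
    unfolding T_def bl_def by (rule sum.cong) (use lt_R in auto)
  \<comment> \<open>The summand 1 keeps the variance bound positive, as the tail estimate
    requires.\<close>
  define V0 where "V0 = (C * B + 1) * ln 2 powr - \<alpha>"
  define V where "V m = V0 * (2 ^ m) powr - \<alpha>" for m :: nat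
  have V0: "V0 > 0" using C B0 by (simp add: V0_def add_nonneg_pos)
  have V_pos: "V m > 0" for m using V0 by (simp add: V_def)
  have var: "(\<Sum>n\<in>bl m r. (norm (c n * \<psi> n x))\<^sup>2) \<le> V m" if m: "m \<ge> 1" for m r x
  proof -
    define K where "K = {tower m..<tower (m + 1)}"
    have JK: "J ` bl m r \<subseteq> K"
      using \<beta>_ub \<beta>_lb m by (auto simp: K_def bl_def)
    have K1: "j \<ge> 1" if "j \<in> K" for j using that tower_ge(2)[of m] by (simp add: K_def)
    have "(\<Sum>n\<in>bl m r. (norm (c n * \<psi> n x))\<^sup>2) \<le> (\<Sum>n\<in>bl m r. w (J n) * (norm (\<psi> n x))\<^sup>2)"
      by (intro sum_mono) (auto simp: norm_mult power_mult_distrib intro!: mult_right_mono w)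
    also have "\<dots> = (\<Sum>j\<in>K. \<Sum>n\<in>{n. n \<in> bl m r \<and> J n = j}. w (J n) * (norm (\<psi> n x))\<^sup>2)"
      using JK fin_bl by (intro sum.group[symmetric]) (auto simp: K_def)
    also have "\<dots> = (\<Sum>j\<in>K. w j * (\<Sum>n\<in>{n. n \<in> bl m r \<and> J n = j}. (norm (\<psi> n x))\<^sup>2))"
      unfolding sum_distrib_left by (intro sum.cong) auto
    also have "\<dots> \<le> (\<Sum>j\<in>K. w j * (C * real j powr \<gamma>))"
    proof (intro sum_mono mult_left_mono)
      fix j assume j: "j \<in> K"
      have "(\<Sum>n\<in>{n. n \<in> bl m r \<and> J n = j}. (norm (\<psi> n x))\<^sup>2) \<le> (\<Sum>n | J n = j. (norm (\<psi> n x))\<^sup>2)"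
        using fib by (intro sum_mono2) auto
      also have "\<dots> \<le> C * real j powr \<gamma>" using K1[OF j] by (rule spec)
      finally show "(\<Sum>n\<in>{n. n \<in> bl m r \<and> J n = j}. (norm (\<psi> n x))\<^sup>2) \<le> C * real j powr \<gamma>" .
    qed (rule w)
    also have "\<dots> = C * (\<Sum>j\<in>K. real j powr \<gamma> * w j)"
      unfolding sum_distrib_left by (intro sum.cong) (auto simp: mult_ac)
    also have "\<dots> \<le> C * (B * ln (real (tower m)) powr - \<alpha>)"
      unfolding B_def using w summ \<alpha> C tower_ge(2)[of m]
      by (intro mult_left_mono weighted_block_sum_le) (auto simp: K_def)
    also have "\<dots> = (C * B) * (ln 2 powr - \<alpha> * (2 ^ m) powr - \<alpha>)"
      unfolding ln_tower by (simp add: powr_mult mult_ac)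
    also have "\<dots> \<le> (C * B + 1) * (ln 2 powr - \<alpha> * (2 ^ m) powr - \<alpha>)"
      by (intro mult_right_mono) auto
    finally show ?thesis by (simp add: V_def V0_def mult.assoc)
  qed
  \<comment> \<open>\<open>P0\<close> is the power of \<open>tower (m + 1)\<close> in the Lipschitz
    and decay constants of a block sum: \<open>p + 1\<close> for the number of terms and
    \<open>2 * p + 2\<close> for each term. \<open>Q\<close> counts the events of the union bound:
    \<open>p + 2\<close> for the cut-offs and \<open>2 * P0 + 4\<close> per dimension for the
    net.\<close>
  define P0 where "P0 = 3 * p + 3"
  define Q where "Q = p + 2 + (2 * P0 + 4) * DIM('a)"
  \<comment> \<open>Chosen so that \<open>(q ^ m)\<^sup>2 = 2 ^ m * (2 ^ m) powr - \<alpha>\<close>: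
    the squared threshold exceeds the variance by the order \<open>2 ^ m\<close> of the logarithm,
    and \<open>q < 1\<close> because \<open>\<alpha> > 1\<close>.\<close>
  define q where "q = 2 powr (- (\<alpha> - 1) / 2)"
  have q: "0 < q" "q < 1" using \<alpha> by (simp_all add: q_def powr_less_one)
  \<comment> \<open>Makes the tail exponent equal to \<open>- (2 * Q + 1) * 2 ^ m\<close>: the part
    \<open>2 * Q * 2 ^ m\<close> pays for \<open>tower (m + 1) ^ Q\<close> events, and
    \<open>exp (- (2 ^ m))\<close> remains.\<close>
  define D where "D = sqrt (4 * \<sigma>\<^sup>2 * V0 * (2 * real Q + 1))"
  have D: "D > 0" "D\<^sup>2 = 4 * \<sigma>\<^sup>2 * V0 * (2 * real Q + 1)"
    using V0 \<sigma>_pos by (simp_all add: D_def)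
  define t where "t m = D * q ^ m" for m :: nat
  have t_pos: "t m > 0" for m using D q by (simp add: t_def)
  have tail: "prob {\<omega> \<in> space M. t m < norm (T m r x \<omega>)} \<le> 4 * exp (- (2 * real Q + 1) * 2 ^ m)"
    if m: "m \<ge> 1" for m r x
  proof -
    have "T m r x \<omega> = (\<Sum>n\<in>bl m r. (c n * \<psi> n x) * of_real (X n \<omega>))" for \<omega>
      by (simp add: T_def mult_ac)
    then have "prob {\<omega> \<in> space M. t m < norm (T m r x \<omega>)} \<le> 4 * exp (- (t m)\<^sup>2 / (4 * \<sigma>\<^sup>2 * V m))"
      using complex_sum_tail[OF fin_bl var[OF m] V_pos t_pos] by simp
    also have "- (t m)\<^sup>2 / (4 * \<sigma>\<^sup>2 * V m) = - (2 * real Q + 1) * 2 ^ m"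
    proof -
      have "(q ^ m)\<^sup>2 = 2 ^ m * (2 ^ m) powr - \<alpha>"
      proof -
        have "(q ^ m)\<^sup>2 = 2 powr (- (\<alpha> - 1) / 2 * real (m * 2))"
          by (simp add: q_def powr_power power_mult[symmetric] mult.commute)
        also have "- (\<alpha> - 1) / 2 * real (m * 2) = real m + real m * - \<alpha>" by (simp add: field_simps)
        also have "2 powr \<dots> = 2 ^ m * (2 ^ m) powr - \<alpha>"
        proof -
          have "(2 ^ m) powr - \<alpha> = (2 powr real m) powr - \<alpha>" by (simp add: powr_realpow)
          then have "(2 ^ m) powr - \<alpha> = 2 powr (real m * - \<alpha>)" by (simp only: powr_powr)
          moreover have "(2::real) ^ m = 2 powr real m" by (simp add: powr_realpow)
          ultimately show ?thesis by (simp only: powr_add)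
        qed
        finally show ?thesis .
      qed
      then have "(t m)\<^sup>2 = (2 * real Q + 1) * 2 ^ m * (4 * \<sigma>\<^sup>2 * V m)"
        by (simp add: t_def power_mult_distrib D V_def mult_ac)
      moreover have "4 * \<sigma>\<^sup>2 * V m \<noteq> 0" using \<sigma>_pos V_pos[of m] by simp
      ultimately have "(t m)\<^sup>2 / (4 * \<sigma>\<^sup>2 * V m) = (2 * real Q + 1) * 2 ^ m" by simp
      then show ?thesis by (simp only: minus_divide_left[symmetric] mult_minus_left)
    qed
    finally show ?thesis .
  qed
  \<comment> \<open>With this mesh a Lipschitz constant of order \<open>tower (m + 1) ^ P0\<close>
    costs only \<open>O(1 / tower (m + 1))\<close>; \<open>Z\<close> makes the covered ball so large
    that the decay estimate gives the same order outside it.\<close>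
  define \<delta> where "\<delta> m = 1 / real (tower (m + 1)) ^ (P0 + 1)" for m
  define Z where "Z m = tower (m + 1) ^ (2 * (P0 + 1))" for m
  have tower_pos: "real (tower m) > 0" for m using tower_ge(2)[of m] by simp
  have \<delta>_pos: "\<delta> m > 0" for m using tower_pos by (simp add: \<delta>_def)
  have Z\<delta>: "real (Z m) * \<delta> m = real (tower (m + 1)) ^ (P0 + 1)" for m
    using tower_pos[of "m + 1"] by (simp add: Z_def \<delta>_def power_mult power2_eq_square mult_2 power_add)
  have "\<forall>m. \<exists>G :: 'a set. finite G \<and> card G \<le> (2 * Z m + 1) ^ DIM('a) \<and>
    (\<forall>x. norm x \<le> real (Z m) * \<delta> m \<longrightarrow> (\<exists>y\<in>G. norm (x - y) \<le> DIM('a) * \<delta> m))"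
    using exists_lattice_net[OF \<delta>_pos] by blast
  then obtain G :: "nat \<Rightarrow> 'a set" where G: "\<And>m. finite (G m)" "\<And>m. card (G m) \<le> (2 * Z m + 1) ^ DIM('a)"
    "\<And>m x. norm x \<le> real (Z m) * \<delta> m \<Longrightarrow> \<exists>y\<in>G m. norm (x - y) \<le> DIM('a) * \<delta> m"
    by metis
  have card_le: "(R m + 1) * card (G m) \<le> tower (m + 1) ^ Q" for m
  proof -
    define N where "N = tower (m + 1)"
    have N: "N \<ge> 2" using tower_ge by (simp add: N_def)
    have pos: "1 \<le> N ^ k" for k using N by simp
    have "R m + 1 \<le> N ^ (p + 1) * 2" using pos[of "p + 1"] by (simp add: R_def N_def)
    also have "\<dots> \<le> N ^ (p + 1) * N" using N by (intro mult_left_mono) auto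
    finally have 1: "R m + 1 \<le> N ^ (p + 2)" by (simp add: mult_ac)
    have "2 * Z m + 1 \<le> 4 * N ^ (2 * (P0 + 1))" using pos[of "2 * (P0 + 1)"] by (simp add: Z_def N_def)
    also have "\<dots> \<le> N\<^sup>2 * N ^ (2 * (P0 + 1))"
      using power_mono[of 2 N 2] N by (intro mult_right_mono) auto
    also have "\<dots> = N ^ (2 * P0 + 4)"
    proof -
      have "2 + 2 * (P0 + 1) = 2 * P0 + 4" by simp
      then show ?thesis by (simp only: power_add[symmetric])
    qed
    finally have "(2 * Z m + 1) ^ DIM('a) \<le> (N ^ (2 * P0 + 4)) ^ DIM('a)" by (intro power_mono) auto
    then have 2: "card (G m) \<le> N ^ ((2 * P0 + 4) * DIM('a))"
      using G(2)[of m] unfolding power_mult by linarith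
    have "(R m + 1) * card (G m) \<le> N ^ (p + 2) * N ^ ((2 * P0 + 4) * DIM('a))"
      using 1 2 by (rule mult_le_mono)
    then show ?thesis unfolding N_def Q_def power_add .
  qed
  define E where "E m = (\<Union>(r, y)\<in>{..R m} \<times> G m. {\<omega> \<in> space M. t m < norm (T m r y \<omega>)})" for m
  have E1[measurable]: "{\<omega> \<in> space M. t m < norm (T m r y \<omega>)} \<in> sets M" for m r y
    unfolding T_def by measurable
  have E_sets[measurable]: "E m \<in> sets M" for m
    unfolding E_def using G(1) E1 by (intro sets.finite_UN) auto
  have E_le: "prob (E m) \<le> 4 * exp (- 1) ^ m" if m: "m \<ge> 1" for m
  proof -
    have "prob (E m) \<le> (\<Sum>(r, y)\<in>{..R m} \<times> G m. prob {\<omega> \<in> space M. t m < norm (T m r y \<omega>)})"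
      unfolding E_def case_prod_beta using G(1) E1 by (intro measure_UNION_le) auto
    also have "\<dots> \<le> (\<Sum>(r, y)\<in>{..R m} \<times> G m. 4 * exp (- (2 * real Q + 1) * 2 ^ m))"
      using tail[OF m] by (intro sum_mono) auto
    also have "\<dots> = real ((R m + 1) * card (G m)) * (4 * exp (- (2 * real Q + 1) * 2 ^ m))"
      by (simp add: case_prod_beta card_cartesian_product)
    also have "\<dots> \<le> real (tower (m + 1) ^ Q) * (4 * exp (- (2 * real Q + 1) * 2 ^ m))"
      by (intro mult_right_mono of_nat_mono card_le) auto
    also have "real (tower (m + 1) ^ Q) = exp (real Q * (2 ^ (m + 1) * ln 2))"
      unfolding ln_tower[symmetric] using tower_pos by (simp add: exp_of_nat_mult)
    also have "\<dots> \<le> exp (2 * real Q * 2 ^ m)"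
      using ln_2_less_1 by (simp add: mult_left_mono mult_left_le)
    also have "exp (2 * real Q * 2 ^ m) * (4 * exp (- (2 * real Q + 1) * 2 ^ m)) = 4 * exp (- (2 ^ m))"
      by (simp add: algebra_simps flip: exp_add)
    also have "\<dots> \<le> 4 * exp (- real m)"
      proof -
      have "real m \<le> real (2 ^ m)" using less_exp[of m] by (simp del: of_nat_power)
      then show ?thesis by simp
    qed
    also have "exp (- real m) = exp (- 1) ^ m" by (simp add: exp_of_nat_mult[symmetric])
    finally show ?thesis by simp
  qed
  have BC: "AE \<omega> in M. eventually (\<lambda>m. \<omega> \<in> space M - E m) sequentially"
  proof (rule borel_cantelli_AE1)
    show "summable (\<lambda>m. prob (E m))"
      by (rule summable_comparison_test'[of "\<lambda>m. 4 * exp (- 1) ^ m" 1])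
        (use E_le in \<open>auto intro!: summable_mult summable_geometric\<close>)
  qed (auto simp: emeasure_eq_measure)
  show ?thesis
    using BC AE_linear_growth
  proof eventually_elim
    case (elim \<omega>)
    obtain m0 where m0: "\<And>m. m \<ge> m0 \<Longrightarrow> \<omega> \<in> space M - E m"
      using elim(1) by (auto simp: eventually_sequentially)
    obtain K where K: "K \<ge> 0" "\<And>n. \<bar>X n \<omega>\<bar> \<le> K * (real n + 1)" using elim(2) by blast
    define L where "L = (B + 1) * K * C"
    have L0: "L \<ge> 0" using B0 K C by (simp add: L_def)
    define N where "N m = real (tower (m + 1))" for m
    have N1: "N m \<ge> 1" for m using tower_ge(2)[of "m + 1"] by (simp add: N_def)
    \<comment> \<open>A single term of the convergent series, with \<open>\<gamma> \<ge> - 1\<close>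
      and \<open>ln j \<ge> 1\<close>, gives \<open>w j \<le> B * j\<close>. Blocks with
      \<open>m \<ge> 1\<close> start no lower than \<open>tower 1 = 4 > exp 1\<close>.\<close>
    have c_le: "norm (c n) \<le> (B + 1) * N m" if n: "\<beta> n = m" "m \<ge> 1" for n m
    proof (rule power2_le_imp_le)
      define j where "j = J n"
      have "tower 1 \<le> j" using \<beta>_lb[of n] tower_mono[of 1 m] n by (simp add: j_def)
      then have j4: "j \<ge> 4" by (simp add: tower_def)
      have jN: "real j \<le> N m" using \<beta>_ub[of n] n by (simp add: j_def N_def)
      have "exp 1 \<le> real j" using exp_le j4 by linarith
      then have "1 \<le> ln (real j)" using j4 by (simp add: ln_ge_iff)
      then have ln1: "1 \<le> ln (real j) powr \<alpha>" using \<alpha> by (intro ge_one_powr_ge_zero) auto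
      have "real j powr - 1 \<le> real j powr \<gamma>" using \<gamma> j4 by (intro powr_mono) auto
      then have "real j powr - 1 * 1 * w j \<le> real j powr \<gamma> * ln (real j) powr \<alpha> * w j"
        using ln1 w(1) by (intro mult_right_mono mult_mono) auto
      also have "\<dots> = (\<Sum>j\<in>{j}. real j powr \<gamma> * ln (real j) powr \<alpha> * w j)" by simp
      also have "\<dots> \<le> B" unfolding B_def using w(1) summ by (intro sum_le_suminf) auto
      finally have wj: "w j \<le> B * real j" using j4 by (simp add: powr_minus_divide field_simps)
      have "(norm (c n))\<^sup>2 \<le> B * real j" using w(2)[of n] wj by (simp add: j_def)
      also have "\<dots> \<le> (B + 1) * N m" using jN B0 by (intro mult_mono) auto
      also have "\<dots> \<le> ((B + 1) * N m)\<^sup>2"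
      proof (rule self_le_power)
        have "1 * 1 \<le> (B + 1) * N m" using B0 N1 by (intro mult_mono) auto
        then show "1 \<le> (B + 1) * N m" by simp
      qed simp
      finally show "(norm (c n))\<^sup>2 \<le> ((B + 1) * N m)\<^sup>2" .
      show "0 \<le> (B + 1) * N m" using B0 N1[of m] by simp
    qed
    have coeff: "norm (c n * of_real (X n \<omega>)) * (C * (real (J n) + 1) ^ p) \<le> L * N m ^ (2 * p + 2)"
      if n: "\<beta> n = m" "m \<ge> 1" for n m
    proof -
      have "real (n + 1) \<le> real (R m)" using lt_R[OF n(1)] by (intro of_nat_mono) simp
      then have "\<bar>X n \<omega>\<bar> \<le> K * N m ^ (p + 1)"
        using K(2)[of n] mult_left_mono[OF _ K(1), of "real n + 1" "N m ^ (p + 1)"]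
        by (simp add: R_def N_def)
      moreover have "(real (J n) + 1) ^ p \<le> N m ^ p"
        using \<beta>_ub[of n] n by (intro power_mono) (simp_all add: N_def)
      ultimately have "norm (c n) * \<bar>X n \<omega>\<bar> * (C * (real (J n) + 1) ^ p)
          \<le> ((B + 1) * N m) * (K * N m ^ (p + 1)) * (C * N m ^ p)"
        using c_le[OF n] C K(1) B0 N1[of m] by (intro mult_mono mult_nonneg_nonneg) auto
      also have "\<dots> = L * N m ^ (2 * p + 2)"
        by (simp add: L_def power_add power_mult mult_ac power2_eq_square power_mult_distrib)
      finally show ?thesis by (simp add: norm_mult)
    qed
    have card_bl: "real (card (bl m r)) \<le> N m ^ (p + 1)" for m r
    proof -
      have "bl m r \<subseteq> {..<R m}" using lt_R by (auto simp: bl_def)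
      from card_mono[OF _ this] have "real (card (bl m r)) \<le> real (R m)" by simp
      then show ?thesis by (simp add: R_def N_def)
    qed
    have sum_bl: "(\<Sum>n\<in>bl m r. norm (c n * of_real (X n \<omega>)) * (C * (real (J n) + 1) ^ p)) \<le> L * N m ^ P0"
      if "m \<ge> 1" for m r
    proof -
      have "(\<Sum>n\<in>bl m r. norm (c n * of_real (X n \<omega>)) * (C * (real (J n) + 1) ^ p))
          \<le> (\<Sum>n\<in>bl m r. L * N m ^ (2 * p + 2))"
        using that by (intro sum_mono coeff) (auto simp: bl_def)
      also have "\<dots> = real (card (bl m r)) * (L * N m ^ (2 * p + 2))" by simp
      also have "\<dots> \<le> N m ^ (p + 1) * (L * N m ^ (2 * p + 2))"
        using L0 N1[of m] card_bl by (intro mult_right_mono) auto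
      also have "\<dots> = L * N m ^ ((p + 1) + (2 * p + 2))" by (simp only: power_add mult_ac)
      also have "(p + 1) + (2 * p + 2) = P0" by (simp add: P0_def)
      finally show ?thesis .
    qed
    have T_lip: "norm (T m r x \<omega> - T m r y \<omega>) \<le> L * N m ^ P0 * norm (x - y)" if "m \<ge> 1" for m r x y
    proof -
      have "norm (T m r x \<omega> - T m r y \<omega>)
          \<le> (\<Sum>n\<in>bl m r. norm (c n * of_real (X n \<omega>) * (\<psi> n x - \<psi> n y)))"
        unfolding T_def sum_subtractf[symmetric] right_diff_distrib[symmetric] by (rule norm_sum)
      also have "\<dots> \<le> (\<Sum>n\<in>bl m r. norm (c n * of_real (X n \<omega>)) * (C * (real (J n) + 1) ^ p) * norm (x - y))"
        unfolding norm_mult[of "_ * _" "_ - _"] mult.assoc[of "norm (_ * _)"]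
        by (intro sum_mono mult_left_mono lip) auto
      also have "\<dots> \<le> L * N m ^ P0 * norm (x - y)"
        unfolding sum_distrib_right[symmetric] using sum_bl[OF that] by (intro mult_right_mono) auto
      finally show ?thesis .
    qed
    have T_dec: "norm x * norm (T m r x \<omega>) \<le> L * N m ^ P0" if "m \<ge> 1" for m r x
    proof -
      have "norm x * norm (T m r x \<omega>) \<le> norm x * (\<Sum>n\<in>bl m r. norm (c n * of_real (X n \<omega>) * \<psi> n x))"
        unfolding T_def by (intro mult_left_mono norm_sum) auto
      also have "\<dots> = (\<Sum>n\<in>bl m r. norm (c n * of_real (X n \<omega>)) * (norm x * norm (\<psi> n x)))"
        unfolding sum_distrib_left by (intro sum.cong) (auto simp: norm_mult mult_ac)
      also have "\<dots> \<le> (\<Sum>n\<in>bl m r. norm (c n * of_real (X n \<omega>)) * (C * (real (J n) + 1) ^ p))"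
        by (intro sum_mono mult_left_mono dec) auto
      finally show ?thesis using sum_bl[OF that, of r] by linarith
    qed
    \<comment> \<open>The first term bounds the values on the net, the second the passage to other
      points: inside the ball by the Lipschitz bound, outside it by decay.\<close>
    define \<eta> where "\<eta> m = t m + L * (DIM('a) + 1) / N m" for m
    have T_le: "norm (T m r x \<omega>) \<le> \<eta> m" if m: "m \<ge> 1" "m \<ge> m0" for m r x
    proof (cases "norm x \<le> real (Z m) * \<delta> m")
      case True
      then obtain y where y: "y \<in> G m" "norm (x - y) \<le> DIM('a) * \<delta> m" using G(3) by blast
      have "norm (T m (min r (R m)) y \<omega>) \<le> t m"
      proof (rule ccontr)
        assume "\<not> ?thesis"
        then have "\<omega> \<in> {\<omega> \<in> space M. t m < norm (T m (min r (R m)) y \<omega>)}"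
          using m0[OF m(2)] by auto
        moreover have "(min r (R m), y) \<in> {..R m} \<times> G m" using y(1) by simp
        ultimately have "\<omega> \<in> E m" unfolding E_def by blast
        then show False using m0[OF m(2)] by simp
      qed
      then have Ty: "norm (T m r y \<omega>) \<le> t m" by (simp add: T_min[of m r])
      have "norm (T m r x \<omega> - T m r y \<omega>) \<le> L * N m ^ P0 * norm (x - y)" by (rule T_lip[OF m(1)])
      also have "\<dots> \<le> L * N m ^ P0 * (DIM('a) * \<delta> m)"
        using y L0 N1[of m] by (intro mult_left_mono) auto
      also have "\<dots> = L * DIM('a) / N m" using N1[of m] by (simp add: \<delta>_def N_def field_simps)
      finally have "norm (T m r x \<omega>) \<le> t m + L * DIM('a) / N m"
        using Ty norm_triangle_sub[of "T m r x \<omega>" "T m r y \<omega>"] by linarith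
      also have "\<dots> \<le> \<eta> m" unfolding \<eta>_def using L0 N1[of m]
        by (intro add_left_mono divide_right_mono mult_left_mono) auto
      finally show ?thesis .
    next
      case False
      then have x: "N m ^ (P0 + 1) \<le> norm x" unfolding Z\<delta> by (simp add: N_def)
      have "N m ^ (P0 + 1) * norm (T m r x \<omega>) \<le> norm x * norm (T m r x \<omega>)"
        using x by (intro mult_right_mono) auto
      then have "N m ^ P0 * (N m * norm (T m r x \<omega>)) \<le> N m ^ P0 * L"
        using T_dec[OF m(1), of x r] by (simp add: mult_ac)
      moreover have "N m ^ P0 > 0" using N1[of m] by simp
      ultimately have "N m * norm (T m r x \<omega>) \<le> L" by simp
      then have "norm (T m r x \<omega>) \<le> L * 1 / N m" using N1[of m] by (simp add: field_simps)
      also have "\<dots> \<le> L * (DIM('a) + 1) / N m"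
        using L0 N1[of m] by (intro divide_right_mono mult_left_mono) auto
      also have "\<dots> \<le> \<eta> m" using t_pos[of m] by (simp add: \<eta>_def)
      finally show ?thesis .
    qed
    have \<eta>_summ: "summable \<eta>"
      unfolding \<eta>_def
    proof (intro summable_add)
      show "summable t" unfolding t_def using q by (intro summable_mult summable_geometric) auto
      show "summable (\<lambda>m. L * (DIM('a) + 1) / N m)"
      proof (rule summable_comparison_test'[of "\<lambda>m. L * (DIM('a) + 1) * (1 / 2) ^ m" 0])
        fix m :: nat
        have "(2::nat) ^ m \<le> 2 ^ 2 ^ (m + 1)"
          using less_exp[of "m + 1"] by (intro power_increasing) auto
        then have "real (2 ^ m) \<le> N m" unfolding N_def tower_def by (rule of_nat_mono)
        then have "L * (DIM('a) + 1) / N m \<le> L * (DIM('a) + 1) / 2 ^ m"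
          using L0 N1[of m] by (intro divide_left_mono) auto
        then show "norm (L * (DIM('a) + 1) / N m) \<le> L * (DIM('a) + 1) * (1 / 2) ^ m"
          using L0 N1[of m] by (simp add: power_divide)
      qed (intro summable_mult summable_geometric, simp)
    qed
    have \<eta>_nonneg: "\<eta> m \<ge> 0" for m using t_pos[of m] L0 N1[of m] by (simp add: \<eta>_def add_nonneg_nonneg)
    define S where "S r x = (\<Sum>n<r. c n * of_real (X n \<omega>) * \<psi> n x)" for r x
    have "uniformly_Cauchy_on UNIV S"
    proof (rule uniformly_Cauchy_onI')
      fix e :: real assume e: "e > 0"
      then obtain m1 where m1: "\<And>a b. m1 \<le> a \<Longrightarrow> norm (sum \<eta> {a..<b}) < e / 2"
        using \<eta>_summ unfolding summable_Cauchy by (metis half_gt_zero)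
      define m2 where "m2 = max 1 (max m0 m1)"
      have "dist (S r x) (S r' x) < e" if r: "R m2 \<le> r" "r < r'" for r r' x
      proof -
        \<comment> \<open>From the cut-off \<open>R m2\<close> on, no index belongs to a block
          before \<open>m2\<close>.\<close>
        have \<beta>_ge: "m2 \<le> \<beta> n" if "n \<ge> r" for n
        proof (rule ccontr)
          assume a: "\<not> m2 \<le> \<beta> n"
          have "n < R (\<beta> n)" by (rule lt_R) simp
          also have "\<dots> \<le> R m2" unfolding R_def using a by (intro power_mono tower_mono) auto
          finally show False using that r by simp
        qed
        define M' where "M' = Suc (Max (insert 0 (\<beta> ` {r..<r'})))"
        have \<beta>_lt: "\<beta> n < M'" if "n \<in> {r..<r'}" for n
          unfolding M'_def less_Suc_eq_le using that by (intro Max_ge) auto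
        have "S r' x - S r x = (\<Sum>n\<in>{r..<r'}. c n * of_real (X n \<omega>) * \<psi> n x)"
        proof -
          have "{..<r'} - {..<r} = {r..<r'}" by auto
          moreover have "{..<r} \<subseteq> {..<r'}" using r by auto
          ultimately show ?thesis unfolding S_def using sum_diff[of "{..<r'}" "{..<r}" "\<lambda>n. c n * of_real (X n \<omega>) * \<psi> n x"] by simp
        qed
        also have "\<dots> = (\<Sum>m\<in>{m2..<M'}. \<Sum>n\<in>{n. n \<in> {r..<r'} \<and> \<beta> n = m}. c n * of_real (X n \<omega>) * \<psi> n x)"
          using \<beta>_ge \<beta>_lt by (intro sum.group[symmetric]) auto
        \<comment> \<open>Between two cut-offs each block contributes a difference of two of its own
          partial sums, whence the factor 2 below.\<close>
        also have "\<dots> = (\<Sum>m\<in>{m2..<M'}. T m r' x \<omega> - T m r x \<omega>)"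
        proof (rule sum.cong[OF refl])
          fix m
          have "{n. n \<in> {r..<r'} \<and> \<beta> n = m} = bl m r' - bl m r" "bl m r \<subseteq> bl m r'"
            using r by (auto simp: bl_def)
          then show "(\<Sum>n\<in>{n. n \<in> {r..<r'} \<and> \<beta> n = m}. c n * of_real (X n \<omega>) * \<psi> n x) = T m r' x \<omega> - T m r x \<omega>"
            unfolding T_def using sum_diff[of "bl m r'" "bl m r" "\<lambda>n. c n * of_real (X n \<omega>) * \<psi> n x"] fin_bl by simp
        qed
        finally have "norm (S r' x - S r x) \<le> (\<Sum>m\<in>{m2..<M'}. norm (T m r' x \<omega> - T m r x \<omega>))"
          by (simp add: norm_sum)
        also have "\<dots> \<le> (\<Sum>m\<in>{m2..<M'}. 2 * \<eta> m)"
        proof (rule sum_mono)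
          fix m assume "m \<in> {m2..<M'}"
          then have "m \<ge> 1" "m \<ge> m0" by (auto simp: m2_def)
          then show "norm (T m r' x \<omega> - T m r x \<omega>) \<le> 2 * \<eta> m"
            using T_le[of m r' x] T_le[of m r x] norm_triangle_ineq4[of "T m r' x \<omega>" "T m r x \<omega>"] by linarith
        qed
        also have "\<dots> = 2 * sum \<eta> {m2..<M'}" by (simp add: sum_distrib_left)
        also have "\<dots> < e"
        proof -
          have "\<bar>sum \<eta> {m2..<M'}\<bar> < e / 2" using m1[of m2 M'] by (simp add: m2_def)
          then show ?thesis by linarith
        qed
        finally show ?thesis by (simp add: dist_norm norm_minus_commute)
      qed
      then show "\<exists>M. \<forall>x\<in>UNIV. \<forall>m\<ge>M. \<forall>n>m. dist (S m x) (S n x) < e" by blast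
    qed
    then show ?case using Cauchy_uniformly_convergent unfolding S_def[abs_def] by blast
  qed
qed

end

subsection \<open>Eigenfunctions and tempered distributions\<close>

lemma cnj_hermite_tensor [simp]: "cnj (hermite_tensor \<alpha> x) = hermite_tensor \<alpha> x"
  by (simp add: hermite_tensor_def)

lemma hermite_tensor_restrict: "hermite_tensor (restrict \<alpha> Basis) = hermite_tensor \<alpha>"
  by (simp add: hermite_tensor_def[abs_def] tensor_def)

lemma L2_fun_hermite_tensor: "L2_fun (hermite_tensor \<alpha>)"
  by (intro hermite_span_L2 hermite_span.tensor)

lemma L2_fun_diff:
  assumes "L2_fun f" "L2_fun g"
  shows "L2_fun (\<lambda>x. f x - g x)"
proof -
  have [measurable]: "f \<in> borel_measurable borel" "g \<in> borel_measurable borel"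
    using assms by (auto simp: L2_fun_def)
  have "integrable lborel (\<lambda>x. (norm (f x - g x))\<^sup>2)"
  proof (rule Bochner_Integration.integrable_bound)
    show "integrable lborel (\<lambda>x. 2 * (norm (f x))\<^sup>2 + 2 * (norm (g x))\<^sup>2)"
      using assms by (simp add: L2_fun_def)
    show "AE x in lborel. norm ((norm (f x - g x))\<^sup>2) \<le> norm (2 * (norm (f x))\<^sup>2 + 2 * (norm (g x))\<^sup>2)"
    proof (rule AE_I2)
      fix x
      have "(norm (f x - g x))\<^sup>2 \<le> (norm (f x) + norm (g x))\<^sup>2"
        by (intro power_mono norm_triangle_ineq4) auto
      also have "\<dots> \<le> 2 * (norm (f x))\<^sup>2 + 2 * (norm (g x))\<^sup>2"
        using zero_le_power2[of "norm (f x) - norm (g x)"] unfolding power2_sum power2_diff by linarith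
      finally show "norm ((norm (f x - g x))\<^sup>2) \<le> norm (2 * (norm (f x))\<^sup>2 + 2 * (norm (g x))\<^sup>2)" by simp
    qed
  qed measurable
  then show ?thesis by (simp add: L2_fun_def)
qed

section \<open>Expansion of an eigenfunction within a single level\<close>

definition hermite_coeff :: "('a::euclidean_space \<Rightarrow> complex) \<Rightarrow> ('a \<Rightarrow> nat) \<Rightarrow> complex" where
  "hermite_coeff f \<alpha> = (LINT x|lborel. f x * hermite_tensor \<alpha> x)"

definition hermite_proj :: "('a::euclidean_space \<Rightarrow> complex) \<Rightarrow> nat \<Rightarrow> 'a \<Rightarrow> complex" where
  "hermite_proj f k x = (\<Sum>\<alpha>\<in>multi_indices Basis k. hermite_coeff f \<alpha> * hermite_tensor \<alpha> x)"

lemma finite_multi_indices_Basis [simp]: "finite (multi_indices Basis k)"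
  by (rule finite_multi_indices) simp

lemma hermite_span_proj: "hermite_span (hermite_proj f k)"
  unfolding hermite_proj_def[abs_def] by (intro hermite_span_sum hermite_span.intros) simp

text \<open>Testing the weak eigenvalue equation with the Schwartz function
  \<open>hermite_tensor \<alpha>\<close> multiplies the coefficient by each of the two eigenvalues;
  if these differ, it vanishes.\<close>

lemma eigenfunction_coeff:
  fixes f :: "'a::euclidean_space \<Rightarrow> complex"
  assumes "harm_osc_L2 f (\<lambda>x. of_real l * f x)" "l \<noteq> 2 * real (sum \<alpha> Basis) + DIM('a)"
  shows "hermite_coeff f \<alpha> = 0"
proof -
  define c :: complex where "c = of_real (2 * real (sum \<alpha> Basis) + DIM('a))"
  have "(LINT x|lborel. f x * harm_osc (hermite_tensor \<alpha>) x) = (LINT x|lborel. of_real l * f x * hermite_tensor \<alpha> x)"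
    using assms(1) schwartz_hermite_tensor[of \<alpha>]
    unfolding harm_osc_L2_def distr_eq_def harm_osc_distr_def distr_of_fun_def by blast
  moreover have "(LINT x|lborel. f x * harm_osc (hermite_tensor \<alpha>) x) = c * hermite_coeff f \<alpha>"
    unfolding harm_osc_hermite_tensor hermite_coeff_def c_def[symmetric]
    by (simp add: mult.left_commute)
  moreover have "(LINT x|lborel. of_real l * f x * hermite_tensor \<alpha> x) = of_real l * hermite_coeff f \<alpha>"
    unfolding hermite_coeff_def by (simp add: mult.assoc)
  ultimately have "(c - of_real l) * hermite_coeff f \<alpha> = 0" by (simp add: left_diff_distrib)
  moreover have "c \<noteq> of_real l" unfolding c_def using assms(2) by (simp only: of_real_eq_iff)
  ultimately show ?thesis by simp
qed

text \<open>Completeness is used twice: if \<open>l\<close> were not the eigenvalue of a tensor, all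
  coefficients and hence \<open>f\<close> would vanish; and \<open>f\<close> minus its projection is
  orthogonal to every tensor, since the coefficients on other levels vanish.\<close>

lemma eigenfunction_expansion:
  fixes f :: "'a::euclidean_space \<Rightarrow> complex"
  assumes eig: "harm_osc_L2 f (\<lambda>x. of_real l * f x)" and nz: "L2_inner f f = 1"
  shows "\<exists>k. l = 2 * real k + DIM('a) \<and> (AE x in lborel. f x = hermite_proj f k x)"
proof -
  have f: "L2_fun f" using eig by (simp add: harm_osc_L2_def)
  obtain k where k: "l = 2 * real k + DIM('a)"
  proof (rule ccontr)
    assume "\<not> thesis"
    then have "hermite_coeff f \<alpha> = 0" for \<alpha> using that eigenfunction_coeff[OF eig] by blast
    then have "AE x in lborel. f x = 0"
      by (intro hermite_tensor_complete f) (simp add: hermite_coeff_def)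
    then have "AE x in lborel. f x * cnj (f x) = 0" by eventually_elim simp
    then have "L2_inner f f = 0" unfolding L2_inner_def by (rule integral_eq_zero_AE)
    then show False using nz by simp
  qed
  define g where "g x = f x - hermite_proj f k x" for x
  have "(LINT x|lborel. g x * hermite_tensor \<beta> x) = 0" for \<beta>
  proof -
    \<comment> \<open>A tensor sees its index only on \<open>Basis\<close>; the restriction is
      extensional, as the orthogonality relation of tensors requires.\<close>
    define \<gamma> where "\<gamma> = restrict \<beta> Basis"
    have \<gamma>: "\<gamma> \<in> Basis \<rightarrow>\<^sub>E UNIV" "hermite_tensor \<beta> = hermite_tensor \<gamma>"
      by (auto simp: \<gamma>_def hermite_tensor_restrict)
    have int: "integrable lborel (\<lambda>x. f x * hermite_tensor \<gamma> x)"
      by (intro integrable_L2_mult f L2_fun_hermite_tensor)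
    have proj: "hermite_proj f k x * hermite_tensor \<gamma> x
        = (\<Sum>\<alpha>\<in>multi_indices Basis k. hermite_coeff f \<alpha> * (hermite_tensor \<alpha> x * hermite_tensor \<gamma> x))" for x
      by (simp add: hermite_proj_def sum_distrib_right mult.assoc)
    have "(LINT x|lborel. hermite_proj f k x * hermite_tensor \<gamma> x)
        = (\<Sum>\<alpha>\<in>multi_indices Basis k. hermite_coeff f \<alpha> * (LINT x|lborel. hermite_tensor \<alpha> x * hermite_tensor \<gamma> x))"
      unfolding proj by (subst Bochner_Integration.integral_sum) (auto simp: integrable_hermite_tensor_mult)
    also have "\<dots> = (\<Sum>\<alpha>\<in>multi_indices Basis k. if \<alpha> = \<gamma> then hermite_coeff f \<alpha> else 0)"
      using \<gamma> by (intro sum.cong) (auto simp: integral_hermite_tensor_mult multi_indices_def)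
    also have "\<dots> = hermite_coeff f \<gamma>"
    proof (cases "\<gamma> \<in> multi_indices Basis k")
      case False
      then have "sum \<gamma> Basis \<noteq> k" using \<gamma> by (simp add: multi_indices_def)
      then have "l \<noteq> 2 * real (sum \<gamma> Basis) + DIM('a)" using k by (simp del: of_nat_sum)
      then have "hermite_coeff f \<gamma> = 0" by (rule eigenfunction_coeff[OF eig])
      then show ?thesis using False by simp
    qed simp
    finally have "(LINT x|lborel. hermite_proj f k x * hermite_tensor \<gamma> x) = hermite_coeff f \<gamma>" .
    moreover have "integrable lborel (\<lambda>x. hermite_proj f k x * hermite_tensor \<gamma> x)"
      by (intro integrable_L2_mult hermite_span_L2 hermite_span_proj hermite_span.tensor)
    ultimately show ?thesis
      using int by (simp add: g_def \<gamma>(2) left_diff_distrib hermite_coeff_def)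
  qed
  moreover have "L2_fun g"
    unfolding g_def[abs_def] by (intro L2_fun_diff f hermite_span_L2 hermite_span_proj)
  ultimately have "AE x in lborel. g x = 0" by (intro hermite_tensor_complete)
  then show ?thesis using k by (auto simp: g_def)
qed

lemma L2_inner_hermite_proj:
  "L2_inner (hermite_proj f k) (hermite_proj g k)
    = (\<Sum>\<alpha>\<in>multi_indices Basis k. hermite_coeff f \<alpha> * cnj (hermite_coeff g \<alpha>))"
proof -
  let ?I = "multi_indices Basis k"
  have "hermite_proj f k x * cnj (hermite_proj g k x) = (\<Sum>\<alpha>\<in>?I. \<Sum>\<beta>\<in>?I.
      (hermite_coeff f \<alpha> * cnj (hermite_coeff g \<beta>)) * (hermite_tensor \<alpha> x * hermite_tensor \<beta> x))" for x
    by (simp add: hermite_proj_def sum_product mult_ac)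
  then have "L2_inner (hermite_proj f k) (hermite_proj g k) = (\<Sum>\<alpha>\<in>?I. \<Sum>\<beta>\<in>?I.
      (hermite_coeff f \<alpha> * cnj (hermite_coeff g \<beta>)) * (LINT x|lborel. hermite_tensor \<alpha> x * hermite_tensor \<beta> x))"
    by (simp add: L2_inner_def Bochner_Integration.integral_sum integrable_hermite_tensor_mult)
  also have "\<dots> = (\<Sum>\<alpha>\<in>?I. \<Sum>\<beta>\<in>?I. if \<beta> = \<alpha> then hermite_coeff f \<alpha> * cnj (hermite_coeff g \<beta>) else 0)"
    by (intro sum.cong refl) (auto simp: integral_hermite_tensor_mult multi_indices_def)
  also have "\<dots> = (\<Sum>\<alpha>\<in>?I. hermite_coeff f \<alpha> * cnj (hermite_coeff g \<alpha>))"
    by (intro sum.cong refl) simp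
  finally show ?thesis .
qed

text \<open>The rows of \<open>U\<close> are orthonormal and \<open>y\<close> is the projection of
  \<open>v\<close> on their conjugates, conjugated because the pairing \<open>U n i * v i\<close> is
  bilinear. Expanding the squared norm of \<open>v - y\<close> gives the inequality.\<close>

lemma finite_bessel:
  fixes U :: "'n \<Rightarrow> 'i \<Rightarrow> complex" and v :: "'i \<Rightarrow> complex"
  assumes "finite N" "finite I"
    and orth: "\<And>m n. m \<in> N \<Longrightarrow> n \<in> N \<Longrightarrow> (\<Sum>i\<in>I. U m i * cnj (U n i)) = (if m = n then 1 else 0)"
  shows "(\<Sum>n\<in>N. (norm (\<Sum>i\<in>I. U n i * v i))\<^sup>2) \<le> (\<Sum>i\<in>I. (norm (v i))\<^sup>2)"
proof -
  define a where "a n = (\<Sum>i\<in>I. U n i * v i)" for n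
  define y where "y i = (\<Sum>n\<in>N. a n * cnj (U n i))" for i
  have vy: "(\<Sum>i\<in>I. cnj (v i) * y i) = (\<Sum>n\<in>N. a n * cnj (a n))"
  proof -
    have "(\<Sum>i\<in>I. cnj (v i) * y i) = (\<Sum>i\<in>I. \<Sum>n\<in>N. a n * (cnj (U n i) * cnj (v i)))"
      unfolding y_def sum_distrib_left by (intro sum.cong) (auto simp: mult_ac)
    also have "\<dots> = (\<Sum>n\<in>N. \<Sum>i\<in>I. a n * (cnj (U n i) * cnj (v i)))" by (rule sum.swap)
    finally show ?thesis by (simp add: sum_distrib_left[symmetric] a_def)
  qed
  have yy: "(\<Sum>i\<in>I. cnj (y i) * y i) = (\<Sum>n\<in>N. a n * cnj (a n))"
  proof -
    have "(\<Sum>i\<in>I. cnj (y i) * y i) = (\<Sum>i\<in>I. \<Sum>m\<in>N. \<Sum>n\<in>N. (cnj (a m) * a n) * (U m i * cnj (U n i)))"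
      unfolding y_def cnj_sum sum_product by (intro sum.cong) (auto simp: mult_ac)
    also have "\<dots> = (\<Sum>m\<in>N. \<Sum>i\<in>I. \<Sum>n\<in>N. (cnj (a m) * a n) * (U m i * cnj (U n i)))"
      by (rule sum.swap)
    also have "\<dots> = (\<Sum>m\<in>N. \<Sum>n\<in>N. (cnj (a m) * a n) * (\<Sum>i\<in>I. U m i * cnj (U n i)))"
      unfolding sum_distrib_left by (intro sum.cong refl sum.swap)
    also have "\<dots> = (\<Sum>m\<in>N. \<Sum>n\<in>N. if n = m then cnj (a m) * a n else 0)"
      using orth by (intro sum.cong refl) auto
    also have "\<dots> = (\<Sum>m\<in>N. cnj (a m) * a m)" using assms(1) by (intro sum.cong refl) simp
    finally show ?thesis by (simp add: mult.commute)
  qed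
  have "(norm (v i - y i))\<^sup>2 = (norm (v i))\<^sup>2 - 2 * Re (cnj (v i) * y i) + Re (cnj (y i) * y i)" for i
    unfolding cmod_power2 by (simp add: power2_eq_square algebra_simps)
  then have "(\<Sum>i\<in>I. (norm (v i - y i))\<^sup>2)
      = (\<Sum>i\<in>I. (norm (v i))\<^sup>2) - 2 * Re (\<Sum>i\<in>I. cnj (v i) * y i) + Re (\<Sum>i\<in>I. cnj (y i) * y i)"
    by (simp only: sum.distrib sum_subtractf sum_distrib_left[symmetric] Re_sum)
  also have "\<dots> = (\<Sum>i\<in>I. (norm (v i))\<^sup>2) - Re (\<Sum>n\<in>N. a n * cnj (a n))"
    unfolding vy yy by simp
  also have "Re (\<Sum>n\<in>N. a n * cnj (a n)) = (\<Sum>n\<in>N. (norm (a n))\<^sup>2)"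
    by (simp add: complex_norm_square[symmetric] flip: of_real_power)
  finally show ?thesis
    using sum_nonneg[of I "\<lambda>i. (norm (v i - y i))\<^sup>2"] by (simp add: a_def)
qed

section \<open>Pairing with Schwartz functions\<close>

lemma schwartz_continuous: "schwartz \<psi> \<Longrightarrow> continuous_on UNIV \<psi>"
proof -
  assume "schwartz \<psi>"
  then have "\<forall>x. iter_partial_deriv [] \<psi> differentiable (at x)" unfolding schwartz_def by blast
  then show ?thesis
    by (auto intro!: continuous_at_imp_continuous_on differentiable_imp_continuous_within)
qed

lemma schwartz_seminorm_bound:
  fixes \<psi> :: "'a::euclidean_space \<Rightarrow> complex"
  assumes "schwartz \<psi>"
  shows "(1 + norm x) ^ k * norm (\<psi> x) \<le> schwartz_seminorm k \<psi>"
proof -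
  define s where "s bs = (SUP x. (1 + norm x) ^ k * norm (iter_partial_deriv bs \<psi> x))" for bs
  have bdd: "bdd_above (range (\<lambda>x. (1 + norm x) ^ k * norm (iter_partial_deriv bs \<psi> x)))"
    if "set bs \<subseteq> Basis" for bs
  proof -
    have "bounded (range (\<lambda>x. (1 + norm x) ^ k *\<^sub>R iter_partial_deriv bs \<psi> x))"
      using assms that unfolding schwartz_def by (auto simp: in_lists_conv_set)
    then obtain B where "\<And>x. norm ((1 + norm x) ^ k *\<^sub>R iter_partial_deriv bs \<psi> x) \<le> B"
      by (auto simp: bounded_iff)
    then show ?thesis by (intro bdd_aboveI2[of _ _ B]) (simp add: abs_of_nonneg)
  qed
  have le: "(1 + norm x) ^ k * norm (iter_partial_deriv bs \<psi> x) \<le> s bs" if "set bs \<subseteq> Basis" for bs x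
    unfolding s_def by (rule cSUP_upper[OF _ bdd[OF that]]) simp
  have s0: "s bs \<ge> 0" if "set bs \<subseteq> Basis" for bs
    by (rule order_trans[OF _ le[OF that, of 0]]) simp
  \<comment> \<open>The empty list of derivatives is one of the summands of the seminorm.\<close>
  have "s [] \<le> schwartz_seminorm k \<psi>"
    unfolding schwartz_seminorm_def s_def[symmetric]
    by (rule member_le_sum) (auto intro: s0 finite_lists_length_le)
  then show ?thesis using le[of "[]" x] by simp
qed

lemma schwartz_integrable:
  fixes \<psi> :: "'a::euclidean_space \<Rightarrow> complex"
  assumes "schwartz \<psi>"
  shows "integrable lborel \<psi>"
    and "(LINT x|lborel. norm (\<psi> x)) \<le> schwartz_seminorm (2 * DIM('a)) \<psi> * (LINT x|lborel. tensor (\<lambda>_::'a. \<lambda>t. inverse (1 + t\<^sup>2)) x)"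
  using integrable_rapid_decay[of \<psi>, OF _ schwartz_seminorm_bound[OF assms]]
    borel_measurable_continuous_onI[OF schwartz_continuous[OF assms]] by auto

lemma integrable_bounded_mult:
  fixes g \<psi> :: "'a::euclidean_space \<Rightarrow> complex"
  assumes "integrable lborel \<psi>" "g \<in> borel_measurable borel" "\<And>x. norm (g x) \<le> B"
  shows "integrable lborel (\<lambda>x. g x * \<psi> x)"
proof (rule Bochner_Integration.integrable_bound)
  show "integrable lborel (\<lambda>x. B * norm (\<psi> x))" using assms by auto
  have [measurable]: "\<psi> \<in> borel_measurable borel" using borel_measurable_integrable[OF assms(1)] by simp
  note assms(2)[measurable]
  show "(\<lambda>x. g x * \<psi> x) \<in> borel_measurable lborel" by measurable
  show "AE x in lborel. norm (g x * \<psi> x) \<le> norm (B * norm (\<psi> x))"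
    by (intro AE_I2) (auto simp: norm_mult abs_mult intro!: mult_right_mono order_trans[OF assms(3) abs_ge_self])
qed

lemma tempered_distribution_bounded_continuous:
  fixes g :: "'a::euclidean_space \<Rightarrow> complex"
  assumes g: "continuous_on UNIV g" "\<And>x. norm (g x) \<le> B"
  shows "tempered_distribution (distr_of_fun g)"
  unfolding tempered_distribution_def distr_of_fun_def
proof (intro conjI allI impI)
  have m: "g \<in> borel_measurable borel" using g(1) by (rule borel_measurable_continuous_onI)
  have int: "integrable lborel (\<lambda>x. g x * \<psi> x)" if "schwartz \<psi>" for \<psi>
    using schwartz_integrable(1)[OF that] m g(2) by (rule integrable_bounded_mult)
  show "(LINT x|lborel. g x * (\<psi> x + \<psi>' x)) = (LINT x|lborel. g x * \<psi> x) + (LINT x|lborel. g x * \<psi>' x)"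
    if "schwartz \<psi>" "schwartz \<psi>'" for \<psi> \<psi>'
    using int[OF that(1)] int[OF that(2)] by (simp add: distrib_left)
  show "(LINT x|lborel. g x * (a * \<psi> x)) = a * (LINT x|lborel. g x * \<psi> x)" for a \<psi>
    by (simp add: mult.left_commute)
  have B: "B \<ge> 0" using g(2)[of 0] norm_ge_zero order_trans by blast
  have "norm (LINT x|lborel. g x * \<psi> x)
      \<le> (B * (LINT x|lborel. tensor (\<lambda>_::'a. \<lambda>t. inverse (1 + t\<^sup>2)) x)) * schwartz_seminorm (2 * DIM('a)) \<psi>"
    if \<psi>: "schwartz \<psi>" for \<psi>
  proof -
    have "norm (LINT x|lborel. g x * \<psi> x) \<le> (LINT x|lborel. norm (g x * \<psi> x))" by (rule integral_norm_bound)
    also have "\<dots> \<le> (LINT x|lborel. B * norm (\<psi> x))"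
      using int[OF \<psi>] schwartz_integrable(1)[OF \<psi>] g(2)
      by (intro integral_mono integrable_norm integrable_mult_right) (auto simp: norm_mult intro!: mult_right_mono)
    also have "\<dots> = B * (LINT x|lborel. norm (\<psi> x))" by simp
    also have "\<dots> \<le> B * (schwartz_seminorm (2 * DIM('a)) \<psi> * (LINT x|lborel. tensor (\<lambda>_::'a. \<lambda>t. inverse (1 + t\<^sup>2)) x))"
      using schwartz_integrable(2)[OF \<psi>] B by (rule mult_left_mono)
    finally show ?thesis by (simp add: mult_ac)
  qed
  then show "\<exists>C k. \<forall>f. schwartz f \<longrightarrow> norm (LINT x|lborel. g x * f x) \<le> C * schwartz_seminorm k f" by blast
qed


text \<open>Dominated convergence with the bound \<open>(B + 1) * norm (\<psi> x)\<close>, valid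
  from an index \<open>r0\<close> on; the shift by \<open>r0\<close> is undone afterwards.
  \<open>F n\<close> is a continuous representative of \<open>f n\<close>.\<close>

lemma distr_of_fun_sums:
  fixes g :: "'a::euclidean_space \<Rightarrow> complex" and f F :: "nat \<Rightarrow> 'a \<Rightarrow> complex"
  assumes lim: "uniform_limit UNIV (\<lambda>r x. \<Sum>n<r. F n x) g sequentially"
    and g: "continuous_on UNIV g" "\<And>x. norm (g x) \<le> B"
    and F: "\<And>n. continuous_on UNIV (F n)" "\<And>n x. norm (F n x) \<le> D n"
    and ae: "\<And>n. AE x in lborel. f n x = F n x" "\<And>n. f n \<in> borel_measurable borel"
  shows "distr_sums (\<lambda>n. distr_of_fun (f n)) (distr_of_fun g)"
  unfolding distr_sums_def
proof (intro allI impI)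
  fix \<psi> :: "'a \<Rightarrow> complex" assume \<psi>: "schwartz \<psi>"
  note \<psi>_int = schwartz_integrable(1)[OF \<psi>]
  have [measurable]: "\<psi> \<in> borel_measurable borel" using borel_measurable_integrable[OF \<psi>_int] by simp
  have F_meas[measurable]: "F n \<in> borel_measurable borel" for n using F(1) by (rule borel_measurable_continuous_onI)
  have [measurable]: "g \<in> borel_measurable borel" using g(1) by (rule borel_measurable_continuous_onI)
  define S where "S r x = (\<Sum>n<r. F n x)" for r x
  have int: "integrable lborel (\<lambda>x. F n x * \<psi> x)" for n
    using \<psi>_int F_meas F(2) by (rule integrable_bounded_mult)
  have partial: "(\<Sum>n<r. distr_of_fun (f n) \<psi>) = (LINT x|lborel. S r x * \<psi> x)" for r
  proof -
    have "distr_of_fun (f n) \<psi> = (LINT x|lborel. F n x * \<psi> x)" for n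
      unfolding distr_of_fun_def
    proof (rule integral_cong_AE)
      note ae(2)[measurable]
      show "(\<lambda>x. f n x * \<psi> x) \<in> borel_measurable lborel" by measurable
      show "AE x in lborel. f n x * \<psi> x = F n x * \<psi> x" using ae(1)[of n] by eventually_elim simp
    qed measurable
    then show ?thesis using int by (simp add: S_def sum_distrib_right)
  qed
  obtain r0 where r0: "\<And>r x. r \<ge> r0 \<Longrightarrow> norm (S r x - g x) < 1"
    using uniform_limitD[OF lim, of 1] by (auto simp: S_def eventually_sequentially dist_norm)
  have "(\<lambda>r. LINT x|lborel. S (r + r0) x * \<psi> x) \<longlonglongrightarrow> (LINT x|lborel. g x * \<psi> x)"
  proof (rule integral_dominated_convergence[where w = "\<lambda>x. (B + 1) * norm (\<psi> x)"])
    show "integrable lborel (\<lambda>x. (B + 1) * norm (\<psi> x))" using \<psi>_int by auto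
    show "AE x in lborel. (\<lambda>r. S (r + r0) x * \<psi> x) \<longlonglongrightarrow> g x * \<psi> x"
    proof (rule AE_I2)
      fix x
      have "(\<lambda>r. S r x) \<longlonglongrightarrow> g x" using tendsto_uniform_limitI[OF lim, of x] by (simp add: S_def)
      then have "(\<lambda>r. S (r + r0) x) \<longlonglongrightarrow> g x" by (rule LIMSEQ_ignore_initial_segment)
      then show "(\<lambda>r. S (r + r0) x * \<psi> x) \<longlonglongrightarrow> g x * \<psi> x" by (intro tendsto_intros)
    qed
    show "AE x in lborel. norm (S (r + r0) x * \<psi> x) \<le> (B + 1) * norm (\<psi> x)" for r
    proof (rule AE_I2)
      fix x
      have "norm (S (r + r0) x) \<le> B + 1"
        using r0[of "r + r0" x] g(2)[of x] norm_triangle_sub[of "S (r + r0) x" "g x"] by simp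
      then show "norm (S (r + r0) x * \<psi> x) \<le> (B + 1) * norm (\<psi> x)"
        unfolding norm_mult by (rule mult_right_mono) simp
    qed
  qed (unfold S_def, measurable)
  then have "(\<lambda>r. LINT x|lborel. S r x * \<psi> x) \<longlonglongrightarrow> (LINT x|lborel. g x * \<psi> x)"
    by (rule LIMSEQ_offset)
  then show "(\<lambda>n. distr_of_fun (f n) \<psi>) sums distr_of_fun g \<psi>"
    unfolding sums_def partial by (simp add: distr_of_fun_def)
qed

text \<open>As \<open>lam\<close> is nondecreasing with finite sublevel sets, a spectral truncation
  is an ordinary partial sum of length \<open>r L\<close>. The countably many null sets where
  \<open>f n\<close> and \<open>F n\<close> differ are merged, and the essential supremum ignores
  them.\<close>

lemma tendsto_Linf_spectral:
  fixes g :: "'a::euclidean_space \<Rightarrow> complex" and f F :: "nat \<Rightarrow> 'a \<Rightarrow> complex" and lam :: "nat \<Rightarrow> real"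
  assumes lim: "uniform_limit UNIV (\<lambda>r x. \<Sum>n<r. F n x) g sequentially"
    and g: "continuous_on UNIV g" "\<And>x. norm (g x) \<le> B"
    and ae: "\<And>n. AE x in lborel. f n x = F n x" "\<And>n. f n \<in> borel_measurable borel"
    and lam: "mono lam" "\<And>L. finite {n. lam n \<le> L}"
  shows "tendsto_Linf (\<lambda>L x. \<Sum>n | lam n \<le> L. f n x) (distr_of_fun g) at_top"
  unfolding tendsto_Linf_def
proof (intro exI conjI)
  have [measurable]: "g \<in> borel_measurable borel" using g(1) by (rule borel_measurable_continuous_onI)
  have "Linf_norm g \<le> ennreal B"
    unfolding Linf_norm_def using g(2) by (intro esssup_I) (auto intro!: AE_I2 ennreal_leI)
  then show "Linf_fun g" by (auto simp: Linf_fun_def intro: le_less_trans)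
  show "distr_eq (distr_of_fun g) (distr_of_fun g)" by (simp add: distr_eq_def)
  define r where "r L = (LEAST n. \<not> lam n \<le> L)" for L
  have set_eq: "{n. lam n \<le> L} = {..<r L}" for L
  proof -
    obtain n where "\<not> lam n \<le> L" using infinite_UNIV_nat finite_subset[OF _ lam(2)[of L], of UNIV] by auto
    then have r1: "\<not> lam (r L) \<le> L" unfolding r_def by (rule LeastI)
    show ?thesis
    proof (intro set_eqI iffI)
      fix n assume "n \<in> {n. lam n \<le> L}"
      then show "n \<in> {..<r L}" using r1 monoD[OF lam(1), of "r L" n] by (auto simp: not_less[symmetric])
    next
      fix n assume "n \<in> {..<r L}"
      then show "n \<in> {n. lam n \<le> L}" using not_less_Least[of n "\<lambda>n. \<not> lam n \<le> L"] by (auto simp: r_def)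
    qed
  qed
  have all: "AE x in lborel. \<forall>n. f n x = F n x" using ae(1) by (simp add: AE_all_countable)
  note ae(2)[measurable]
  show "((\<lambda>L. Linf_norm (\<lambda>x. (\<Sum>n | lam n \<le> L. f n x) - g x)) \<longlongrightarrow> 0) at_top"
  proof (rule order_tendstoI)
    fix a :: ennreal assume "0 < a"
    then obtain b where b: "0 < b" "b < a" using dense by blast
    then obtain e where e: "b = ennreal e" "e > 0" by (cases b) auto
    obtain N where N: "\<And>m x. m \<ge> N \<Longrightarrow> norm ((\<Sum>n<m. F n x) - g x) < e"
      using uniform_limitD[OF lim e(2)] by (auto simp: eventually_sequentially dist_norm)
    show "\<forall>\<^sub>F L in at_top. Linf_norm (\<lambda>x. (\<Sum>n | lam n \<le> L. f n x) - g x) < a"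
      using eventually_ge_at_top[of "lam N"]
    proof eventually_elim
      case (elim L)
      then have "N \<in> {..<r L}" unfolding set_eq[symmetric] by simp
      then have "N \<le> r L" by simp
      have "Linf_norm (\<lambda>x. (\<Sum>n | lam n \<le> L. f n x) - g x) \<le> ennreal e"
        unfolding Linf_norm_def
      proof (rule esssup_I)
        show "AE x in lborel. ennreal (norm ((\<Sum>n | lam n \<le> L. f n x) - g x)) \<le> ennreal e"
          using all
        proof eventually_elim
          case (elim x)
          then show ?case using N[OF \<open>N \<le> r L\<close>, of x] by (intro ennreal_leI) (simp add: set_eq)
        qed
      qed measurable
      then show ?case using b e by simp
    qed
  qed simp
qed

theorem theorem2p6:
  fixes lam :: "nat \<Rightarrow> real"
    and \<phi> :: "nat \<Rightarrow> 'a::euclidean_space \<Rightarrow> complex"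
    and c :: "nat \<Rightarrow> complex"
    and M :: "'w measure"
    and X :: "nat \<Rightarrow> 'w \<Rightarrow> real"
  assumes lam_mono: "mono lam"
    and basis: "L2_orthonormal_basis \<phi>"
    and eigen: "\<And>n. harm_osc_L2 (\<phi> n) (\<lambda>x. of_real (lam n) * \<phi> n x)"
    and coeffs: "\<exists>\<alpha>>1. summable (\<lambda>i. let j = Suc i in
      real j powr gamma_exp DIM('a) * ln (real j) powr \<alpha> * window_max lam c j)"
    and prob: "prob_space M"
    and indep: "prob_space.indep_vars M (\<lambda>_. borel) X UNIV"
    and ident: "\<And>m n. distr M borel (X m) = distr M borel (X n)"
    and symmetric: "\<And>n. distr M borel (\<lambda>\<omega>. - X n \<omega>) = distr M borel (X n)"
    and nonconst: "\<And>n. \<not> (\<exists>a. AE \<omega> in M. X n \<omega> = a)"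
    and subgaussian: "\<exists>\<sigma>>0. \<forall>r::real.
      integrable M (\<lambda>\<omega>. exp (r * X 1 \<omega>)) \<and>
      (LINT \<omega>|M. exp (r * X 1 \<omega>)) \<le> exp (1 / 2 * \<sigma>\<^sup>2 * r\<^sup>2)"
  shows "AE \<omega> in M. \<exists>u. tempered_distribution u \<and>
    distr_sums (\<lambda>n. distr_of_fun (\<lambda>x. c n * of_real (X n \<omega>) * \<phi> n x)) u \<and>
    tendsto_Linf (\<lambda>\<Lambda> x. \<Sum>n | lam n \<le> \<Lambda>. c n * of_real (X n \<omega>) * \<phi> n x) u at_top \<and>
    (\<exists>g\<in>bcontfun. distr_eq u (distr_of_fun g))"
proof -
  interpret prob_space M by (rule prob)
  let ?I = "\<lambda>k. multi_indices (Basis :: 'a set) k"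
  obtain \<sigma> where \<sigma>: "\<sigma> > 0" and mgf: "\<And>r. integrable M (\<lambda>\<omega>. exp (r * X 1 \<omega>))"
    "\<And>r. expectation (\<lambda>\<omega>. exp (r * X 1 \<omega>)) \<le> exp (1 / 2 * \<sigma>\<^sup>2 * r\<^sup>2)"
    using subgaussian by blast
  have X_meas: "X n \<in> borel_measurable M" for n using indep by (auto simp: indep_vars_def)
  \<comment> \<open>The exponential moments are given for \<open>X 1\<close>; equality of laws
    carries them to every \<open>n\<close>.\<close>
  have transfer: "integrable M (\<lambda>\<omega>. exp (r * X n \<omega>)) \<longleftrightarrow> integrable M (\<lambda>\<omega>. exp (r * X 1 \<omega>))"
    "expectation (\<lambda>\<omega>. exp (r * X n \<omega>)) = expectation (\<lambda>\<omega>. exp (r * X 1 \<omega>))" for r n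
  proof -
    have e: "(\<lambda>x::real. exp (r * x)) \<in> borel_measurable borel" by measurable
    show "integrable M (\<lambda>\<omega>. exp (r * X n \<omega>)) \<longleftrightarrow> integrable M (\<lambda>\<omega>. exp (r * X 1 \<omega>))"
      using integrable_distr_eq[OF X_meas[of n] e] integrable_distr_eq[OF X_meas[of 1] e] ident[of n 1] by simp
    show "expectation (\<lambda>\<omega>. exp (r * X n \<omega>)) = expectation (\<lambda>\<omega>. exp (r * X 1 \<omega>))"
      using integral_distr[OF X_meas[of n] e] integral_distr[OF X_meas[of 1] e] ident[of n 1] by simp
  qed
  interpret subgaussian_sequence M X \<sigma>
  proof unfold_locales
    show "integrable M (\<lambda>\<omega>. exp (r * X n \<omega>))" for n r using mgf(1) transfer(1) by blast
    show "expectation (\<lambda>\<omega>. exp (r * X n \<omega>)) \<le> exp (1 / 2 * \<sigma>\<^sup>2 * r\<^sup>2)" for n r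
      by (subst transfer(2)) (rule mgf(2))
  qed (rule indep, rule \<sigma>)
  have orth: "L2_inner (\<phi> m) (\<phi> n) = (if m = n then 1 else 0)" for m n
    using basis by (simp add: L2_orthonormal_basis_def)
  have "\<forall>n. \<exists>k. lam n = 2 * real k + DIM('a) \<and> (AE x in lborel. \<phi> n x = hermite_proj (\<phi> n) k x)"
    using eigenfunction_expansion[OF eigen] orth by simp
  then obtain k where k: "\<And>n. lam n = 2 * real (k n) + DIM('a)"
    "\<And>n. AE x in lborel. \<phi> n x = hermite_proj (\<phi> n) (k n) x" by metis
  \<comment> \<open>The continuous representative of \<open>\<phi> n\<close>, for which pointwise
    estimates make sense.\<close>
  define \<psi> where "\<psi> n = hermite_proj (\<phi> n) (k n)" for n
  define U where "U n = hermite_coeff (\<phi> n)" for n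
  have \<psi>_eq: "\<psi> n x = (\<Sum>\<alpha>\<in>?I (k n). U n \<alpha> * hermite_tensor \<alpha> x)" for n x
    by (simp add: \<psi>_def hermite_proj_def U_def)
  have \<phi>_meas[measurable]: "\<phi> n \<in> borel_measurable borel" for n
    using basis by (simp add: L2_orthonormal_basis_def L2_fun_def)
  have \<psi>_cont: "continuous_on UNIV (\<psi> n)" for n
    unfolding \<psi>_def by (intro hermite_span_continuous hermite_span_proj)
  have U_orth: "(\<Sum>\<alpha>\<in>?I (k n). U m \<alpha> * cnj (U n \<alpha>)) = (if m = n then 1 else 0)" if "k m = k n" for m n
  proof -
    have "L2_inner (\<phi> m) (\<phi> n) = L2_inner (\<psi> m) (\<psi> n)"
      unfolding L2_inner_def
    proof (rule integral_cong_AE)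
      have cnj_meas: "(\<lambda>x. cnj (h x)) \<in> borel_measurable borel" if "h \<in> borel_measurable borel" for h :: "'a \<Rightarrow> complex"
        by (rule borel_measurable_continuous_on[OF _ that]) (intro continuous_intros)
      have \<psi>_meas: "\<psi> n \<in> borel_measurable borel" for n using \<psi>_cont by (rule borel_measurable_continuous_onI)
      show "(\<lambda>x. \<phi> m x * cnj (\<phi> n x)) \<in> borel_measurable lborel"
        "(\<lambda>x. \<psi> m x * cnj (\<psi> n x)) \<in> borel_measurable lborel"
        using cnj_meas \<phi>_meas \<psi>_meas by (auto intro: borel_measurable_times)
      show "AE x in lborel. \<phi> m x * cnj (\<phi> n x) = \<psi> m x * cnj (\<psi> n x)"
        using k(2)[of m] k(2)[of n] by eventually_elim (simp add: \<psi>_def)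
    qed
    then show ?thesis
      using L2_inner_hermite_proj[of "\<phi> m" "k n" "\<phi> n"] orth[of m n] that by (simp add: \<psi>_def U_def)
  qed
  have U_unit: "(\<Sum>\<alpha>\<in>?I (k n). (norm (U n \<alpha>))\<^sup>2) = 1" for n
  proof -
    have "complex_of_real (\<Sum>\<alpha>\<in>?I (k n). (norm (U n \<alpha>))\<^sup>2) = (\<Sum>\<alpha>\<in>?I (k n). U n \<alpha> * cnj (U n \<alpha>))"
      by (simp add: complex_norm_square[symmetric])
    also have "\<dots> = 1" using U_orth[of n n] by simp
    finally show ?thesis by (simp only: of_real_eq_1_iff)
  qed
  have bessel: "(\<Sum>n\<in>N. (norm (\<Sum>\<alpha>\<in>?I l. U n \<alpha> * v \<alpha>))\<^sup>2) \<le> (\<Sum>\<alpha>\<in>?I l. (norm (v \<alpha>))\<^sup>2)"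
    if "finite N" "N \<subseteq> {n. k n = l}" for N l v
  proof (rule finite_bessel)
    fix m n assume "m \<in> N" "n \<in> N"
    then have "k m = l" "k n = l" using that by auto
    then show "(\<Sum>\<alpha>\<in>?I l. U m \<alpha> * cnj (U n \<alpha>)) = (if m = n then 1 else 0)" using U_orth[of m n] by simp
  qed (use that in auto)
  \<comment> \<open>Multiplicity by double counting: the rows are unit vectors, and Bessel's
    inequality against the indicator of one \<open>\<alpha>\<close> bounds every column by
    1.\<close>
  have fiber: "finite {n. k n = l} \<and> card {n. k n = l} \<le> (l + 1) ^ DIM('a)" for l
  proof (rule finite_if_finite_subsets_card_bdd)
    fix N assume N: "N \<subseteq> {n. k n = l}" "finite N"
    have "real (card N) = (\<Sum>n\<in>N. \<Sum>\<alpha>\<in>?I l. (norm (U n \<alpha>))\<^sup>2)"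
    proof -
      have "(\<Sum>\<alpha>\<in>?I l. (norm (U n \<alpha>))\<^sup>2) = 1" if "n \<in> N" for n
        using U_unit[of n] N that by auto
      then show ?thesis by simp
    qed
    also have "\<dots> = (\<Sum>\<alpha>\<in>?I l. \<Sum>n\<in>N. (norm (U n \<alpha>))\<^sup>2)" by (rule sum.swap)
    also have "\<dots> \<le> (\<Sum>\<alpha>\<in>?I l. 1)"
    proof (rule sum_mono)
      fix \<alpha> assume \<alpha>: "\<alpha> \<in> ?I l"
      have "(\<Sum>n\<in>N. (norm (\<Sum>\<beta>\<in>?I l. U n \<beta> * (if \<beta> = \<alpha> then 1 else 0)))\<^sup>2)
          \<le> (\<Sum>\<beta>\<in>?I l. (norm (if \<beta> = \<alpha> then 1 else 0 :: complex))\<^sup>2)"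
        by (rule bessel[OF N(2,1)])
      also have "\<dots> = (\<Sum>\<beta>\<in>?I l. if \<beta> = \<alpha> then 1 else 0)" by (intro sum.cong) auto
      finally show "(\<Sum>n\<in>N. (norm (U n \<alpha>))\<^sup>2) \<le> 1"
        using \<alpha> by (simp add: if_distrib[where f = "\<lambda>z. _ * z"] cong: if_cong)
    qed
    also have "\<dots> = real (card (?I l))" by simp
    finally show "card N \<le> (l + 1) ^ DIM('a)"
      using card_multi_indices_le[of "Basis :: 'a set" l] by simp
  qed
  have U_le: "norm (U n \<alpha>) \<le> 1" if "\<alpha> \<in> ?I (k n)" for n \<alpha>
  proof (rule power2_le_imp_le)
    have "(norm (U n \<alpha>))\<^sup>2 \<le> (\<Sum>\<alpha>\<in>?I (k n). (norm (U n \<alpha>))\<^sup>2)"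
      using that by (intro member_le_sum) auto
    also have "\<dots> = 1" by (rule U_unit)
    finally show "(norm (U n \<alpha>))\<^sup>2 \<le> 1\<^sup>2" by simp
  qed simp
  \<comment> \<open>The window of \<open>lam n = 2 * k n + d\<close> has number
    \<open>k n + d div 2\<close>, for either parity of the dimension.\<close>
  define h where "h = DIM('a) div 2"
  define J where "J n = k n + h" for n
  \<comment> \<open>The dimension for the number of tensors in one level, and 1 for the linear
    growth of their Lipschitz constants.\<close>
  define p where "p = DIM('a) + 1"
  have J_mono: "mono J"
    using monoD[OF lam_mono] by (intro monoI) (simp add: J_def k)
  have J_set: "{n. J n = j} = (if j < h then {} else {n. k n = j - h})" for j
    by (auto simp: J_def)
  have fin_J: "finite {n. J n = j}" for j unfolding J_set using fiber by simp
  have card_J: "card {n. J n = j} \<le> (j + 1) ^ p" for j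
  proof (cases "j < h")
    case False
    have "card {n. k n = j - h} \<le> (j - h + 1) ^ DIM('a)" using fiber by blast
    also have "\<dots> \<le> (j + 1) ^ DIM('a)" by (intro power_mono) auto
    also have "\<dots> \<le> (j + 1) ^ p" by (intro power_increasing) (auto simp: p_def)
    finally show ?thesis using False by (simp add: J_set)
  qed (simp add: J_set)
  have window: "spectral_window lam j = {n. J n = j}" for j
  proof (intro set_eqI)
    fix n
    have "n \<in> spectral_window lam j \<longleftrightarrow> real (2 * j) \<le> real (2 * k n + DIM('a)) \<and> real (2 * k n + DIM('a)) < real (2 * j + 2)"
      by (simp add: spectral_window_def k algebra_simps)
    also have "\<dots> \<longleftrightarrow> J n = j" unfolding of_nat_le_iff of_nat_less_iff J_def h_def by presburger
    finally show "n \<in> spectral_window lam j \<longleftrightarrow> n \<in> {n. J n = j}" by simp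
  qed
  \<comment> \<open>One summand for the spectral bound, one for the Lipschitz and decay
    bounds.\<close>
  define C :: real where "C = 7000 * 39 ^ DIM('a) + 9 ^ DIM('a) * real (DIM('a) * 2)"
  have C: "C \<ge> 0" by (simp add: C_def)
  have poly: "(\<Sum>\<alpha>\<in>?I (k n). norm (U n \<alpha>) * (9 ^ DIM('a) * (DIM('a) * 2 * (real (k n) + 1)))) \<le> C * (real (J n) + 1) ^ p" for n
  proof -
    have "(\<Sum>\<alpha>\<in>?I (k n). norm (U n \<alpha>) * (9 ^ DIM('a) * (DIM('a) * 2 * (real (k n) + 1))))
        \<le> (\<Sum>\<alpha>\<in>?I (k n). 1 * (C * (real (J n) + 1)))"
    proof (rule sum_mono)
      fix \<alpha> assume \<alpha>: "\<alpha> \<in> ?I (k n)"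
      have "(9 ^ DIM('a) * real (DIM('a) * 2)) * (real (k n) + 1) \<le> C * (real (J n) + 1)"
        by (intro mult_mono) (auto simp: C_def J_def)
      then have "9 ^ DIM('a) * (real (DIM('a) * 2) * (real (k n) + 1)) \<le> C * (real (J n) + 1)" by (simp only: mult.assoc)
      then show "norm (U n \<alpha>) * (9 ^ DIM('a) * (DIM('a) * 2 * (real (k n) + 1))) \<le> 1 * (C * (real (J n) + 1))"
        by (rule mult_mono[OF U_le[OF \<alpha>]]) auto
    qed
    also have "\<dots> = real (card (?I (k n))) * (C * (real (J n) + 1))" by simp
    also have "\<dots> \<le> (real (J n) + 1) ^ DIM('a) * (C * (real (J n) + 1))"
    proof (rule mult_right_mono)
      have "card (?I (k n)) \<le> (J n + 1) ^ DIM('a)"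
        by (rule order_trans[OF card_multi_indices_le]) (auto simp: J_def intro!: power_mono)
      then have "real (card (?I (k n))) \<le> real ((J n + 1) ^ DIM('a))" by (rule of_nat_mono)
      then show "real (card (?I (k n))) \<le> (real (J n) + 1) ^ DIM('a)" by (simp add: add.commute)
      show "0 \<le> C * (real (J n) + 1)" using C by simp
    qed
    finally show ?thesis by (simp add: p_def mult_ac)
  qed
  have idx_le: "\<alpha> b \<le> l" if "\<alpha> \<in> ?I l" "b \<in> Basis" for \<alpha> l b
    using multi_indices_subset[of "Basis :: 'a set" l] that by (auto simp: PiE_iff)
  have \<psi>_lip: "norm (\<psi> n x - \<psi> n y) \<le> C * (real (J n) + 1) ^ p * norm (x - y)" for n x y
  proof -
    have "norm (\<psi> n x - \<psi> n y) \<le> (\<Sum>\<alpha>\<in>?I (k n). norm (U n \<alpha> * (hermite_tensor \<alpha> x - hermite_tensor \<alpha> y)))"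
      unfolding \<psi>_eq sum_subtractf[symmetric] right_diff_distrib[symmetric] by (rule norm_sum)
    also have "\<dots> \<le> (\<Sum>\<alpha>\<in>?I (k n). norm (U n \<alpha>) * (9 ^ DIM('a) * (DIM('a) * 2 * (real (k n) + 1)) * norm (x - y)))"
      unfolding norm_mult by (intro sum_mono mult_left_mono hermite_tensor_lipschitz) (auto intro: idx_le)
    also have "\<dots> = (\<Sum>\<alpha>\<in>?I (k n). norm (U n \<alpha>) * (9 ^ DIM('a) * (DIM('a) * 2 * (real (k n) + 1)))) * norm (x - y)"
      unfolding sum_distrib_right by (simp only: mult.assoc)
    also have "\<dots> \<le> C * (real (J n) + 1) ^ p * norm (x - y)"
      by (intro mult_right_mono poly) auto
    finally show ?thesis .
  qed
  have \<psi>_dec: "norm x * norm (\<psi> n x) \<le> C * (real (J n) + 1) ^ p" for n x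
  proof -
    have "norm x * norm (\<psi> n x) \<le> norm x * (\<Sum>\<alpha>\<in>?I (k n). norm (U n \<alpha> * hermite_tensor \<alpha> x))"
      unfolding \<psi>_eq by (intro mult_left_mono norm_sum) auto
    also have "\<dots> = (\<Sum>\<alpha>\<in>?I (k n). norm (U n \<alpha>) * (norm x * norm (hermite_tensor \<alpha> x)))"
      unfolding sum_distrib_left norm_mult by (simp only: mult.left_commute)
    also have "\<dots> \<le> (\<Sum>\<alpha>\<in>?I (k n). norm (U n \<alpha>) * (9 ^ DIM('a) * (DIM('a) * 2 * (real (k n) + 1))))"
      by (intro sum_mono mult_left_mono norm_mult_hermite_tensor_le) (auto intro: idx_le)
    finally show ?thesis using poly[of n] by linarith
  qed
  have \<psi>_spec: "(\<Sum>n | J n = j. (norm (\<psi> n x))\<^sup>2) \<le> C * real j powr gamma_exp DIM('a)" if j: "j \<ge> 1" for j x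
  proof (cases "j < h")
    case True
    then show ?thesis using C by (simp add: J_set)
  next
    case False
    define l where "l = j - h"
    have "(\<Sum>n | J n = j. (norm (\<psi> n x))\<^sup>2) = (\<Sum>n | k n = l. (norm (\<Sum>\<alpha>\<in>?I l. U n \<alpha> * hermite_tensor \<alpha> x))\<^sup>2)"
      using False by (intro sum.cong) (auto simp: J_set l_def \<psi>_eq)
    also have "\<dots> \<le> (\<Sum>\<alpha>\<in>?I l. (norm (hermite_tensor \<alpha> x))\<^sup>2)"
      using fiber[of l] by (intro bessel) auto
    also have "\<dots> \<le> 7000 * 39 ^ DIM('a) * (real l + 1) powr gamma_exp DIM('a)"
      by (rule sum_norm_hermite_tensor_le)
    also have "\<dots> \<le> C * real j powr gamma_exp DIM('a)"
    proof (rule mult_mono)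
      \<comment> \<open>The exponent changes sign with the dimension: for \<open>d = 1\<close> it is
        negative and \<open>h = 0\<close> gives \<open>l + 1 > j\<close>; for
        \<open>d \<ge> 2\<close> it is nonnegative and \<open>h \<ge> 1\<close> gives
        \<open>l + 1 \<le> j\<close>.\<close>
      show "(real l + 1) powr gamma_exp DIM('a) \<le> real j powr gamma_exp DIM('a)"
      proof (cases "DIM('a) = 1")
        case True
        then have "l = j" by (simp add: l_def h_def)
        then show ?thesis using True j by (simp add: gamma_exp_def powr_mono2')
      next
        case False
        then have d: "DIM('a) \<ge> 2" using DIM_positive[where 'a = 'a] by linarith
        then have "h \<ge> 1" by (simp add: h_def)
        then have "real l + 1 \<le> real j" using \<open>\<not> j < h\<close> by (simp add: l_def)
        moreover have "gamma_exp DIM('a) \<ge> 0" using d False by (simp add: gamma_exp_def)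
        ultimately show ?thesis by (intro powr_mono2) auto
      qed
    qed (auto simp: C_def)
    finally show ?thesis .
  qed
  obtain \<alpha> where \<alpha>: "\<alpha> > 1" and summ: "summable (\<lambda>i. let j = Suc i in
      real j powr gamma_exp DIM('a) * ln (real j) powr \<alpha> * window_max lam c j)" using coeffs by blast
  have w_ge: "(norm (c n))\<^sup>2 \<le> window_max lam c (J n)" for n
    unfolding window_max_def window using fin_J by auto
  have w_nonneg: "0 \<le> window_max lam c j" for j
  proof (cases "{n. J n = j} = {}")
    case False
    then obtain n where "J n = j" by blast
    then show ?thesis using w_ge[of n] by (auto intro: order_trans[OF zero_le_power2])
  qed (simp add: window_max_def window)
  have "AE \<omega> in M. uniformly_convergent_on UNIV (\<lambda>r x. \<Sum>n<r. c n * of_real (X n \<omega>) * \<psi> n x)"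
  proof (rule AE_uniformly_convergent[where J = J and \<psi> = \<psi> and w = "window_max lam c" and p = p and C = C,
        OF J_mono fin_J card_J C \<psi>_lip \<psi>_dec \<psi>_spec w_nonneg w_ge \<alpha>])
    show "- 1 \<le> gamma_exp DIM('a)" by (simp add: gamma_exp_def)
    \<comment> \<open>The series in \<open>coeffs\<close> starts at level 1; adding the term of
      index 0 does not affect summability.\<close>
    show "summable (\<lambda>j. real j powr gamma_exp DIM('a) * ln (real j) powr \<alpha> * window_max lam c j)"
      by (subst summable_Suc_iff[symmetric]) (use summ in \<open>simp add: Let_def\<close>)
  qed
  then show ?thesis
  proof eventually_elim
    case (elim \<omega>)
    define F where "F n x = c n * of_real (X n \<omega>) * \<psi> n x" for n x
    define f where "f n x = c n * of_real (X n \<omega>) * \<phi> n x" for n x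
    obtain g where g: "uniform_limit UNIV (\<lambda>r x. \<Sum>n<r. F n x) g sequentially"
      using elim by (auto simp: uniformly_convergent_on_def F_def)
    have F_cont: "continuous_on UNIV (F n)" for n
      unfolding F_def[abs_def] using \<psi>_cont by (intro continuous_intros)
    have g_cont: "continuous_on UNIV g"
      using F_cont by (intro uniform_limit_theorem[OF _ g] always_eventually allI continuous_intros) auto
    have "\<exists>D. \<forall>x. norm (\<psi> n x) \<le> D" for n
      using hermite_span_rapid_decay[OF hermite_span_proj, of 0 "\<phi> n" "k n"] by (simp add: \<psi>_def)
    then obtain D where D: "\<And>n x. norm (\<psi> n x) \<le> D n" by metis
    have F_le: "norm (F n x) \<le> norm (c n * of_real (X n \<omega>)) * D n" for n x
      unfolding F_def norm_mult[of "_ * _"] using D by (intro mult_left_mono) auto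
    obtain r where r: "\<And>x. norm ((\<Sum>n<r. F n x) - g x) < 1"
      using uniform_limitD[OF g, of 1] by (auto simp: eventually_sequentially dist_norm)
    have g_le: "norm (g x) \<le> (\<Sum>n<r. norm (c n * of_real (X n \<omega>)) * D n) + 1" for x
    proof -
      have "norm (\<Sum>n<r. F n x) \<le> (\<Sum>n<r. norm (c n * of_real (X n \<omega>)) * D n)"
        by (rule order_trans[OF norm_sum]) (intro sum_mono F_le)
      then show ?thesis
        using r[of x] norm_triangle_sub[of "g x" "\<Sum>n<r. F n x"] by (simp add: norm_minus_commute)
    qed
    have f_meas: "f n \<in> borel_measurable borel" for n unfolding f_def[abs_def] by measurable
    have f_AE: "AE x in lborel. f n x = F n x" for n
      using k(2)[of n] by eventually_elim (simp add: f_def F_def \<psi>_def)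
    have lam_fin: "finite {n. lam n \<le> L}" for L
    proof (rule finite_subset)
      show "{n. lam n \<le> L} \<subseteq> {..<(nat \<lceil>L\<rceil> + 1) ^ (p + 1)}"
      proof
        fix n assume "n \<in> {n. lam n \<le> L}"
        then have "real (2 * k n + DIM('a)) \<le> L" by (simp add: k)
        then have "2 * k n + DIM('a) \<le> nat \<lceil>L\<rceil>" by linarith
        then have "J n < nat \<lceil>L\<rceil> + 1" by (simp add: J_def h_def)
        then show "n \<in> {..<(nat \<lceil>L\<rceil> + 1) ^ (p + 1)}"
          unfolding lessThan_iff by (rule index_bound[of J p n, OF J_mono fin_J card_J])
      qed
    qed simp
    have "g \<in> bcontfun"
      using g_cont g_le by (auto simp: bcontfun_def bounded_iff)
    moreover have "distr_eq (distr_of_fun g) (distr_of_fun g)" by (simp add: distr_eq_def)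
    ultimately show ?case
      using tempered_distribution_bounded_continuous[OF g_cont g_le]
        distr_of_fun_sums[OF g g_cont g_le F_cont F_le f_AE f_meas]
        tendsto_Linf_spectral[OF g g_cont g_le f_AE f_meas lam_mono lam_fin]
      unfolding f_def by blast
  qed
qed

end
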